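(* Let $\varepsilon\in\{1,-1\}$, let $k$ be an integer, and put $k_\varepsilon = k-\frac12+\frac{\varepsilon}{2}$ (so $k_\varepsilon=k$ if $\varepsilon=1$ and $k_\varepsilon=k-1$ if $\varepsilon=-1$). Assume $k_\varepsilon\ge 1$ and $k_\varepsilon\not\equiv 1\pmod 3$. Then there are infinitely many primes $p$ such that the integer $2$ is not a square modulo $p$ and, for every $1\le i\le k_\varepsilon$, the inertia degree of $p$ in the extension $\mathbb{Q}(\zeta_{2k_\varepsilon+1}^i+\zeta_{2k_\varepsilon+1}^{-i})/\mathbb{Q}$ is at least two.
   Context: For a positive integer $m$, $\zeta_m=e^{2\pi i/m}$. The inertia degree of $p$ in a Galois extension $E/\mathbb{Q}$ is the degree over $\mathbb{F}_p$ of the residue field of $\mathcal{O}_E$ at any prime above $p$ (independent of the choice of prime). *)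

theory Defs
  imports
    "HOL-Number_Theory.Number_Theory"
    "HOL-Algebra.Algebraic_Closure_Type"
    "HOL-Algebra.Embedded_Algebras"
    "HOL-Algebra.Generated_Fields"
    "HOL-Algebra.QuotRing"
begin

definition zeta :: "int \<Rightarrow> complex" where
  "zeta m = exp (2 * of_real pi * \<i> / of_int m)"

text \<open>Number fields are represented by their carriers, as subfields of \<^typ>\<open>complex\<close>.\<close>

abbreviation complex_ring :: "complex ring" where
  "complex_ring \<equiv> ring_of_type_algebra"

definition rat_adjoin :: "complex \<Rightarrow> complex set" where
  "rat_adjoin x = generate_field complex_ring (insert x \<rat>)"

definition ring_of_integers :: "complex set \<Rightarrow> complex ring" where
  "ring_of_integers E = complex_ring\<lparr>carrier := {x \<in> E. algebraic_int x}\<rparr>"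

definition primes_above :: "complex set \<Rightarrow> nat \<Rightarrow> complex set set" where
  "primes_above E p = {P. primeideal P (ring_of_integers E) \<and> of_nat p \<in> P}"

definition residue_field :: "complex set \<Rightarrow> complex set \<Rightarrow> complex set ring" where
  "residue_field E P = ring_of_integers E Quot P"

text \<open>The image of the integers in the residue field at a prime above \<open>p\<close>; it is the
  prime field with \<open>p\<close> elements.\<close>

definition residue_prime_field :: "complex set \<Rightarrow> complex set \<Rightarrow> complex set set" where
  "residue_prime_field E P = range (\<lambda>n::int. P +>\<^bsub>ring_of_integers E\<^esub> of_int n)"

definition residue_degree :: "complex set \<Rightarrow> complex set \<Rightarrow> nat" where
  "residue_degree E P =
     (THE d. ring.dimension (residue_field E P) d (residue_prime_field E P)
               (carrier (residue_field E P)))"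

text \<open>Meant for prime \<open>p\<close> and \<open>E\<close> a number field that is Galois over the rationals: then
  a prime above \<open>p\<close> exists and the residue degree does not depend on which one is chosen.\<close>

definition inertia_degree :: "complex set \<Rightarrow> nat \<Rightarrow> nat" where
  "inertia_degree E p = residue_degree E (SOME P. P \<in> primes_above E p)"

end

theory Submission
  imports Defs "Jordan_Normal_Form.Char_Poly" "HOL-Analysis.Analysis"
begin

text \<open>
  Put \<open>n = 2 k\<^sub>\<epsilon> + 1\<close>, which is coprime to \<open>6\<close>. By Dirichlet's theorem there are infinitely many primes
  with \<open>p \<equiv> 3 (mod 8)\<close> and \<open>p \<equiv> 2 (mod n)\<close>; for these, \<open>2\<close> is not a square modulo \<open>p\<close>.
  Let \<open>\<omega> \<noteq> 1\<close> be an \<open>n\<close>-th root of unity, \<open>\<alpha> = \<omega> + 1/\<omega>\<close>, and suppose that a prime \<open>P\<close> of \<open>\<rat>(\<alpha>)\<close> above \<open>p\<close>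
  has residue degree one. Then \<open>\<alpha>\<close> is congruent to an integer modulo \<open>P\<close>, so
  \<open>\<alpha> \<equiv> \<alpha>\<^sup>p \<equiv> \<omega>\<^sup>p + 1/\<omega>\<^sup>p = \<alpha>\<^sup>2 - 2\<close>, that is, \<open>P\<close> contains
  \<open>\<alpha>\<^sup>2 - \<alpha> - 2 = (\<omega> - 1) (\<omega>\<^sup>3 - 1) / \<omega>\<^sup>2\<close>. This number divides \<open>n\<^sup>2\<close>, because \<open>\<eta> - 1\<close> divides \<open>n\<close> for every
  \<open>n\<close>-th root of unity \<open>\<eta> \<noteq> 1\<close> and \<open>3\<close> does not divide \<open>n\<close>; hence \<open>p\<close> divides \<open>n\<close>, a contradiction.

  Dirichlet's theorem is derived from the behaviour of the series \<open>L(s, \<psi>)\<close> as \<open>s\<close> decreases to \<open>1\<close> along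
  the reals. That \<open>L(1, \<psi>)\<close> does not vanish follows from the inequality
  \<open>\<bar>L(s, \<psi>\<^sub>0)\<^sup>3 L(s, \<psi>)\<^sup>4 L(s, \<psi>\<^sup>2)\<bar> \<ge> 1\<close> if \<open>\<psi>\<^sup>2\<close> is not principal, and for real \<open>\<psi>\<close> from Monsky's
  argument with the Lambert series \<open>\<Sum>\<psi>(n) t\<^sup>n / (1 - t\<^sup>n)\<close> as \<open>t\<close> tends to \<open>1\<close>.
\<close>

section \<open>Algebraic integers\<close>

text \<open>Modulo \<open>n\<close> the prime is 2, so the Frobenius squares \<omega> and maps
  \<alpha> to \<open>\<alpha>\<^sup>2 - 2\<close>. A fixed \<alpha> satisfies (\<alpha> - 2)
  (\<alpha> + 1) = 0, which means that \<omega> is 1 or of order 3. The second case, where \<alpha>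
  = -1 and the field is \<rat>, is the one that \<open>k\<epsilon>\<close> not congruent to 1 modulo
  3 excludes. The class 3 modulo 8 is compatible with 2 modulo \<open>n\<close> because
  \<open>n\<close> is odd. Two obstacles shape the algebra. First, \<omega> lies outside the field
  of \<alpha>, in which \<open>P\<close> lives. Divisibilities are therefore proved among all
  complex algebraic integers, and each cofactor is then recognised as an element of the field
  because it is a quotient of two elements of it. Second, \<open>residue_degree\<close> is a
  definite description and \<open>inertia_degree\<close> rests on an arbitrary choice. A bound thus
  requires that a prime above \<open>p\<close> exists, that the residue ring has a dimension at all,
  and that the argument covers every prime above \<open>p\<close>. The dimension exists because the
  field is finite-dimensional over \<rat>.\<close>

interpretation int_span: Modules.module "\<lambda>(n::int) (x::complex). of_int n * x"
  by unfold_locales (auto simp: algebra_simps)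

interpretation rat_span: Vector_Spaces.vector_space "\<lambda>(q::rat) (x::complex). of_rat q * x"
  by unfold_locales (auto simp: algebra_simps of_rat_add of_rat_mult)

text \<open>The determinant trick: multiplication by \<open>x\<close> acts on the generators through
  an integer matrix, with the vector of generators as eigenvector (nonzero because of
  \<open>s\<close>). So \<open>x\<close> is a root of a monic characteristic polynomial.\<close>

lemma algebraic_int_if_span_invariant:
  fixes x :: complex
  assumes "finite S" and "s \<in> S" "s \<noteq> 0"
    and stable: "\<And>v. v \<in> S \<Longrightarrow> x * v \<in> int_span.span S"
  shows "algebraic_int x"
proof -
  obtain vs where vs: "set vs = S" "distinct vs"
    using finite_distinct_list[OF assms(1)] by blast
  define n where "n = length vs"
  have "\<exists>c. x * vs ! i = (\<Sum>v\<in>S. of_int (c v) * v)" if "i < n" for i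
    using stable[of "vs ! i"] that vs int_span.span_finite[OF assms(1)]
    unfolding n_def by (auto dest: nth_mem)
  then obtain c :: "nat \<Rightarrow> complex \<Rightarrow> int"
    where c: "\<And>i. i < n \<Longrightarrow> x * vs ! i = (\<Sum>v\<in>S. of_int (c i v) * v)"
    by metis
  have sum_nth: "(\<Sum>v\<in>S. f v) = (\<Sum>j<n. f (vs ! j))" for f :: "complex \<Rightarrow> complex"
    using sum.reindex_bij_betw[OF bij_betw_nth[OF vs(2) refl refl], of f]
    by (simp add: vs n_def)
  define A where "A = Matrix.mat n n (\<lambda>(i, j). c i (vs ! j))"
  define A' :: "complex mat" where "A' = map_mat of_int A"
  have A: "A \<in> carrier_mat n n" and A': "A' \<in> carrier_mat n n"
    by (auto simp: A_def A'_def)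
  define V where "V = Matrix.vec n (\<lambda>i. vs ! i)"
  obtain j where j: "j < n" "vs ! j = s"
    using assms(2) vs n_def by (metis in_set_conv_nth)
  have "A' *\<^sub>v V = x \<cdot>\<^sub>v V"
  proof (rule eq_vecI)
    fix i assume "i < dim_vec (x \<cdot>\<^sub>v V)"
    hence i: "i < n" by (simp add: V_def)
    thus "(A' *\<^sub>v V) $ i = (x \<cdot>\<^sub>v V) $ i"
      using c[OF i] unfolding sum_nth
      by (simp add: A'_def A_def V_def scalar_prod_def atLeast0LessThan)
  qed (use A' in \<open>auto simp: V_def\<close>)
  moreover have "V \<noteq> 0\<^sub>v (dim_row A')"
  proof
    assume "V = 0\<^sub>v (dim_row A')"
    hence "V $ j = 0\<^sub>v n $ j" using A' by auto
    with j assms(3) show False by (simp add: V_def)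
  qed
  ultimately have "eigenvalue A' x"
    using A' unfolding eigenvalue_def eigenvector_def by (auto simp: V_def intro!: exI[of _ V])
  hence "poly (char_poly A') x = 0"
    using eigenvalue_root_char_poly[OF A'] by blast
  moreover have "char_poly A' = map_poly of_int (char_poly A)"
    unfolding A'_def by (rule of_int_hom.char_poly_hom[OF A])
  moreover have "lead_coeff (char_poly A) = 1"
    using degree_monic_char_poly[OF A] by simp
  ultimately show ?thesis
    unfolding algebraic_int_altdef_ipoly by metis
qed

lemma int_span_mult_closed:
  assumes "\<And>v. v \<in> S \<Longrightarrow> x * v \<in> int_span.span T" and "w \<in> int_span.span S"
  shows "x * w \<in> int_span.span T"
  using assms(2)
proof (induction rule: int_span.span_induct_alt)
  case base
  thus ?case by (simp add: int_span.span_zero)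
next
  case (step c v w)
  have "x * (of_int c * v + w) = of_int c * (x * v) + x * w"
    by (simp add: algebra_simps)
  thus ?case
    using step assms(1) by (simp add: int_span.span_add int_span.span_scale)
qed

lemma algebraic_int_power_in_span:
  assumes "algebraic_int x"
  obtains n where "n > 0" "x ^ n \<in> int_span.span ((\<lambda>i. x ^ i) ` {..<n})"
proof -
  obtain p :: "int poly" where p: "poly (map_poly of_int p) x = 0" "lead_coeff p = 1"
    using assms unfolding algebraic_int_altdef_ipoly by blast
  define n where "n = Polynomial.degree p"
  have "n > 0"
  proof (rule ccontr)
    assume "\<not> n > 0"
    hence "p = 1" using p(2) n_def by (auto elim!: degree_eq_zeroE simp: one_pCons)
    with p(1) show False by simp
  qed
  have "0 = (\<Sum>i\<le>n. of_int (Polynomial.coeff p i) * x ^ i)"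
    using p(1) by (simp add: poly_altdef n_def)
  also have "\<dots> = (\<Sum>i<n. of_int (Polynomial.coeff p i) * x ^ i) + x ^ n"
    using p(2) by (simp add: n_def lessThan_Suc_atMost[symmetric])
  finally have "x ^ n = - (\<Sum>i<n. of_int (Polynomial.coeff p i) * x ^ i)"
    by (simp add: eq_neg_iff_add_eq_0 add.commute)
  also have "\<dots> \<in> int_span.span ((\<lambda>i. x ^ i) ` {..<n})"
    by (intro int_span.span_neg int_span.span_sum int_span.span_scale int_span.span_base) auto
  finally show ?thesis using \<open>n > 0\<close> that by blast
qed

text \<open>The monomials \<open>x ^ i * y ^ j\<close> below the exponents of two monic relations
  span a module that contains 1 and is stable under \<open>x\<close> and \<open>y\<close>, hence
  under their sum and product.\<close>

lemma algebraic_int_add_mult: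
  fixes x y :: complex
  assumes "algebraic_int x" "algebraic_int y"
  shows "algebraic_int (x + y)" "algebraic_int (x * y)"
proof -
  obtain m where m: "m > 0" "x ^ m \<in> int_span.span ((\<lambda>i. x ^ i) ` {..<m})"
    using algebraic_int_power_in_span[OF assms(1)] by blast
  obtain n where n: "n > 0" "y ^ n \<in> int_span.span ((\<lambda>i. y ^ i) ` {..<n})"
    using algebraic_int_power_in_span[OF assms(2)] by blast
  define S where "S = (\<lambda>(i, j). x ^ i * y ^ j) ` ({..<m} \<times> {..<n})"
  have S: "x ^ i * y ^ j \<in> int_span.span S" if "i < m" "j < n" for i j
    using that by (intro int_span.span_base) (auto simp: S_def)
  have S': "y ^ j * x ^ i \<in> int_span.span S" if "i < m" "j < n" for i j
    using S[OF that] by (simp add: mult.commute)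
  have x: "x * v \<in> int_span.span S" if v: "v \<in> S" for v
  proof -
    obtain i j where ij: "i < m" "j < n" "v = x ^ i * y ^ j"
      using v by (auto simp: S_def)
    show ?thesis
    proof (cases "Suc i < m")
      case True
      thus ?thesis using S[of "Suc i" j] ij by (simp add: mult.assoc)
    next
      case False
      hence "m = Suc i" using ij by simp
      \<comment> \<open>At the top exponent the monic relation for \<open>x ^ m\<close>, multiplied
        by \<open>y ^ j\<close>, leads back into the span.\<close>
      hence "x * v = y ^ j * x ^ m" using ij by (simp add: algebra_simps)
      thus ?thesis
        using int_span_mult_closed[OF _ m(2), of "y ^ j" S] S' ij(2) by auto
    qed
  qed
  have y: "y * v \<in> int_span.span S" if v: "v \<in> S" for v
  proof -
    obtain i j where ij: "i < m" "j < n" "v = x ^ i * y ^ j"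
      using v by (auto simp: S_def)
    show ?thesis
    proof (cases "Suc j < n")
      case True
      thus ?thesis using S[of i "Suc j"] ij by (simp add: algebra_simps)
    next
      case False
      hence "n = Suc j" using ij by simp
      hence "y * v = x ^ i * y ^ n" using ij by (simp add: algebra_simps)
      thus ?thesis
        using int_span_mult_closed[OF _ n(2), of "x ^ i" S] S ij(1) by auto
    qed
  qed
  have "finite S" and one: "1 \<in> S"
    using m(1) n(1) by (auto simp: S_def intro!: image_eqI[of _ _ "(0, 0)"])
  show "algebraic_int (x + y)"
    using \<open>finite S\<close> one by (rule algebraic_int_if_span_invariant)
      (auto simp: distrib_right intro!: int_span.span_add x y)
  show "algebraic_int (x * y)"
    using \<open>finite S\<close> one by (rule algebraic_int_if_span_invariant)
      (auto simp: mult.assoc intro!: int_span_mult_closed[OF x] y)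
qed

lemma algebraic_int_power:
  fixes x :: complex
  assumes "algebraic_int x"
  shows "algebraic_int (x ^ n)"
  by (induction n) (auto intro: algebraic_int_add_mult assms)

lemma algebraic_int_sum:
  fixes f :: "'a \<Rightarrow> complex"
  assumes "\<And>i. i \<in> I \<Longrightarrow> algebraic_int (f i)"
  shows "algebraic_int (sum f I)"
  using assms by (induction I rule: infinite_finite_induct) (auto intro: algebraic_int_add_mult)

lemma algebraic_int_root_of_unity:
  fixes x :: complex
  assumes "x ^ n = 1" "n > 0"
  shows "algebraic_int x"
  by (rule algebraic_int_root[of 1 "Polynomial.monom 1 n"])
     (use assms in \<open>auto simp: poly_monom degree_monom_eq\<close>)

section \<open>Rings of integers and residue fields\<close>

lemma complex_ring_simps [simp]:
  "carrier complex_ring = UNIV" "x \<otimes>\<^bsub>complex_ring\<^esub> y = x * y" "x \<oplus>\<^bsub>complex_ring\<^esub> y = x + y"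
  "\<one>\<^bsub>complex_ring\<^esub> = 1" "\<zero>\<^bsub>complex_ring\<^esub> = 0"
  by (simp_all add: ring_of_type_algebra_def)

lemma field_complex_ring: "Ring.field complex_ring"
  by (rule field_from_type_algebra)

interpretation complex_ring: cring complex_ring
  by (rule cring_from_type_algebra)

lemma complex_ring_a_inv [simp]: "\<ominus>\<^bsub>complex_ring\<^esub> x = - x"
  by (rule complex_ring.add.inv_equality[simplified]) auto

lemma complex_ring_m_inv:
  assumes "x \<noteq> 0"
  shows "inv\<^bsub>complex_ring\<^esub> x = inverse x"
  using assms complex_ring.comm_inv_char[of x "inverse x"] by simp

lemma subfield_complexE:
  assumes "subfield E complex_ring"
  shows "0 \<in> E" "1 \<in> E" "x \<in> E \<Longrightarrow> y \<in> E \<Longrightarrow> x + y \<in> E" "x \<in> E \<Longrightarrow> y \<in> E \<Longrightarrow> x * y \<in> E"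
    "x \<in> E \<Longrightarrow> - x \<in> E" "x \<in> E \<Longrightarrow> y \<in> E \<Longrightarrow> x - y \<in> E" "of_int n \<in> E" "x \<in> E \<Longrightarrow> x ^ m \<in> E"
    "x \<in> E \<Longrightarrow> inverse x \<in> E"
proof -
  interpret E: subfield E complex_ring by fact
  have r: "subring E complex_ring" by (rule E.subring_axioms)
  note [simp] = subringE[OF r, simplified]
  show 0: "0 \<in> E" and 1: "1 \<in> E" by simp_all
  show "x \<in> E \<Longrightarrow> y \<in> E \<Longrightarrow> x + y \<in> E" "x \<in> E \<Longrightarrow> y \<in> E \<Longrightarrow> x * y \<in> E"
    "x \<in> E \<Longrightarrow> - x \<in> E" by simp_all
  show "x \<in> E \<Longrightarrow> y \<in> E \<Longrightarrow> x - y \<in> E"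
    using subringE(7)[OF r, of x "-y"] subringE(5)[OF r, of y] by simp
  have nat: "of_nat k \<in> E" for k
    by (induction k) auto
  thus "of_int n \<in> E"
    by (cases n rule: int_cases2) auto
  show "x \<in> E \<Longrightarrow> x ^ m \<in> E"
    by (induction m) auto
  show "x \<in> E \<Longrightarrow> inverse x \<in> E"
    using complex_ring.subfield_m_inv(1)[OF assms, of x] 0
    by (cases "x = 0") (auto simp: complex_ring_m_inv)
qed

lemma subfield_rat_adjoin: "subfield (rat_adjoin x) complex_ring"
  unfolding rat_adjoin_def by (rule field.generate_field_is_subfield[OF field_complex_ring]) simp

lemma generator_in_rat_adjoin: "x \<in> rat_adjoin x"
  unfolding rat_adjoin_def by (auto intro: generate_field.incl)

section \<open>Finite dimension of the field generated by an algebraic integer\<close>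

lemma algebraic_int_power_in_rat_span:
  fixes x :: complex
  assumes "algebraic_int x"
  obtains n where "n > 0" "x ^ n \<in> rat_span.span ((\<lambda>i. x ^ i) ` {..<n})"
proof -
  obtain n where n: "n > 0" "x ^ n \<in> int_span.span ((\<lambda>i. x ^ i) ` {..<n})"
    using algebraic_int_power_in_span[OF assms] by blast
  have "w \<in> rat_span.span S" if "w \<in> int_span.span S" for w S
    using that
  proof (induction rule: int_span.span_induct_alt)
    case base
    show ?case by (rule rat_span.span_zero)
  next
    case (step c v w)
    thus ?case
      using rat_span.span_add[OF rat_span.span_scale[OF rat_span.span_base[OF step(1)], of "of_int c"] step(2)]
      by simp
  qed
  thus ?thesis using n that by blast
qed

lemma rat_span_mult_closed:
  assumes "\<And>v. v \<in> S \<Longrightarrow> x * v \<in> rat_span.span T" and "w \<in> rat_span.span S"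
  shows "x * w \<in> rat_span.span T"
  using assms(2)
proof (induction rule: rat_span.span_induct_alt)
  case base
  thus ?case by (simp add: rat_span.span_zero)
next
  case (step c v w)
  have "x * (of_rat c * v + w) = of_rat c * (x * v) + x * w"
    by (simp add: algebra_simps)
  thus ?case
    using step assms(1) by (simp add: rat_span.span_add rat_span.span_scale)
qed

text \<open>Multiplication by \<open>y\<close> is injective, so it maps a basis \<open>B\<close> to
  an independent set of the same size. By dimension the image still spans 1, and the preimage of 1
  is the inverse.\<close>

lemma inverse_in_rat_span:
  fixes S :: "complex set"
  assumes "finite S" "1 \<in> rat_span.span S"
    and mult: "\<And>v w. v \<in> rat_span.span S \<Longrightarrow> w \<in> rat_span.span S \<Longrightarrow> v * w \<in> rat_span.span S"
    and y: "y \<in> rat_span.span S" "y \<noteq> 0"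
  shows "inverse y \<in> rat_span.span S"
proof -
  let ?V = "rat_span.span S"
  obtain B where B: "B \<subseteq> ?V" "rat_span.independent B" "?V \<subseteq> rat_span.span B"
    by (rule rat_span.maximal_independent_subset)
  have span_B: "rat_span.span B = ?V"
    by (intro equalityI rat_span.span_minimal B rat_span.subspace_span)
  have "finite B" 
    using rat_span.independent_span_bound[OF assms(1) B(2) B(1)] by blast
  have hom: "Modules.module_hom (\<lambda>(q::rat) (x::complex). of_rat q * x) (\<lambda>(q::rat) (x::complex). of_rat q * x) ((*) y)"
    by unfold_locales (auto simp: algebra_simps)
  note img = Modules.module_hom.span_image[OF hom]
  have inj: "inj ((*) y)"
    using y by (auto simp: inj_def)
  have "rat_span.independent ((*) y ` B)"
    unfolding rat_span.dependent_def
  proof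
    assume "\<exists>a\<in>(*) y ` B. a \<in> rat_span.span ((*) y ` B - {a})"
    then obtain b where b: "b \<in> B" "y * b \<in> rat_span.span ((*) y ` B - {y * b})"
      by (elim bexE imageE) simp
    have "(*) y ` B - {y * b} = (*) y ` (B - {b})"
      using inj by (auto simp: inj_def)
    with b img[of "B - {b}"] inj have "b \<in> rat_span.span (B - {b})"
      by (auto simp: inj_def)
    with b B(2) show False by (auto simp: rat_span.dependent_def)
  qed
  hence "1 \<in> rat_span.span ((*) y ` B)"
  proof (rule contrapos_pp)
    assume one: "1 \<notin> rat_span.span ((*) y ` B)"
    show "\<not> rat_span.independent ((*) y ` B)"
    proof
      assume "rat_span.independent ((*) y ` B)"
      hence "rat_span.independent (insert 1 ((*) y ` B))"
        using one by (rule rat_span.independent_insertI[rotated])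
      moreover have "insert 1 ((*) y ` B) \<subseteq> rat_span.span B"
        unfolding span_B using assms(2) B(1) mult[OF y(1)] by (intro insert_subsetI image_subsetI) (auto dest: subsetD)
      ultimately have "card (insert 1 ((*) y ` B)) \<le> card B"
        using rat_span.independent_span_bound[OF \<open>finite B\<close>] by blast
      moreover have "1 \<notin> (*) y ` B"
        using one rat_span.span_base[of 1 "(*) y ` B"] by argo
      moreover have "card ((*) y ` B) = card B"
        by (rule card_image[OF inj_on_subset[OF inj subset_UNIV]])
      ultimately show False
        using \<open>finite B\<close> by simp
    qed
  qed
  then obtain z where z: "z \<in> ?V" "1 = y * z"
    unfolding img span_B by (rule imageE)
  have "inverse y = z"
    using z(2) by (intro inverse_unique) simp
  with z(1) show ?thesis by simp
qed

text \<open>The powers of \<open>x\<close> below the exponent of a monic relation span a ring, which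
  is a field by \<open>inverse_in_rat_span\<close>; minimality of the generated field gives the
  inclusion.\<close>

lemma rat_adjoin_finite_dim:
  assumes "algebraic_int x"
  obtains T where "finite T" "rat_adjoin x \<subseteq> rat_span.span T"
proof -
  obtain n where n: "n > 0" "x ^ n \<in> rat_span.span ((\<lambda>i. x ^ i) ` {..<n})"
    using algebraic_int_power_in_rat_span[OF assms] by blast
  define T where "T = (\<lambda>i. x ^ i) ` {..<n}"
  let ?V = "rat_span.span T"
  have "finite T" by (simp add: T_def)
  have base: "x ^ i \<in> ?V" if "i < n" for i
    using that by (intro rat_span.span_base) (auto simp: T_def)
  have x: "x * w \<in> ?V" if "w \<in> ?V" for w
  proof (rule rat_span_mult_closed[OF _ that])
    fix v assume "v \<in> T"
    then obtain i where i: "i < n" "v = x ^ i" by (auto simp: T_def)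
    show "x * v \<in> ?V"
    proof (cases "Suc i < n")
      case False
      hence "n = Suc i" using i by simp
      thus ?thesis using n(2) i by (simp add: T_def)
    qed (use base[of "Suc i"] i in simp)
  qed
  have pow: "x ^ i * w \<in> ?V" if "w \<in> ?V" for i w
    using that by (induction i) (auto simp: mult.assoc intro: x)
  have mult: "v * w \<in> ?V" if "v \<in> ?V" "w \<in> ?V" for v w
  proof -
    have "w * v \<in> ?V"
      using that pow by (intro rat_span_mult_closed[of T w T v]) (auto simp: T_def mult.commute[of w])
    thus ?thesis by (simp add: mult.commute)
  qed
  have one: "1 \<in> ?V" using base[of 0] n(1) by simp
  have rat: "q \<in> ?V" if "q \<in> \<rat>" for q
  proof -
    obtain r where "q = of_rat r" using \<open>q \<in> \<rat>\<close> by (auto simp: Rats_def)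
    thus ?thesis using rat_span.span_scale[OF one, of r] by simp
  qed
  have "subfield ?V complex_ring"
  proof (rule field.subfieldI'[OF field_complex_ring])
    show "subring ?V complex_ring"
      by (rule complex_ring.subringI)
        (auto simp: one mult rat_span.span_add rat_span.span_neg)
    show "inv\<^bsub>complex_ring\<^esub> k \<in> ?V" if "k \<in> ?V - {\<zero>\<^bsub>complex_ring\<^esub>}" for k
      using that inverse_in_rat_span[OF \<open>finite T\<close> one mult, of k]
      by (auto simp: complex_ring_m_inv)
  qed
  moreover have "insert x \<rat> \<subseteq> ?V"
    using rat pow[OF one, of 1] by auto
  ultimately have "rat_adjoin x \<subseteq> ?V"
    unfolding rat_adjoin_def by (intro field.generate_field_min_subfield1[OF field_complex_ring]) auto
  thus ?thesis using \<open>finite T\<close> that by blast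
qed

section \<open>Existence of primes above p\<close>

lemma (in cring) exists_maximalideal:
  assumes I: "ideal I R" "\<one> \<notin> I"
  obtains M where "maximalideal M R" "I \<subseteq> M"
proof -
  define A where "A = {J. ideal J R \<and> I \<subseteq> J \<and> \<one> \<notin> J}"
  have "\<exists>M\<in>A. \<forall>J\<in>A. M \<subseteq> J \<longrightarrow> J = M"
  proof (rule subset_Zorn_nonempty)
    show "A \<noteq> {}" using I by (auto simp: A_def)
    fix C assume C: "C \<noteq> {}" "subset.chain A C"
    hence C': "C \<subseteq> A" by (simp add: subset.chain_def)
    have directed: "\<exists>J\<in>C. x \<in> J \<and> y \<in> J" if "x \<in> \<Union>C" "y \<in> \<Union>C" for x y
      using that C(2) unfolding subset.chain_def by blast
    have ideal: "ideal J R" if "J \<in> C" for J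
      using that C' by (auto simp: A_def)
    have "ideal (\<Union>C) R"
    proof (rule idealI[OF ring_axioms])
      show "subgroup (\<Union>C) (add_monoid R)"
      proof (rule add.subgroupI)
        show "\<Union>C \<subseteq> carrier R"
          using additive_subgroup.a_subset[OF ideal.axioms(1)[OF ideal]] by blast
        show "\<Union>C \<noteq> {}"
          using C(1) additive_subgroup.zero_closed[OF ideal.axioms(1)[OF ideal]] by blast
        show "\<ominus> x \<in> \<Union>C" if "x \<in> \<Union>C" for x
          using that additive_subgroup.a_inv_closed[OF ideal.axioms(1)[OF ideal]] by blast
        show "x \<oplus> y \<in> \<Union>C" if "x \<in> \<Union>C" "y \<in> \<Union>C" for x y
          using directed[OF that] additive_subgroup.a_closed[OF ideal.axioms(1)[OF ideal]] by blast
      qed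
      show "x \<otimes> a \<in> \<Union>C" if "a \<in> \<Union>C" "x \<in> carrier R" for a x
        using that ideal.I_l_closed[OF ideal] by blast
      show "a \<otimes> x \<in> \<Union>C" if "a \<in> \<Union>C" "x \<in> carrier R" for a x
        using that ideal.I_r_closed[OF ideal] by blast
    qed
    moreover have "I \<subseteq> \<Union>C" "\<one> \<notin> \<Union>C"
      using C(1) C' by (auto simp: A_def)
    ultimately show "\<Union>C \<in> A" by (simp add: A_def)
  qed
  then obtain M where M: "ideal M R" "I \<subseteq> M" "\<one> \<notin> M" "\<And>J. J \<in> A \<Longrightarrow> M \<subseteq> J \<Longrightarrow> J = M"
    by (auto simp: A_def)
  have "maximalideal M R"
  proof (rule maximalidealI[OF M(1)])
    show "carrier R \<noteq> M" using M(3) by auto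
    fix J assume J: "ideal J R" "M \<subseteq> J" "J \<subseteq> carrier R"
    show "J = M \<or> J = carrier R"
    proof (cases "\<one> \<in> J")
      case True
      thus ?thesis using ideal.one_imp_carrier[OF J(1)] by simp
    next
      case False
      thus ?thesis using M J by (auto simp: A_def)
    qed
  qed
  thus ?thesis using M(2) that by blast
qed

lemma ring_of_integers_simps [simp]:
  "carrier (ring_of_integers E) = {x \<in> E. algebraic_int x}"
  "x \<otimes>\<^bsub>ring_of_integers E\<^esub> y = x * y" "x \<oplus>\<^bsub>ring_of_integers E\<^esub> y = x + y"
  "\<one>\<^bsub>ring_of_integers E\<^esub> = 1" "\<zero>\<^bsub>ring_of_integers E\<^esub> = 0"
  by (simp_all add: ring_of_integers_def)

lemma cring_ring_of_integers:
  assumes E: "subfield E complex_ring"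
  shows "cring (ring_of_integers E)"
proof -
  have "subring {x \<in> E. algebraic_int x} complex_ring"
    by (rule complex_ring.subringI)
      (auto intro: algebraic_int_add_mult subfield_complexE[OF E])
  hence "subcring {x \<in> E. algebraic_int x} complex_ring"
    by (rule complex_ring.subcringI) simp
  thus ?thesis
    unfolding ring_of_integers_def by (subst (asm) complex_ring.subcring_iff) auto
qed

text \<open>If the ideal generated by \<open>p\<close> contained 1, then 1/p would be a rational
  algebraic integer, hence an integer. So it lies in a maximal ideal, and the choice in
  \<open>inertia_degree\<close> has a meaning.\<close>

lemma primes_above_nonempty:
  assumes E: "subfield E complex_ring" and p: "Factorial_Ring.prime p"
  shows "primes_above E p \<noteq> {}"
proof -
  interpret cring "ring_of_integers E" by (rule cring_ring_of_integers[OF E])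
  let ?I = "PIdl\<^bsub>ring_of_integers E\<^esub> (of_nat p)"
  have p_in: "of_nat p \<in> carrier (ring_of_integers E)"
    using subfield_complexE(7)[OF E, of "int p"] by simp
  have "1 \<notin> ?I"
  proof
    assume "1 \<in> ?I"
    then obtain x :: complex where x: "algebraic_int x" "1 = x * of_nat p"
      by (auto simp: cgenideal_def)
    have "p > 1" using p by (rule prime_gt_1_nat)
    hence "x = of_rat (1 / of_nat p)"
      using x(2) by (simp add: of_rat_divide field_simps)
    hence "x \<in> \<rat>" by (metis Rats_of_rat)
    hence "x \<in> \<int>"
      using x(1) rational_algebraic_int_is_int by blast
    then obtain k where "x = of_int k" by (auto simp: Ints_def)
    hence "(1 :: complex) = of_int (k * int p)" using x(2) by simp
    hence "1 = k * int p" by (metis of_int_eq_1_iff)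
    hence "int p dvd 1" by (metis dvd_triv_right)
    thus False using \<open>p > 1\<close> by simp
  qed
  then obtain M where M: "maximalideal M (ring_of_integers E)" "?I \<subseteq> M"
    using exists_maximalideal[OF cgenideal_ideal[OF p_in]] by auto
  have "of_nat p \<in> M" using cgenideal_self[OF p_in] M(2) by blast
  thus ?thesis
    using maximalideal_prime[OF M(1)] by (auto simp: primes_above_def)
qed

section \<open>The residue ring at a prime above p and its prime field\<close>

locale prime_above =
  fixes E :: "complex set" and p :: nat and P :: "complex set"
  assumes E: "subfield E complex_ring" and prime_p: "Factorial_Ring.prime p"
    and P: "P \<in> primes_above E p"
begin

abbreviation integers where "integers \<equiv> ring_of_integers E"
abbreviation residues where "residues \<equiv> residue_field E P"
abbreviation prime_residues where "prime_residues \<equiv> residue_prime_field E P"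
abbreviation coset where "coset x \<equiv> P +>\<^bsub>integers\<^esub> x"

lemma primeideal_P: "primeideal P integers" and p_in_P: "of_nat p \<in> P"
  using P by (auto simp: primes_above_def)

lemma ideal_P: "ideal P integers"
  using primeideal_P by (rule primeideal.axioms(1))

lemma of_int_mem [simp]: "of_int n \<in> E"
  by (rule subfield_complexE(7)[OF E])

lemma P_add: "x \<in> P \<Longrightarrow> y \<in> P \<Longrightarrow> x + y \<in> P"
  using additive_subgroup.a_closed[OF ideal.axioms(1)[OF ideal_P]] by auto

lemma P_mult: "x \<in> E \<Longrightarrow> algebraic_int x \<Longrightarrow> y \<in> P \<Longrightarrow> x * y \<in> P"
  using ideal.I_l_closed[OF ideal_P] by auto

lemma P_diff: "x \<in> P \<Longrightarrow> y \<in> P \<Longrightarrow> x - y \<in> P"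
  using P_add[of x "- y"] P_mult[of "- 1" y] of_int_mem[of "-1"] by auto

lemma one_notin_P: "1 \<notin> P"
  using primeideal.I_notcarr[OF primeideal_P] ideal.one_imp_carrier[OF ideal_P] by auto

lemma coset_hom: "coset \<in> Ring.ring_hom integers residues"
  unfolding residue_field_def by (rule ideal.rcos_ring_hom[OF ideal_P])

lemma coset_add:
  "x \<in> E \<Longrightarrow> algebraic_int x \<Longrightarrow> y \<in> E \<Longrightarrow> algebraic_int y \<Longrightarrow> coset (x + y) = coset x \<oplus>\<^bsub>residues\<^esub> coset y"
  and coset_mult:
  "x \<in> E \<Longrightarrow> algebraic_int x \<Longrightarrow> y \<in> E \<Longrightarrow> algebraic_int y \<Longrightarrow> coset (x * y) = coset x \<otimes>\<^bsub>residues\<^esub> coset y"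
  and coset_one: "coset 1 = \<one>\<^bsub>residues\<^esub>"
  and coset_closed: "x \<in> E \<Longrightarrow> algebraic_int x \<Longrightarrow> coset x \<in> carrier residues"
  using ring_hom_add[OF coset_hom, of x y] ring_hom_mult[OF coset_hom, of x y]
    ring_hom_one[OF coset_hom] ring_hom_closed[OF coset_hom, of x] by auto

lemma domain_residues: "domain residues"
  unfolding residue_field_def by (rule primeideal.quotient_is_domain[OF primeideal_P])

text \<open>Makes the linear algebra over a subfield (\<open>independent\<close>,
  \<open>Span\<close>, \<open>dimension\<close>) available for the residue ring.\<close>

sublocale domain residues by (rule domain_residues)

lemma coset_zero: "coset 0 = \<zero>\<^bsub>residues\<^esub>"
  using ring_hom_zero[OF coset_hom] cring_ring_of_integers[OF E] domain_residues
  by (auto simp: cring_def domain_def)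

lemma coset_eq_iff:
  assumes "x \<in> E" "algebraic_int x" "y \<in> E" "algebraic_int y"
  shows "coset x = coset y \<longleftrightarrow> x - y \<in> P"
proof -
  have "x \<ominus>\<^bsub>integers\<^esub> y = x - y"
  proof -
    interpret I: cring integers by (rule cring_ring_of_integers[OF E])
    have "\<ominus>\<^bsub>integers\<^esub> y = - y"
      using assms subfield_complexE[OF E] by (intro I.add.inv_equality[simplified]) auto
    thus ?thesis by (simp add: a_minus_def)
  qed
  thus ?thesis
    using ring.quotient_eq_iff_same_a_r_cos[OF cring.axioms(1)[OF cring_ring_of_integers[OF E]] ideal_P, of x y] assms by simp
qed

lemma coset_eq_zero_iff:
  assumes "x \<in> E" "algebraic_int x"
  shows "coset x = \<zero>\<^bsub>residues\<^esub> \<longleftrightarrow> x \<in> P"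
  using coset_eq_iff[OF assms, of 0] subfield_complexE(1)[OF E] by (simp add: coset_zero)

lemma carrier_residues: "carrier residues = coset ` {x \<in> E. algebraic_int x}"
  unfolding residue_field_def FactRing_def by (auto simp: A_RCOSETS_def')

text \<open>By Bezout, an integer of \<open>P\<close> prime to \<open>p\<close> would put 1 into
  \<open>P\<close>. Hence the prime residues form a copy of the field with \<open>p\<close>
  elements.\<close>

lemma of_int_in_P_iff: "of_int n \<in> P \<longleftrightarrow> int p dvd n"
proof
  assume "int p dvd n"
  then obtain k where "n = k * int p" by (metis dvd_div_mult_self)
  thus "of_int n \<in> P" using P_mult[of "of_int k" "of_nat p"] p_in_P by auto
next
  assume n: "of_int n \<in> P"
  show "int p dvd n"
  proof (rule ccontr)
    assume "\<not> int p dvd n"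
    hence "coprime (int p) n"
      using prime_p by (intro prime_imp_coprime) auto
    then obtain a b where "a * int p + b * n = 1"
      using bezout_int[of "int p" n] by (metis coprime_imp_gcd_eq_1)
    hence "of_int a * of_nat p + of_int b * of_int n = (1 :: complex)"
      by (metis of_int_1 of_int_add of_int_mult of_int_of_nat_eq)
    moreover have "of_int a * of_nat p + of_int b * of_int n \<in> P"
      by (intro P_add P_mult p_in_P n) auto
    ultimately show False using one_notin_P by simp
  qed
qed

lemma prime_residues_def': "prime_residues = range (\<lambda>n::int. coset (of_int n))"
  by (simp add: residue_prime_field_def)

lemma prime_residuesE:
  assumes "x \<in> prime_residues"
  obtains n :: int where "x = coset (of_int n)"
  using assms unfolding prime_residues_def' by blast

lemma coset_of_int_mem: "coset (of_int n) \<in> prime_residues"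
  by (auto simp: prime_residues_def')

lemma coset_of_int_add: "coset (of_int m) \<oplus>\<^bsub>residues\<^esub> coset (of_int n) = coset (of_int (m + n))"
  and coset_of_int_mult: "coset (of_int m) \<otimes>\<^bsub>residues\<^esub> coset (of_int n) = coset (of_int (m * n))"
  using coset_add[of "of_int m" "of_int n"] coset_mult[of "of_int m" "of_int n"] by auto

end

text \<open>Clear denominators with the product \<open>D\<close>, then divide by the gcd
  \<open>g\<close> of the integer coefficients. This keeps the relation nontrivial after reduction
  modulo a prime above \<open>p\<close>.\<close>

lemma primitive_integer_relation:
  fixes u :: "complex \<Rightarrow> rat"
  assumes "finite S" "\<exists>v\<in>S. u v \<noteq> 0" "(\<Sum>v\<in>S. of_rat (u v) * v) = 0"
    and p: "Factorial_Ring.prime p"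
  obtains c :: "complex \<Rightarrow> int" where
    "(\<Sum>v\<in>S. of_int (c v) * v) = 0" "\<exists>v\<in>S. \<not> int p dvd c v"
proof -
  define d where "d v = snd (quotient_of (u v))" for v
  define D where "D = (\<Prod>v\<in>S. d v)"
  have d: "d v > 0" "u v = of_int (fst (quotient_of (u v))) / of_int (d v)" for v
    unfolding d_def using quotient_of_denom_pos' quotient_of_div[OF prod.collapse[symmetric]] by auto
  have "D \<noteq> 0" using d(1) assms(1) unfolding D_def by (auto simp: less_le)
  define a where "a v = fst (quotient_of (u v)) * (D div d v)" for v
  have a: "of_int (a v) = of_int D * u v" if "v \<in> S" for v
  proof -
    have "d v dvd D" unfolding D_def using assms(1) that by (rule dvd_prodI)
    hence "(of_int (D div d v) :: rat) = of_int D / of_int (d v)"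
      using d(1)[of v] by (auto elim!: dvdE)
    thus ?thesis by (subst d(2)) (simp add: a_def)
  qed
  define g where "g = Gcd (a ` S)"
  have "g \<noteq> 0"
  proof -
    obtain v where v: "v \<in> S" "u v \<noteq> 0" using assms(2) by blast
    hence "of_int (a v) \<noteq> (0 :: rat)" using \<open>D \<noteq> 0\<close> by (simp add: a)
    thus ?thesis using v(1) by (auto simp: g_def Gcd_0_iff)
  qed
  have g: "a v = g * (a v div g)" if "v \<in> S" for v
    using that by (simp add: g_def)
  show ?thesis
  proof (rule that)
    have "of_int g * (\<Sum>v\<in>S. of_int (a v div g) * v) = (\<Sum>v\<in>S. of_int (a v) * v)"
      by (auto simp: sum_distrib_left mult.assoc[symmetric] simp flip: of_int_mult intro!: sum.cong)
        (use g in metis)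
    also have "\<dots> = (\<Sum>v\<in>S. of_int D * (of_rat (u v) * v))"
    proof (rule sum.cong)
      fix v assume "v \<in> S"
      hence "of_rat (of_int (a v)) = (of_rat (of_int D * u v) :: complex)"
        by (simp only: a)
      thus "of_int (a v) * v = of_int D * (of_rat (u v) * v)" by (simp add: of_rat_mult)
    qed simp
    also have "\<dots> = 0" using assms(3) by (simp flip: sum_distrib_left)
    finally show "(\<Sum>v\<in>S. of_int (a v div g) * v) = 0" using \<open>g \<noteq> 0\<close> by simp
    show "\<exists>v\<in>S. \<not> int p dvd a v div g"
    proof (rule ccontr)
      assume "\<not> ?thesis"
      hence "int p * g dvd a v" if "v \<in> S" for v
        using that g[OF that] mult_dvd_mono[of "int p" "a v div g" g g] by (simp add: mult.commute)
      hence "int p * g dvd g" unfolding g_def by (intro Gcd_greatest) auto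
      hence "int p dvd 1" using \<open>g \<noteq> 0\<close> by (metis dvd_mult_cancel_right mult_1)
      thus False using prime_gt_1_nat[OF p] by simp
    qed
  qed
qed

context prime_above
begin

text \<open>An integer outside \<open>P\<close> is prime to \<open>p\<close>, and its Bezout inverse
  modulo \<open>p\<close> inverts its residue. Dimensions of the residue ring are taken over this
  subfield.\<close>

lemma subfield_prime_residues: "subfield prime_residues residues"
proof (rule subfieldI)
  have sub: "prime_residues \<subseteq> carrier residues"
    by (auto simp: prime_residues_def' intro!: coset_closed)
  have one: "\<one>\<^bsub>residues\<^esub> \<in> prime_residues"
    using coset_of_int_mem[of 1] by (simp add: coset_one)
  have mult: "x \<otimes>\<^bsub>residues\<^esub> y \<in> prime_residues"
    if "x \<in> prime_residues" "y \<in> prime_residues" for x y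
    using that by (elim prime_residuesE) (simp only: coset_of_int_mult coset_of_int_mem)
  have "subring prime_residues residues"
  proof (rule subringI)
    fix x assume "x \<in> prime_residues"
    then obtain n where n: "x = coset (of_int n)" by (rule prime_residuesE)
    have "coset (of_int (- n)) \<oplus>\<^bsub>residues\<^esub> x = \<zero>\<^bsub>residues\<^esub>"
      unfolding n coset_of_int_add by (simp add: coset_zero)
    hence "\<ominus>\<^bsub>residues\<^esub> x = coset (of_int (- n))"
      unfolding n by (intro minus_equality coset_closed of_int_mem algebraic_int_of_int)
    thus "\<ominus>\<^bsub>residues\<^esub> x \<in> prime_residues" by (simp only: coset_of_int_mem)
  next
    fix x y assume "x \<in> prime_residues" "y \<in> prime_residues"
    thus "x \<oplus>\<^bsub>residues\<^esub> y \<in> prime_residues"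
      by (elim prime_residuesE) (simp only: coset_of_int_add coset_of_int_mem)
  qed (use sub one mult in auto)
  thus "subcring prime_residues residues" by (rule subcringI')
  have "x \<in> Units (residues\<lparr>carrier := prime_residues\<rparr>)"
    if x: "x \<in> prime_residues" "x \<noteq> \<zero>\<^bsub>residues\<^esub>" for x
  proof -
    from x(1) obtain n where n: "x = coset (of_int n)" by (rule prime_residuesE)
    have "\<not> int p dvd n"
      using x(2) coset_eq_zero_iff[of "of_int n"] of_int_in_P_iff[of n] by (auto simp: n)
    hence "coprime (int p) n"
      using prime_p by (intro prime_imp_coprime) auto
    then obtain a b where ab: "a * int p + b * n = 1"
      using bezout_int[of "int p" n] by (metis coprime_imp_gcd_eq_1)
    have "coset (of_int (b * n)) = coset (of_int 1)"
    proof (subst coset_eq_iff)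
      have "b * n - 1 = (- a) * int p" using ab by (simp add: algebra_simps)
      hence "int p dvd b * n - 1" by (metis dvd_triv_right)
      thus "complex_of_int (b * n) - of_int 1 \<in> P"
        using of_int_in_P_iff[of "b * n - 1"] by simp
    qed (auto simp: subfield_complexE(2)[OF E] simp del: of_int_mult)
    hence "coset (of_int b) \<otimes>\<^bsub>residues\<^esub> x = \<one>\<^bsub>residues\<^esub>"
      unfolding n coset_of_int_mult by (simp add: coset_one)
    moreover from this have "x \<otimes>\<^bsub>residues\<^esub> coset (of_int b) = \<one>\<^bsub>residues\<^esub>"
      using sub x(1) coset_of_int_mem[of b] m_comm[of x "coset (of_int b)"] by (simp add: subset_iff)
    ultimately show ?thesis
      using x(1) coset_of_int_mem[of b] unfolding Units_def by auto
  qed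
  moreover have "\<zero>\<^bsub>residues\<^esub> \<notin> Units (residues\<lparr>carrier := prime_residues\<rparr>)"
    using sub unfolding Units_def by (auto simp: subset_iff)
  moreover have "Units (residues\<lparr>carrier := prime_residues\<rparr>) \<subseteq> prime_residues"
    unfolding Units_def by auto
  ultimately show "Units (residues\<lparr>carrier := prime_residues\<rparr>) = prime_residues - {\<zero>\<^bsub>residues\<^esub>}"
    by blast
qed

text \<open>Lifts the list form in which \<open>combine\<close> expresses linear combinations to a
  sum in the field. Both claims share one induction because the residue of a sum splits only for
  integral elements of \<open>E\<close>.\<close>

lemma combine_cosets:
  assumes "\<And>x. x \<in> set xs \<Longrightarrow> x \<in> E \<and> algebraic_int x"
  shows "combine (map (\<lambda>x. coset (of_int (c x))) xs) (map coset xs) =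
           coset (\<Sum>x\<leftarrow>xs. of_int (c x) * x)"
    and "(\<Sum>x\<leftarrow>xs. of_int (c x) * x) \<in> E \<and> algebraic_int (\<Sum>x\<leftarrow>xs. of_int (c x) * x)"
  using assms
proof (induction xs)
  case Nil
  { case 1 thus ?case by (simp add: coset_zero) }
  { case 2 thus ?case using subfield_complexE(1)[OF E] by simp }
next
  case (Cons x xs)
  let ?r = "\<Sum>x\<leftarrow>xs. of_int (c x) * x"
  have IH: "combine (map (\<lambda>x. coset (of_int (c x))) xs) (map coset xs) = coset ?r"
    "?r \<in> E" "algebraic_int ?r"
    if "\<And>y. y \<in> set (x # xs) \<Longrightarrow> y \<in> E \<and> algebraic_int y"
    using Cons.IH that by simp_all
  have x: "of_int (c x) * x \<in> E" "algebraic_int (of_int (c x) * x)"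
    if "x \<in> E \<and> algebraic_int x"
    using that by (auto intro: algebraic_int_add_mult(2) subfield_complexE(4)[OF E])
  { case 1
    have "coset (of_int (c x) * x) = coset (of_int (c x)) \<otimes>\<^bsub>residues\<^esub> coset x"
      using 1 by (intro coset_mult) auto
    moreover have "coset (of_int (c x) * x + ?r) = coset (of_int (c x) * x) \<oplus>\<^bsub>residues\<^esub> coset ?r"
      using 1 by (intro coset_add x IH) auto
    ultimately show ?case using IH(1)[OF 1] by simp }
  { case 2
    thus ?case using IH(2,3)[OF 2] x algebraic_int_add_mult(1) subfield_complexE(3)[OF E] by simp }
qed

text \<open>A rational relation between lifts can be scaled to an integral one whose coefficients are not
  all divisible by \<open>p\<close>; its reduction is then a nontrivial relation between the residues.\<close>

lemma independent_length_le_card: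
  assumes T: "finite T" "E \<subseteq> rat_span.span T" and ind: "independent prime_residues Us"
  shows "length Us \<le> card T"
proof (rule ccontr)
  assume "\<not> length Us \<le> card T"
  have "set Us \<subseteq> coset ` {x \<in> E. algebraic_int x}"
    using independent_in_carrier[OF ind] by (simp add: carrier_residues)
  hence "Us \<in> map coset ` lists {x \<in> E. algebraic_int x}"
    unfolding lists_image[symmetric] by auto
  then obtain xs where xs: "Us = map coset xs" "\<And>x. x \<in> set xs \<Longrightarrow> x \<in> E \<and> algebraic_int x"
    by auto
  have "distinct xs"
    using independent_distinct[OF subfield_prime_residues ind] by (simp add: xs(1) distinct_map)
  hence "\<not> card (set xs) \<le> card T"
    using \<open>\<not> length Us \<le> card T\<close> by (simp add: distinct_card xs(1))
  hence "rat_span.dependent (set xs)"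
    using rat_span.independent_span_bound[OF T(1), of "set xs"] T(2) xs(2) by blast
  then obtain u where u: "\<exists>v\<in>set xs. u v \<noteq> 0" "(\<Sum>v\<in>set xs. of_rat (u v) * v) = 0"
    unfolding rat_span.dependent_finite[OF finite_set] by blast
  obtain c where c: "(\<Sum>v\<in>set xs. of_int (c v) * v) = 0" "\<exists>v\<in>set xs. \<not> int p dvd c v"
    by (rule primitive_integer_relation[OF finite_set u prime_p])
  have "combine (map (\<lambda>x. coset (of_int (c x))) xs) (map coset xs) =
      coset (\<Sum>x\<leftarrow>xs. of_int (c x) * x)"
    by (rule combine_cosets(1)[OF xs(2)])
  also have "\<dots> = \<zero>\<^bsub>residues\<^esub>"
    using c(1) by (simp add: sum_list_distinct_conv_sum_set[OF \<open>distinct xs\<close>] coset_zero)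
  finally have "combine (map (\<lambda>x. coset (of_int (c x))) xs) Us = \<zero>\<^bsub>residues\<^esub>"
    by (simp only: xs(1))
  hence "set (take (length Us) (map (\<lambda>x. coset (of_int (c x))) xs)) \<subseteq> {\<zero>\<^bsub>residues\<^esub>}"
    by (intro independent_imp_trivial_combine[OF subfield_prime_residues ind])
      (auto simp: coset_of_int_mem)
  hence "coset (of_int (c x)) = \<zero>\<^bsub>residues\<^esub>" if "x \<in> set xs" for x
    using that by (auto simp: xs(1))
  with c(2) show False
    using coset_eq_zero_iff of_int_in_P_iff by (metis algebraic_int_of_int of_int_mem)
qed

text \<open>By \<open>independent_length_le_card\<close> an independent list of maximal length
  exists, and maximality makes it span. Without some \<open>d\<close> the definite description in
  \<open>residue_degree\<close> would say nothing.\<close>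

lemma residues_dimension:
  assumes T: "finite T" "E \<subseteq> rat_span.span T"
  obtains d where "dimension d prime_residues (carrier residues)"
proof -
  define L where "L = {length Us | Us. independent prime_residues Us}"
  have "finite L"
    using independent_length_le_card[OF T] by (intro finite_subset[of L "{..card T}"]) (auto simp: L_def)
  moreover have "0 \<in> L" by (auto simp: L_def intro!: exI[of _ "[]"])
  ultimately have max: "Max L \<in> L" "\<And>n. n \<in> L \<Longrightarrow> n \<le> Max L"
    by (auto intro: Max_in)
  then obtain Us where Us: "independent prime_residues Us" "length Us = Max L"
    by (auto simp: L_def)
  have "carrier residues \<subseteq> Span prime_residues Us"
  proof
    fix v assume v: "v \<in> carrier residues"
    show "v \<in> Span prime_residues Us"
    proof (rule ccontr)
      assume "v \<notin> Span prime_residues Us"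
      hence "independent prime_residues (v # Us)" using v Us(1) by (intro li_Cons)
      hence "length (v # Us) \<in> L" unfolding L_def by blast
      thus False using max(2) Us(2) by fastforce
    qed
  qed
  hence "Span prime_residues Us = carrier residues"
    using Span_in_carrier[OF subfieldE(3)[OF subfield_prime_residues] independent_in_carrier[OF Us(1)]]
    by blast
  thus ?thesis using that dimensionI[OF subfield_prime_residues Us(1)] by blast
qed

text \<open>Dimension 0 would force 1 = 0 in the residue ring. In dimension 1 the vector 1 alone is
  a basis, so every residue, also that of \<open>x\<close>, would come from an integer.\<close>

lemma residue_degree_ge_2:
  assumes T: "finite T" "E \<subseteq> rat_span.span T"
    and x: "x \<in> E" "algebraic_int x" "\<And>n::int. x - of_int n \<notin> P"
  shows "residue_degree E P \<ge> 2"
proof -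
  obtain d where d: "dimension d prime_residues (carrier residues)"
    by (rule residues_dimension[OF T])
  have "residue_degree E P = d"
    unfolding residue_degree_def
    by (rule the_equality[where P = "\<lambda>d. dimension d _ _", OF d])
      (rule dimension_is_inj[OF subfield_prime_residues _ d])
  moreover have "d \<noteq> 0"
  proof
    assume "d = 0"
    hence "carrier residues = {\<zero>\<^bsub>residues\<^esub>}"
      using d dimension_zero[OF subfield_prime_residues] by simp
    thus False using one_closed one_not_zero by simp
  qed
  moreover have "d \<noteq> 1"
  proof
    assume "d = 1"
    have "independent prime_residues [\<one>\<^bsub>residues\<^esub>]"
      by (intro li_Cons) auto
    hence "Span prime_residues [\<one>\<^bsub>residues\<^esub>] = carrier residues"
      using independent_length_eq_dimension[OF subfield_prime_residues d, of "[\<one>\<^bsub>residues\<^esub>]"] \<open>d = 1\<close> by simp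
    hence "coset x \<in> Span prime_residues [\<one>\<^bsub>residues\<^esub>]"
      using coset_closed x by simp
    hence "coset x \<in> prime_residues"
      using subfieldE(3)[OF subfield_prime_residues] by (auto simp: line_extension_mem_iff)
    then obtain n :: int where "coset x = coset (of_int n)" by (rule prime_residuesE)
    thus False using x coset_eq_iff[of x "of_int n"] by simp
  qed
  ultimately show ?thesis by simp
qed

end

text \<open>The prime behind \<open>inertia_degree\<close> is an arbitrary choice, so the hypothesis
  ranges over all primes above \<open>p\<close>.\<close>

lemma inertia_degree_ge_2:
  assumes \<alpha>: "algebraic_int \<alpha>" and p: "Factorial_Ring.prime p"
    and "\<And>P n. P \<in> primes_above (rat_adjoin \<alpha>) p \<Longrightarrow> \<alpha> - of_int n \<notin> P"
  shows "inertia_degree (rat_adjoin \<alpha>) p \<ge> 2"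
proof -
  define P where "P = (SOME P. P \<in> primes_above (rat_adjoin \<alpha>) p)"
  have P: "P \<in> primes_above (rat_adjoin \<alpha>) p"
    unfolding P_def using primes_above_nonempty[OF subfield_rat_adjoin p] by (simp add: some_in_eq)
  interpret prime_above "rat_adjoin \<alpha>" p P
    by (rule prime_above.intro[OF subfield_rat_adjoin p P])
  obtain T where T: "finite T" "rat_adjoin \<alpha> \<subseteq> rat_span.span T"
    using rat_adjoin_finite_dim[OF \<alpha>] by blast
  show ?thesis
    unfolding inertia_degree_def P_def[symmetric]
    by (rule residue_degree_ge_2[OF T generator_in_rat_adjoin \<alpha> assms(3)[OF P]])
qed

section \<open>Sums of two inverse roots of unity\<close>

text \<open>Discrete form of differentiating the geometric sum. At an \<open>n\<close>-th root of
  unity other than 1 the geometric sum vanishes and the right-hand side is just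
  \<open>n\<close>.\<close>

lemma sum_of_nat_mult_power:
  fixes x :: "'a :: comm_ring_1"
  shows "(x - 1) * (\<Sum>k<n. of_nat k * x ^ k) = of_nat n * x ^ n - x * (\<Sum>k<n. x ^ k)"
  by (induction n) (simp_all add: algebra_simps)

text \<open>The cofactor is explicit, \<open>\<Sum>k<m. of_nat k * x ^ k\<close>, and visibly an
  algebraic integer, whether \<open>x\<close> is primitive or not.\<close>

lemma root_of_unity_minus_one_dvd:
  fixes x :: complex
  assumes "x ^ m = 1" "x \<noteq> 1" "m > 0"
  shows "algebraic_int (of_nat m / (x - 1))"
proof -
  have "(\<Sum>k<m. x ^ k) = 0"
    using assms by (simp add: sum_gp_strict)
  hence "(x - 1) * (\<Sum>k<m. of_nat k * x ^ k) = of_nat m"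
    using sum_of_nat_mult_power[of x m] assms(1) by simp
  hence "of_nat m / (x - 1) = (\<Sum>k<m. of_nat k * x ^ k)"
    using assms(2) by (simp add: field_simps)
  moreover have "algebraic_int x"
    by (rule algebraic_int_root_of_unity[OF assms(1,3)])
  ultimately show ?thesis
    by (auto intro!: algebraic_int_sum algebraic_int_add_mult(2) algebraic_int_power)
qed

text \<open>The inner binomial coefficients are divisible by \<open>p\<close>. The error is kept as
  \<open>p\<close> times a complex algebraic integer because \<omega> and its inverse need not lie
  in the field to which this is applied.\<close>

lemma freshman_dream_algebraic_int:
  fixes x y :: complex
  assumes "algebraic_int x" "algebraic_int y" and p: "Factorial_Ring.prime p"
  obtains z where "algebraic_int z" "(x + y) ^ p = x ^ p + y ^ p + of_nat p * z"
proof -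
  have "p > 0" using p by (rule prime_gt_0_nat)
  define z where "z = (\<Sum>k\<in>{0<..<p}. of_nat ((p choose k) div p) * (x ^ k * y ^ (p - k)))"
  have "(x + y) ^ p = (\<Sum>k\<le>p. of_nat (p choose k) * x ^ k * y ^ (p - k))"
    by (rule binomial_ring)
  also have "{..p} = insert 0 (insert p {0<..<p})" by auto
  also have "(\<Sum>k\<in>\<dots>. of_nat (p choose k) * x ^ k * y ^ (p - k)) =
      y ^ p + (x ^ p + (\<Sum>k\<in>{0<..<p}. of_nat (p choose k) * x ^ k * y ^ (p - k)))"
    using \<open>p > 0\<close> by simp
  also have "(\<Sum>k\<in>{0<..<p}. of_nat (p choose k) * x ^ k * y ^ (p - k)) = of_nat p * z"
    unfolding z_def sum_distrib_left
  proof (rule sum.cong)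
    fix k assume "k \<in> {0<..<p}"
    hence "p dvd (p choose k)"
      using p by (intro dvd_choose_prime) auto
    hence "of_nat (p choose k) = (of_nat p * of_nat ((p choose k) div p) :: complex)"
      by (metis dvd_mult_div_cancel of_nat_mult)
    thus "of_nat (p choose k) * x ^ k * y ^ (p - k) =
        of_nat p * (of_nat ((p choose k) div p) * (x ^ k * y ^ (p - k)))" by simp
  qed simp
  finally have "(x + y) ^ p = x ^ p + y ^ p + of_nat p * z" by simp
  moreover have "algebraic_int z"
    unfolding z_def using assms by (intro algebraic_int_sum algebraic_int_add_mult algebraic_int_power) auto
  ultimately show ?thesis using that by blast
qed

lemma prime_dvd_power_minus_self:
  fixes n :: int
  assumes p: "Factorial_Ring.prime p"
  shows "int p dvd n ^ p - n"
proof -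
  have "p > 0" using p by (rule prime_gt_0_nat)
  \<comment> \<open>\<open>fermat_theorem\<close> speaks of natural numbers, so \<open>n\<close> is
    replaced by its residue.\<close>
  define m where "m = nat (n mod int p)"
  have n: "[n = int m] (mod int p)"
    using \<open>p > 0\<close> by (simp add: m_def unique_euclidean_semiring_class.cong_def)
  have "[m ^ p = m] (mod p)"
  proof (cases "p dvd m")
    case True
    moreover from this have "p dvd m ^ p"
      using \<open>p > 0\<close> by (meson dvd_power dvd_trans)
    ultimately show ?thesis by (simp add: unique_euclidean_semiring_class.cong_def dvd_imp_mod_0)
  next
    case False
    have "[m * m ^ (p - 1) = m * 1] (mod p)"
      by (rule cong_mult[OF cong_refl fermat_theorem[OF p False]])
    moreover have "m * m ^ (p - 1) = m ^ p"
      using \<open>p > 0\<close> by (cases p) auto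
    ultimately show ?thesis by simp
  qed
  hence "[int m ^ p = int m] (mod int p)"
    by (metis cong_int_iff of_nat_power)
  hence "[n ^ p = n] (mod int p)"
    using cong_pow[OF n, of p] n by (metis cong_trans cong_sym)
  thus ?thesis by (simp add: cong_iff_dvd_diff)
qed

text \<open>Gauss's lemma with \<open>p = 8 * k + 3\<close>: among the doubles of 1, ..., 4k+1 those
  beyond half of \<open>p\<close> come from 2k+1, ..., 4k+1, and their number 2k+1 is odd.\<close>

lemma two_not_QuadRes_3_mod_8:
  assumes p: "Factorial_Ring.prime p" "[p = 3] (mod 8)"
  shows "\<not> QuadRes (int p) 2"
proof -
  define k where "k = p div 8"
  have k: "p = 8 * k + 3"
    using p(2) mult_div_mod_eq[of 8 p] by (simp add: unique_euclidean_semiring_class.cong_def k_def)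
  interpret GAUSS p 2
  proof
    show "Factorial_Ring.prime p" "2 < p" using p k by auto
    show "\<not> [2 = 0] (mod int p)" using k by (simp add: cong_0_iff zdvd_not_zless)
  qed auto
  have half: "(int p - 1) div 2 = 4 * int k + 1" using k by simp
  have "E = (\<lambda>x. 2 * x) ` {2 * int k + 1..4 * int k + 1}"
  proof -
    have "C = (\<lambda>x. 2 * x) ` A"
      unfolding C_def B_def A_def image_image half
      by (intro image_cong) (auto simp: k)
    hence "E = (\<lambda>x. 2 * x) ` A \<inter> {4 * int k + 1<..}"
      unfolding E_def half by simp
    also have "\<dots> = (\<lambda>x. 2 * x) ` {2 * int k + 1..4 * int k + 1}"
      unfolding A_def half by auto
    finally show ?thesis .
  qed
  hence "card E = 2 * k + 1"
    by (simp add: card_image inj_on_def)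
  hence "Legendre 2 (int p) = -1"
    using gauss_lemma by simp
  thus ?thesis by (auto simp: Legendre_def split: if_splits)
qed

text \<open>The computation runs through \<omega>, which need not lie in the field of \<alpha>. The
  cofactors \<open>z\<close> and \<open>\<delta>\<close> are integral by their construction outside
  the field, and lie in the field by solving their defining equations for them. The hypothesis on
  \<open>\<omega> ^ 3\<close> also rules out \<omega> = 1.\<close>

lemma not_congruent_to_integer:
  fixes \<omega> :: complex
  defines "\<alpha> \<equiv> \<omega> + inverse \<omega>"
  assumes \<omega>: "\<omega> ^ m = 1" "\<omega> ^ 3 \<noteq> 1" "m > 0"
    and p: "Factorial_Ring.prime p" "coprime p m" "[p = 2] (mod m)"
    and P: "P \<in> primes_above (rat_adjoin \<alpha>) p"
  shows "\<alpha> - of_int n \<notin> P"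
proof
  interpret prime_above "rat_adjoin \<alpha>" p P
    by (rule prime_above.intro[OF subfield_rat_adjoin p(1) P])
  note E_closed = subfield_complexE[OF E]
  have [simp]: "\<omega> \<noteq> 0" using \<omega>(1,3) by (auto simp: power_0_left)
  have "\<omega> \<noteq> 1" using \<omega>(2) by auto
  have int: "algebraic_int \<omega>" "algebraic_int (inverse \<omega>)"
    by (rule algebraic_int_root_of_unity[of _ m]; simp add: power_inverse \<omega>(1,3))+
  have \<alpha>: "algebraic_int \<alpha>" "\<alpha> \<in> rat_adjoin \<alpha>"
    using algebraic_int_add_mult(1)[OF int] generator_in_rat_adjoin by (simp_all add: \<alpha>_def)
  \<comment> \<open>The Frobenius image of \<alpha> minus \<alpha>; as a polynomial it is (\<alpha>
    - 2) (\<alpha> + 1).\<close>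
  define \<gamma> where "\<gamma> = \<alpha>\<^sup>2 - 2 - \<alpha>"
  have \<gamma>_eq: "\<gamma> = inverse \<omega> ^ 2 * ((\<omega> - 1) * (\<omega> ^ 3 - 1))"
  proof -
    define w where "w = inverse \<omega>"
    have "\<omega> * w = 1" by (simp add: w_def)
    have "(\<omega> + w)\<^sup>2 - 2 - (\<omega> + w) = \<omega>\<^sup>2 + 2 * (\<omega> * w) + w\<^sup>2 - 2 - (\<omega> + w)"
      by (simp add: power2_sum)
    \<comment> \<open>Factors \<open>\<omega> * w = 1\<close> are inserted so that the last two
      expressions agree as polynomials in \<omega> and \<open>w\<close>.\<close>
    also have "\<dots> = (\<omega> * w)\<^sup>2 * \<omega>\<^sup>2 - (\<omega> * w)\<^sup>2 * \<omega> - \<omega> * w * w + w\<^sup>2"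
      by (simp add: \<open>\<omega> * w = 1\<close>)
    also have "\<dots> = w\<^sup>2 * ((\<omega> - 1) * (\<omega> ^ 3 - 1))"
      by (simp add: algebra_simps eval_nat_numeral)
    finally show ?thesis by (simp add: \<gamma>_def \<alpha>_def w_def)
  qed
  have two: "2 \<in> rat_adjoin \<alpha>"
    using of_int_mem[of 2] by simp
  have "\<gamma> \<in> rat_adjoin \<alpha>"
    unfolding \<gamma>_def by (rule E_closed(6)[OF E_closed(6)[OF E_closed(8)[OF \<alpha>(2)] two] \<alpha>(2)])
  assume "\<alpha> - of_int n \<in> P"
  have "\<gamma> \<in> P"
  proof -
    have "\<omega> ^ p = \<omega> ^ 2"
    proof -
      have red: "\<omega> ^ (j mod m) = \<omega> ^ j" for j
      proof -
        have "\<omega> ^ j = (\<omega> ^ m) ^ (j div m) * \<omega> ^ (j mod m)"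
          by (simp flip: power_mult power_add)
        thus ?thesis using \<omega>(1) by simp
      qed
      show ?thesis
        using red[of p] red[of 2] p(3) by (simp add: unique_euclidean_semiring_class.cong_def)
    qed
    moreover obtain z where z: "algebraic_int z" "\<alpha> ^ p = \<omega> ^ p + inverse \<omega> ^ p + of_nat p * z"
      unfolding \<alpha>_def by (rule freshman_dream_algebraic_int[OF int p(1)])
    ultimately have pz: "\<alpha> ^ p = \<alpha>\<^sup>2 - 2 + of_nat p * z"
      by (simp add: power_inverse) (simp add: \<alpha>_def power2_sum power_inverse)
    have "p > 0" using p(1) by (rule prime_gt_0_nat)
    \<comment> \<open>Solving for \<open>z\<close> shows that it lies in the field, so that its
      product with \<open>p\<close> lies in \<open>P\<close>.\<close>
    have "z = (\<alpha> ^ p - (\<alpha>\<^sup>2 - 2)) * inverse (of_int (int p))"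
      using pz \<open>p > 0\<close> by (simp add: field_simps)
    also have "\<dots> \<in> rat_adjoin \<alpha>"
      by (intro E_closed(4,6,8,9) \<alpha>(2) of_int_mem two)
    finally have "z * of_nat p \<in> P"
      using z(1) by (intro P_mult p_in_P)
    moreover have "\<alpha> ^ p - of_int n ^ p \<in> P"
    proof -
      have eq: "\<alpha> ^ p - of_int n ^ p = (\<Sum>i<p. of_int n ^ (p - Suc i) * \<alpha> ^ i) * (\<alpha> - of_int n)"
        by (subst power_diff_sumr2) (simp add: mult.commute)
      moreover have "(\<Sum>i<k. of_int n ^ (p - Suc i) * \<alpha> ^ i) \<in> rat_adjoin \<alpha>" for k
        by (induction k) (simp_all add: E_closed(1,3,4,8) \<alpha>(2))
      moreover have "algebraic_int (\<Sum>i<p. of_int n ^ (p - Suc i) * \<alpha> ^ i)"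
        by (intro algebraic_int_sum algebraic_int_add_mult(2) algebraic_int_power \<alpha>(1) algebraic_int_of_int)
      ultimately show ?thesis
        unfolding eq using \<open>\<alpha> - of_int n \<in> P\<close> by (intro P_mult)
    qed
    moreover have "of_int n ^ p - of_int n \<in> P"
      using of_int_in_P_iff[of "n ^ p - n"] prime_dvd_power_minus_self[OF p(1)] by simp
    \<comment> \<open>The terms telescope to \<open>\<alpha> ^ p - \<alpha> - z * of_nat p\<close>,
      which is \<gamma> by \<open>pz\<close>.\<close>
    ultimately have "(\<alpha> ^ p - of_int n ^ p) + (of_int n ^ p - of_int n) - (\<alpha> - of_int n) - z * of_nat p \<in> P"
      by (intro P_diff[OF P_diff[OF P_add \<open>\<alpha> - of_int n \<in> P\<close>]])
    thus ?thesis by (simp add: pz \<gamma>_def algebra_simps)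
  qed
  \<comment> \<open>The cofactor that takes \<gamma> to \<open>m * m\<close>: both \<omega> and
    \<open>\<omega> ^ 3\<close> are \<open>m\<close>-th roots of unity other than 1, and each
    contributes one \<open>m\<close>.\<close>
  define \<delta> where "\<delta> = \<omega> ^ 2 * ((of_nat m / (\<omega> - 1)) * (of_nat m / (\<omega> ^ 3 - 1)))"
  have "\<gamma> \<noteq> 0" using \<open>\<omega> \<noteq> 1\<close> \<omega>(2) by (simp add: \<gamma>_eq)
  have \<gamma>\<delta>: "\<delta> * \<gamma> = of_int (int (m * m))"
    using \<open>\<omega> \<noteq> 1\<close> \<omega>(2) by (simp add: \<gamma>_eq \<delta>_def power_inverse)
  have "(\<omega> ^ 3) ^ m = 1" using \<omega>(1) by (simp add: power_mult[symmetric] mult.commute[of 3]) (simp add: power_mult)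
  hence "algebraic_int \<delta>"
    unfolding \<delta>_def
    by (intro algebraic_int_add_mult(2) algebraic_int_power int(1)
        root_of_unity_minus_one_dvd[OF \<omega>(1) \<open>\<omega> \<noteq> 1\<close> \<omega>(3)] root_of_unity_minus_one_dvd[OF _ \<omega>(2,3)])
  moreover have "\<delta> = of_int (int (m * m)) * inverse \<gamma>"
    using \<gamma>\<delta> \<open>\<gamma> \<noteq> 0\<close> by (simp add: field_simps)
  hence "\<delta> \<in> rat_adjoin \<alpha>"
    using E_closed(4)[OF of_int_mem E_closed(9)[OF \<open>\<gamma> \<in> rat_adjoin \<alpha>\<close>]] by (simp only:)
  ultimately have "of_int (int (m * m)) \<in> P"
    unfolding \<gamma>\<delta>[symmetric] using \<open>\<gamma> \<in> P\<close> by (intro P_mult)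
  hence "p dvd m * m" by (simp only: of_int_in_P_iff int_dvd_int_iff)
  hence "p dvd m" using p(1) by (simp add: prime_dvd_mult_iff)
  thus False using p(1,2) by (metis coprime_absorb_left not_prime_unit)
qed

section \<open>Dirichlet characters\<close>

lemmas cong_iff_mod_eq = unique_euclidean_semiring_class.cong_def

text \<open>Functions on the natural numbers, not on the unit group, so that characters serve
  directly as coefficients. The value 1 at 1 follows from multiplicativity and nonvanishing.\<close>

definition dirichlet_characters :: "nat \<Rightarrow> (nat \<Rightarrow> complex) set" where
  "dirichlet_characters N = {\<psi>. (\<forall>m n. \<psi> (m * n) = \<psi> m * \<psi> n) \<and>
     (\<forall>n. \<psi> n \<noteq> 0 \<longleftrightarrow> coprime n N) \<and> (\<forall>m n. [m = n] (mod N) \<longrightarrow> \<psi> m = \<psi> n)}"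

definition principal_character :: "nat \<Rightarrow> nat \<Rightarrow> complex" where
  "principal_character N n = (if coprime n N then 1 else 0)"

text \<open>A character of a subgroup of the units modulo \<open>N\<close>, the subgroup being given
  as the union of its residue classes. Closure under products yields inverses because units have
  finite order.\<close>

definition partial_character :: "nat \<Rightarrow> nat set \<Rightarrow> (nat \<Rightarrow> complex) \<Rightarrow> bool" where
  "partial_character N H \<psi> \<longleftrightarrow>
     1 \<in> H \<and> \<psi> 1 = 1 \<and>
     (\<forall>m\<in>H. coprime m N) \<and>
     (\<forall>m\<in>H. \<forall>n. [m = n] (mod N) \<longrightarrow> n \<in> H \<and> \<psi> m = \<psi> n) \<and>
     (\<forall>m\<in>H. \<forall>n\<in>H. m * n \<in> H \<and> \<psi> (m * n) = \<psi> m * \<psi> n)"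

section \<open>Extending characters from subgroups\<close>

context
  fixes N :: nat and H :: "nat set" and \<psi> :: "nat \<Rightarrow> complex"
  assumes pc: "partial_character N H \<psi>"
begin

lemma partial_character_one: "1 \<in> H" "\<psi> 1 = 1"
  and partial_character_coprime: "m \<in> H \<Longrightarrow> coprime m N"
  and partial_character_cong: "m \<in> H \<Longrightarrow> [m = n] (mod N) \<Longrightarrow> n \<in> H" "m \<in> H \<Longrightarrow> [m = n] (mod N) \<Longrightarrow> \<psi> n = \<psi> m"
  and partial_character_mult: "m \<in> H \<Longrightarrow> n \<in> H \<Longrightarrow> m * n \<in> H" "m \<in> H \<Longrightarrow> n \<in> H \<Longrightarrow> \<psi> (m * n) = \<psi> m * \<psi> n"
  using pc unfolding partial_character_def by auto

lemma partial_character_power: "m \<in> H \<Longrightarrow> m ^ k \<in> H" "m \<in> H \<Longrightarrow> \<psi> (m ^ k) = \<psi> m ^ k"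
  by (induction k) (auto intro: partial_character_mult simp: partial_character_one[simplified] partial_character_mult)

lemma partial_character_nonzero:
  assumes "m \<in> H"
  shows "\<psi> m \<noteq> 0"
proof
  assume "\<psi> m = 0"
  have "[m ^ totient N = 1] (mod N)"
    by (rule euler_theorem[OF partial_character_coprime[OF assms]])
  hence "\<psi> m ^ totient N = 1"
    using partial_character_cong(2)[OF partial_character_power(1)[OF assms]] partial_character_power(2)[OF assms]
      partial_character_one by metis
  with \<open>\<psi> m = 0\<close> have "totient N = 0" by (cases "totient N") auto
  hence "N = 0" by simp
  hence "m = 1" using partial_character_coprime[OF assms] by simp
  with \<open>\<psi> m = 0\<close> show False using partial_character_one by simp
qed

text \<open>By Euler's theorem \<open>m ^ (totient N - 1)\<close> inverts \<open>m\<close> modulo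
  \<open>N\<close>, and it lies in \<open>H\<close>.\<close>

lemma partial_character_cancel:
  assumes "m \<in> H" "m * n \<in> H" "N > 0"
  shows "n \<in> H"
proof -
  have "[m ^ totient N * n = 1 * n] (mod N)"
    by (intro cong_mult euler_theorem partial_character_coprime assms cong_refl)
  moreover have "m ^ totient N * n = m ^ (totient N - 1) * (m * n)"
    using \<open>N > 0\<close> by (cases "totient N") auto
  ultimately show ?thesis
    using partial_character_cong(1) partial_character_mult(1) partial_character_power(1) assms
    by (metis mult_1)
qed

text \<open>Here \<open>k\<close> is the order of \<open>x\<close> modulo \<open>H\<close>, and
  \<open>w\<close> may be any \<open>k\<close>-th root of the forced value
  \<open>\<psi> (x ^ k)\<close>. The extension sends \<open>h * x ^ j\<close> to
  \<open>\<psi> h * w ^ j\<close>. The freedom in \<open>w\<close> is what later separates residue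
  classes.\<close>

lemma extend_partial_character:
  assumes "N > 0" and x: "coprime x N" and k: "k > 0" "x ^ k \<in> H" "\<And>j. 0 < j \<Longrightarrow> j < k \<Longrightarrow> x ^ j \<notin> H"
    and w: "w ^ k = \<psi> (x ^ k)"
  obtains H' \<psi>' where "partial_character N H' \<psi>'" "H \<subseteq> H'" "x \<in> H'"
    "\<forall>h\<in>H. \<psi>' h = \<psi> h" "\<psi>' x = w"
proof -
  \<comment> \<open>The remainder of \<open>d\<close> modulo \<open>k\<close> gives a smaller power
    of \<open>x\<close> in \<open>H\<close>, so it is 0 by minimality. This makes the extension well
    defined.\<close>
  have pow: "k dvd d \<and> \<psi> (x ^ d) = w ^ d" if d: "x ^ d \<in> H" for d
  proof -
    have eq: "x ^ d = (x ^ k) ^ (d div k) * x ^ (d mod k)"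
      by (simp flip: power_mult power_add)
    have "x ^ (d mod k) \<in> H"
      using partial_character_cancel[OF partial_character_power(1)[OF k(2)]] d eq \<open>N > 0\<close> by metis
    hence "d mod k = 0" using k(3)[of "d mod k"] k(1) by auto
    moreover from this have "\<psi> (x ^ d) = (w ^ k) ^ (d div k)"
      unfolding eq w using partial_character_power(2)[OF k(2)] by simp
    ultimately show ?thesis
      by (metis dvd_eq_mod_eq_0 dvd_mult_div_cancel power_mult)
  qed
  have wd_le: "\<psi> h * w ^ i = \<psi> h' * w ^ j"
    if h: "h \<in> H" "h' \<in> H" and c: "[h * x ^ i = h' * x ^ j] (mod N)" and "i \<le> j" for h h' i j
  proof -
    have "x ^ j = x ^ (j - i) * x ^ i" using \<open>i \<le> j\<close> by (simp flip: power_add)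
    hence "[h * x ^ i = h' * x ^ (j - i) * x ^ i] (mod N)"
      using c by (simp add: mult.assoc)
    hence c': "[h = h' * x ^ (j - i)] (mod N)"
      using x by (simp add: cong_mult_rcancel_nat coprime_commute)
    hence in_H: "h' * x ^ (j - i) \<in> H" using partial_character_cong(1)[OF h(1)] by blast
    hence x_in: "x ^ (j - i) \<in> H" using partial_character_cancel h(2) \<open>N > 0\<close> by blast
    have "\<psi> h = \<psi> h' * w ^ (j - i)"
      using partial_character_cong(2)[OF h(1) c'] partial_character_mult(2)[OF h(2) x_in] pow[OF x_in] by simp
    thus ?thesis using \<open>i \<le> j\<close> by (simp add: mult.assoc flip: power_add)
  qed
  have wd: "\<psi> h * w ^ i = \<psi> h' * w ^ j"
    if "h \<in> H" "h' \<in> H" "[h * x ^ i = h' * x ^ j] (mod N)" for h h' i j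
    using wd_le[OF that] wd_le[OF that(2,1) cong_sym[OF that(3)]] by (cases "i \<le> j") auto
  define H' where "H' = {m. \<exists>h\<in>H. \<exists>j. [m = h * x ^ j] (mod N)}"
  define \<psi>' where "\<psi>' m = (SOME c. \<exists>h\<in>H. \<exists>j. [m = h * x ^ j] (mod N) \<and> c = \<psi> h * w ^ j)" for m
  have \<psi>': "\<psi>' m = \<psi> h * w ^ j" if m: "h \<in> H" "[m = h * x ^ j] (mod N)" for m h j
    unfolding \<psi>'_def
  proof (rule some_equality)
    show "\<exists>h'\<in>H. \<exists>i. [m = h' * x ^ i] (mod N) \<and> \<psi> h * w ^ j = \<psi> h' * w ^ i"
      using m by blast
  next
    fix c assume "\<exists>h'\<in>H. \<exists>i. [m = h' * x ^ i] (mod N) \<and> c = \<psi> h' * w ^ i"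
    then obtain h' i where h': "h' \<in> H" "[m = h' * x ^ i] (mod N)" "c = \<psi> h' * w ^ i" by blast
    have "[h' * x ^ i = h * x ^ j] (mod N)"
      using cong_trans[OF cong_sym[OF h'(2)] m(2)] .
    thus "c = \<psi> h * w ^ j" using wd[OF h'(1) m(1)] h'(3) by simp
  qed
  have "partial_character N H' \<psi>'"
    unfolding partial_character_def
  proof (intro conjI ballI allI impI)
    have one: "[1 = 1 * x ^ 0] (mod N)" by simp
    show "1 \<in> H'" unfolding H'_def using partial_character_one(1) one by blast
    show "\<psi>' 1 = 1"
      using \<psi>'[OF partial_character_one(1) one] partial_character_one(2) by simp
  next
    fix m assume "m \<in> H'"
    then obtain h j where h: "h \<in> H" "[m = h * x ^ j] (mod N)" by (auto simp: H'_def)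
    show "coprime m N"
      using cong_imp_coprime[OF cong_sym[OF h(2)]] partial_character_coprime[OF h(1)] x by simp
    fix n assume n: "[m = n] (mod N)"
    have n': "[n = h * x ^ j] (mod N)" using cong_trans[OF cong_sym[OF n] h(2)] .
    thus "n \<in> H'" using h by (auto simp: H'_def)
    show "\<psi>' m = \<psi>' n" using \<psi>'[OF h] \<psi>'[OF h(1) n'] by simp
  next
    fix m n assume "m \<in> H'" "n \<in> H'"
    then obtain h i g j where h: "h \<in> H" "[m = h * x ^ i] (mod N)" "g \<in> H" "[n = g * x ^ j] (mod N)"
      by (auto simp: H'_def)
    have mn: "[m * n = (h * g) * x ^ (i + j)] (mod N)"
      using cong_mult[OF h(2,4)] by (simp add: power_add mult_ac)
    have hg: "h * g \<in> H" using partial_character_mult(1) h by blast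
    show "m * n \<in> H'" using mn hg by (auto simp: H'_def)
    show "\<psi>' (m * n) = \<psi>' m * \<psi>' n"
      using \<psi>'[OF hg mn] \<psi>'[OF h(1,2)] \<psi>'[OF h(3,4)] partial_character_mult(2)[OF h(1,3)]
      by (simp add: power_add)
  qed
  moreover have "h \<in> H' \<and> \<psi>' h = \<psi> h" if "h \<in> H" for h
  proof -
    have "[h = h * x ^ 0] (mod N)" by simp
    thus ?thesis using \<psi>'[OF that, of h 0] that unfolding H'_def by fastforce
  qed
  hence "H \<subseteq> H'" "\<forall>h\<in>H. \<psi>' h = \<psi> h" by auto
  moreover have "[x = 1 * x ^ 1] (mod N)" by simp
  hence "x \<in> H'" "\<psi>' x = w"
    using \<psi>'[OF partial_character_one(1), of x 1] partial_character_one unfolding H'_def by fastforce+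
  ultimately show ?thesis using that by blast
qed

end

lemma least_power_in:
  assumes pc: "partial_character N H \<psi>" and "coprime x N" "N > 0"
  shows "\<exists>k>0. x ^ k \<in> H \<and> (\<forall>j. 0 < j \<longrightarrow> j < k \<longrightarrow> x ^ j \<notin> H)"
proof -
  have "x ^ totient N \<in> H"
    using partial_character_cong(1)[OF pc partial_character_one(1)[OF pc]] cong_sym[OF euler_theorem[OF assms(2)]]
    by blast
  hence ex: "\<exists>k. k > 0 \<and> x ^ k \<in> H" using \<open>N > 0\<close> by (intro exI[of _ "totient N"]) auto
  define k where "k = (LEAST k. k > 0 \<and> x ^ k \<in> H)"
  have "k > 0 \<and> x ^ k \<in> H" unfolding k_def by (rule LeastI_ex[OF ex])
  moreover have "x ^ j \<notin> H" if "0 < j" "j < k" for j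
    using not_less_Least[of j "\<lambda>k. k > 0 \<and> x ^ k \<in> H"] that by (auto simp: k_def)
  ultimately show ?thesis by blast
qed

text \<open>Missing units are adjoined one at a time, keeping the value at \<open>b\<close>; the
  induction counts the unit residues outside \<open>H\<close>.\<close>

lemma extend_to_dirichlet_character:
  assumes "partial_character N H \<psi>" "b \<in> H" "\<psi> b = w" "N > 0"
  shows "\<exists>\<rho>\<in>dirichlet_characters N. \<rho> b = w"
  using assms
proof (induction "card ({n. n < N \<and> coprime n N} - H)" arbitrary: H \<psi> rule: less_induct)
  case (less H \<psi>)
  note pc = less.prems(1)
  show ?case
  proof (cases "{n. coprime n N} \<subseteq> H")
    case True
    define \<rho> where "\<rho> n = (if coprime n N then \<psi> n else 0)" for n
    have "\<rho> \<in> dirichlet_characters N"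
      unfolding dirichlet_characters_def
    proof (intro CollectI conjI allI impI)
      show "\<rho> (m * n) = \<rho> m * \<rho> n" for m n
        using True partial_character_mult(2)[OF pc, of m n] by (auto simp: \<rho>_def)
      show "\<rho> n \<noteq> 0 \<longleftrightarrow> coprime n N" for n
        using True partial_character_nonzero[OF pc, of n] by (auto simp: \<rho>_def)
      show "\<rho> m = \<rho> n" if "[m = n] (mod N)" for m n
      proof -
        have "coprime m N \<longleftrightarrow> coprime n N"
          using cong_imp_coprime[OF that] cong_imp_coprime[OF cong_sym[OF that]] by argo
        moreover have "\<psi> n = \<psi> m" if "coprime m N"
          using True that by (intro partial_character_cong(2)[OF pc _ \<open>[m = n] (mod N)\<close>]) auto
        ultimately show ?thesis by (simp add: \<rho>_def)
      qed
    qed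
    moreover have "\<rho> b = w" using less.prems(3) partial_character_coprime[OF pc less.prems(2)] by (simp add: \<rho>_def)
    ultimately show ?thesis by blast
  next
    case False
    then obtain x where x: "coprime x N" "x \<notin> H" by blast
    obtain k where k: "k > 0" "x ^ k \<in> H" "\<forall>j. 0 < j \<longrightarrow> j < k \<longrightarrow> x ^ j \<notin> H"
      using least_power_in[OF pc x(1) \<open>N > 0\<close>] by blast
    \<comment> \<open>Some \<open>k\<close>-th root, taken through the logarithm of a nonzero
      value.\<close>
    define v where "v = exp (Ln (\<psi> (x ^ k)) / of_nat k)"
    have v: "v ^ k = \<psi> (x ^ k)"
      using partial_character_nonzero[OF pc k(2)] k(1)
      by (simp add: v_def flip: exp_of_nat_mult)
    obtain H' \<psi>' where H': "partial_character N H' \<psi>'" "H \<subseteq> H'" "x \<in> H'"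
        "\<forall>m\<in>H. \<psi>' m = \<psi> m" "\<psi>' x = v"
      by (rule extend_partial_character[OF pc \<open>N > 0\<close> x(1) k(1,2) k(3)[rule_format] v])
    show ?thesis
    proof (rule less.hyps[OF _ H'(1)])
      have "x mod N \<in> H'" "x mod N \<notin> H"
        using partial_character_cong(1)[OF H'(1,3)] partial_character_cong(1)[OF pc, of "x mod N" x] x(2)
        by (auto simp: cong_iff_mod_eq)
      moreover have "coprime (x mod N) N" "x mod N < N"
        using x(1) \<open>N > 0\<close> by auto
      ultimately show "card ({n. n < N \<and> coprime n N} - H') < card ({n. n < N \<and> coprime n N} - H)"
        using H'(2) by (intro psubset_card_mono) auto
      show "b \<in> H'" "\<psi>' b = w" using less.prems(2,3) H'(2) H'(4) by auto
    qed fact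
  qed
qed

text \<open>Start from the trivial subgroup and adjoin \<open>b\<close>: its order \<open>k\<close>
  exceeds 1, so its value can be a primitive \<open>k\<close>-th root of unity.\<close>

lemma dirichlet_character_separates:
  assumes "coprime b N" "\<not> [b = 1] (mod N)" "N > 0"
  obtains \<rho> where "\<rho> \<in> dirichlet_characters N" "\<rho> b \<noteq> 1"
proof -
  have pc: "partial_character N {n. [n = 1] (mod N)} (\<lambda>_. 1)"
    unfolding partial_character_def
    using cong_mult[of _ 1 N _ 1] by (auto intro: cong_sym cong_trans dest: cong_imp_coprime[OF cong_sym])
  obtain k where k: "k > 0" "b ^ k \<in> {n. [n = 1] (mod N)}"
      "\<forall>j. 0 < j \<longrightarrow> j < k \<longrightarrow> b ^ j \<notin> {n. [n = 1] (mod N)}"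
    using least_power_in[OF pc assms(1,3)] by blast
  have "k \<noteq> 1" using k(2) assms(2) by auto
  hence "k > 1" using k(1) by simp
  define w where "w = cis (2 * pi / k)"
  have "w ^ k = 1" unfolding w_def Complex.DeMoivre using k(1) by simp
  have "w \<noteq> 1"
  proof
    assume "w = 1"
    hence "cos (2 * pi / k) = 1" unfolding w_def by (metis cis.simps(1) one_complex.simps(1))
    then obtain n :: int where "2 * pi / k = of_int n * 2 * pi" by (auto simp: cos_one_2pi_int)
    hence "1 = real_of_int (n * int k)" using k(1) by (simp add: field_simps)
    hence "1 = n * int k" by linarith
    hence "int k dvd 1" by (metis dvd_triv_right)
    thus False using \<open>k > 1\<close> by simp
  qed
  obtain H \<psi> where "partial_character N H \<psi>" "b \<in> H" "\<psi> b = w"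
    by (rule extend_partial_character[OF pc assms(3,1) k(1,2) k(3)[rule_format] \<open>w ^ k = 1\<close>])
  then obtain \<rho> where "\<rho> \<in> dirichlet_characters N" "\<rho> b = w"
    using extend_to_dirichlet_character assms(3) by blast
  thus ?thesis using \<open>w \<noteq> 1\<close> that by blast
qed

section \<open>Values, finiteness and orthogonality of characters\<close>

lemma dirichlet_characterD:
  assumes "\<psi> \<in> dirichlet_characters N"
  shows "\<psi> (m * n) = \<psi> m * \<psi> n" "\<psi> n \<noteq> 0 \<longleftrightarrow> coprime n N" "[m = n] (mod N) \<Longrightarrow> \<psi> m = \<psi> n"
  using assms unfolding dirichlet_characters_def by blast+

lemma dirichlet_character_one:
  assumes "\<psi> \<in> dirichlet_characters N"
  shows "\<psi> (Suc 0) = 1"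
proof -
  have "\<psi> 1 * \<psi> 1 = \<psi> 1" using dirichlet_characterD(1)[OF assms, of 1 1] by simp
  moreover have "\<psi> 1 \<noteq> 0" using dirichlet_characterD(2)[OF assms] by simp
  ultimately show ?thesis by simp
qed

lemma dirichlet_character_power:
  assumes "\<psi> \<in> dirichlet_characters N"
  shows "\<psi> (n ^ k) = \<psi> n ^ k"
  by (induction k) (simp_all add: dirichlet_character_one[OF assms] dirichlet_characterD(1)[OF assms])

lemma dirichlet_character_root_of_unity:
  assumes \<psi>: "\<psi> \<in> dirichlet_characters N" and "coprime n N"
  shows "\<psi> n ^ totient N = 1"
proof -
  have "\<psi> (n ^ totient N) = \<psi> 1"
    by (rule dirichlet_characterD(3)[OF \<psi> euler_theorem[OF assms(2)]])
  thus ?thesis by (simp add: dirichlet_character_power[OF \<psi>] dirichlet_character_one[OF \<psi>])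
qed

lemma norm_dirichlet_character:
  assumes \<psi>: "\<psi> \<in> dirichlet_characters N" and "N > 0"
  shows "norm (\<psi> n) = (if coprime n N then 1 else 0)"
proof (cases "coprime n N")
  case True
  hence "norm (\<psi> n) ^ totient N = 1"
    using dirichlet_character_root_of_unity[OF \<psi>] by (metis norm_one norm_power)
  moreover have "totient N > 0" using \<open>N > 0\<close> by simp
  ultimately have "norm (\<psi> n) = 1"
    by (metis norm_ge_zero power_eq_imp_eq_base power_one zero_le_one)
  thus ?thesis using True by simp
next
  case False
  thus ?thesis using dirichlet_characterD(2)[OF \<psi>, of n] by auto
qed

lemma norm_dirichlet_character_le:
  assumes "\<psi> \<in> dirichlet_characters N" "N > 0"
  shows "norm (\<psi> n) \<le> 1"
  using norm_dirichlet_character[OF assms, of n] by simp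

lemma dirichlet_character_mod:
  assumes "\<psi> \<in> dirichlet_characters N"
  shows "\<psi> (n mod N) = \<psi> n"
  by (rule dirichlet_characterD(3)[OF assms]) (simp add: cong_iff_mod_eq)

lemma principal_character: "principal_character N \<in> dirichlet_characters N"
proof -
  have "coprime m N \<longleftrightarrow> coprime n N" if "[m = n] (mod N)" for m n
    using cong_imp_coprime[OF that] cong_imp_coprime[OF cong_sym[OF that]] by argo
  thus ?thesis
    unfolding dirichlet_characters_def principal_character_def by auto
qed

lemma dirichlet_characters_mult:
  assumes "\<psi> \<in> dirichlet_characters N" "\<rho> \<in> dirichlet_characters N"
  shows "(\<lambda>n. \<psi> n * \<rho> n) \<in> dirichlet_characters N"
  unfolding dirichlet_characters_def
proof (intro CollectI conjI allI impI)
  show "\<psi> (m * n) * \<rho> (m * n) = \<psi> m * \<rho> m * (\<psi> n * \<rho> n)" for m n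
    using assms[THEN dirichlet_characterD(1)] by simp
  show "\<psi> n * \<rho> n \<noteq> 0 \<longleftrightarrow> coprime n N" for n
    using assms[THEN dirichlet_characterD(2)] by simp
  show "\<psi> m * \<rho> m = \<psi> n * \<rho> n" if "[m = n] (mod N)" for m n
    using assms[THEN dirichlet_characterD(3), OF that] by simp
qed

text \<open>A character is determined by \<open>N\<close> values, each 0 or a root of unity of order
  dividing \<open>totient N\<close>.\<close>

lemma finite_dirichlet_characters:
  assumes "N > 0"
  shows "finite (dirichlet_characters N)"
proof -
  define R where "R = insert 0 {z::complex. z ^ totient N = 1}"
  have "finite R"
    using assms by (simp add: R_def finite_roots_unity Suc_leI)
  have val: "\<psi> n \<in> R" if "\<psi> \<in> dirichlet_characters N" for \<psi> n
    using dirichlet_character_root_of_unity[OF that, of n] dirichlet_characterD(2)[OF that, of n]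
    by (auto simp: R_def)
  have "inj_on (\<lambda>\<psi>. restrict \<psi> {..<N}) (dirichlet_characters N)"
  proof (rule inj_onI)
    fix \<psi> \<rho> assume \<psi>: "\<psi> \<in> dirichlet_characters N" and \<rho>: "\<rho> \<in> dirichlet_characters N"
      and eq: "restrict \<psi> {..<N} = restrict \<rho> {..<N}"
    show "\<psi> = \<rho>"
    proof
      fix n
      have "\<psi> (n mod N) = \<rho> (n mod N)"
        using fun_cong[OF eq, of "n mod N"] \<open>N > 0\<close> by simp
      thus "\<psi> n = \<rho> n"
        using dirichlet_character_mod[OF \<psi>] dirichlet_character_mod[OF \<rho>] by simp
    qed
  qed
  moreover have "(\<lambda>\<psi>. restrict \<psi> {..<N}) ` dirichlet_characters N \<subseteq> Pi\<^sub>E {..<N} (\<lambda>_. R)"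
    using val by (intro image_subsetI) (simp add: restrict_PiE_iff)
  moreover have "finite (Pi\<^sub>E {..<N} (\<lambda>_. R))"
    using \<open>finite R\<close> by (intro finite_PiE) auto
  ultimately show ?thesis using finite_imageD finite_subset by metis
qed

text \<open>Multiplication by a character \<open>\<rho>\<close> with
  \<open>\<rho> b \<noteq> 1\<close> permutes the characters, so the sum equals
  \<open>\<rho> b\<close> times itself.\<close>

lemma sum_dirichlet_characters:
  assumes "N > 0" "coprime b N"
  shows "(\<Sum>\<psi>\<in>dirichlet_characters N. \<psi> b) =
           (if [b = 1] (mod N) then of_nat (card (dirichlet_characters N)) else 0)"
proof (cases "[b = 1] (mod N)")
  case True
  hence "\<psi> b = 1" if "\<psi> \<in> dirichlet_characters N" for \<psi>
    using dirichlet_characterD(3)[OF that True] dirichlet_character_one[OF that] by simp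
  hence "(\<Sum>\<psi>\<in>dirichlet_characters N. \<psi> b) = (\<Sum>\<psi>\<in>dirichlet_characters N. 1)"
    by (intro sum.cong) auto
  thus ?thesis using True by simp
next
  case False
  let ?X = "dirichlet_characters N"
  obtain \<rho> where \<rho>: "\<rho> \<in> ?X" "\<rho> b \<noteq> 1"
    by (rule dirichlet_character_separates[OF assms(2) False assms(1)])
  define f where "f \<psi> = (\<lambda>n. \<rho> n * \<psi> n)" for \<psi> :: "nat \<Rightarrow> complex"
  have "inj_on f ?X"
  proof (rule inj_onI)
    fix \<psi> \<psi>' assume \<psi>: "\<psi> \<in> ?X" "\<psi>' \<in> ?X" and eq: "f \<psi> = f \<psi>'"
    show "\<psi> = \<psi>'"
    proof
      fix n
      show "\<psi> n = \<psi>' n"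
        using fun_cong[OF eq, of n] \<psi>[THEN dirichlet_characterD(2), of n] dirichlet_characterD(2)[OF \<rho>(1), of n]
        by (auto simp: f_def)
    qed
  qed
  moreover have "f ` ?X \<subseteq> ?X"
    using dirichlet_characters_mult[OF \<rho>(1)] by (auto simp: f_def)
  ultimately have "f ` ?X = ?X"
    using finite_dirichlet_characters[OF assms(1)] by (intro endo_inj_surj)
  hence "(\<Sum>\<psi>\<in>?X. \<psi> b) = (\<Sum>\<psi>\<in>?X. f \<psi> b)"
    using sum.reindex[OF \<open>inj_on f ?X\<close>, of "\<lambda>\<psi>. \<psi> b"] by simp
  also have "\<dots> = \<rho> b * (\<Sum>\<psi>\<in>?X. \<psi> b)"
    by (simp add: f_def sum_distrib_left)
  finally show ?thesis using \<rho>(2) False by simp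
qed

text \<open>The dual argument: replacing \<open>n\<close> by \<open>c * n\<close>, for a unit
  \<open>c\<close> with \<open>\<psi> c \<noteq> 1\<close>, permutes the residues.\<close>

lemma sum_dirichlet_character_period:
  assumes \<psi>: "\<psi> \<in> dirichlet_characters N" "\<psi> \<noteq> principal_character N" and "N > 0"
  shows "(\<Sum>n<N. \<psi> n) = 0"
proof -
  have "\<exists>c. coprime c N \<and> \<psi> c \<noteq> 1"
  proof (rule ccontr)
    assume "\<not> ?thesis"
    hence "\<psi> n = principal_character N n" for n
      using dirichlet_characterD(2)[OF \<psi>(1), of n] by (auto simp: principal_character_def)
    with \<psi>(2) show False by blast
  qed
  then obtain c where c: "coprime c N" "\<psi> c \<noteq> 1" by blast
  define f where "f n = c * n mod N" for n
  have inj: "inj_on f {..<N}"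
  proof (rule inj_onI)
    fix x y assume xy: "x \<in> {..<N}" "y \<in> {..<N}" "f x = f y"
    hence "[c * x = c * y] (mod N)" by (simp add: f_def cong_iff_mod_eq)
    hence "[x = y] (mod N)" using c(1) by (simp add: cong_mult_lcancel_nat coprime_commute)
    thus "x = y" using xy by (simp add: cong_iff_mod_eq)
  qed
  moreover have "f ` {..<N} \<subseteq> {..<N}" using \<open>N > 0\<close> by (auto simp: f_def)
  ultimately have "f ` {..<N} = {..<N}" by (intro endo_inj_surj) auto
  hence "(\<Sum>n<N. \<psi> n) = (\<Sum>n<N. \<psi> (f n))"
    using sum.reindex[OF inj, of \<psi>] by simp
  also have "\<dots> = \<psi> c * (\<Sum>n<N. \<psi> n)"
    by (simp add: f_def dirichlet_character_mod[OF \<psi>(1)] dirichlet_characterD(1)[OF \<psi>(1)] sum_distrib_left)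
  finally show ?thesis using c(2) by simp
qed

text \<open>Complete periods cancel and fewer than \<open>N\<close> terms of norm at most 1 remain.
  This bound feeds every use of \<open>abel_summation_bound\<close>.\<close>

lemma norm_sum_dirichlet_character_le:
  assumes \<psi>: "\<psi> \<in> dirichlet_characters N" "\<psi> \<noteq> principal_character N" and "N > 0"
  shows "norm (\<Sum>n<M. \<psi> n) \<le> N"
proof -
  have shift: "(\<Sum>n<k * N + r. \<psi> n) = (\<Sum>n<r. \<psi> n)" for k r
  proof (induction k)
    case (Suc k)
    have "(\<Sum>n<N + m. \<psi> n) = (\<Sum>n<N. \<psi> n) + (\<Sum>n<m. \<psi> (N + n))" for m
      by (induction m) (simp_all add: algebra_simps)
    moreover have "\<psi> (N + n) = \<psi> n" for n
      by (rule dirichlet_characterD(3)[OF \<psi>(1)]) (simp add: cong_iff_mod_eq)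
    ultimately show ?case
      using Suc sum_dirichlet_character_period[OF assms] by (simp add: add.assoc)
  qed simp
  have "norm (\<Sum>n<M. \<psi> n) = norm (\<Sum>n<M mod N. \<psi> n)"
    using shift[of "M div N" "M mod N"] by simp
  also have "\<dots> \<le> (\<Sum>n<M mod N. 1)"
    by (rule sum_norm_le) (rule norm_dirichlet_character_le[OF \<psi>(1) \<open>N > 0\<close>])
  also have "\<dots> \<le> N" using \<open>N > 0\<close> by (simp add: less_imp_le)
  finally show ?thesis .
qed

section \<open>Dirichlet series\<close>

text \<open>Meant for s > 1, where absolute convergence lets the unordered sum be regrouped by
  divisors and by prime factors. In ordered partial sums the index 0 may appear, since
  \<open>0 powr _\<close> is 0.\<close>

definition dirichlet_series :: "(nat \<Rightarrow> complex) \<Rightarrow> real \<Rightarrow> complex" where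
  "dirichlet_series a s = infsum (\<lambda>n. a n * of_real (real n powr - s)) {0<..}"

lemma summable_on_powr:
  assumes "s > 1"
  shows "(\<lambda>n. real n powr - s) summable_on {0<..}"
proof -
  have "summable (\<lambda>n. real n powr - s)"
    using assms by (subst summable_real_powr_iff) simp
  hence "(\<lambda>n. real n powr - s) summable_on UNIV"
    by (subst summable_on_UNIV_nonneg_real_iff) auto
  thus ?thesis by (rule summable_on_subset_banach) simp
qed

lemma summable_on_ln_powr:
  assumes "s > 1"
  shows "(\<lambda>n. ln (real n) * real n powr - s) summable_on {0<..}"
proof (rule summable_on_comparison_test)
  \<comment> \<open>Half of the excess of \<open>s\<close> over 1 absorbs the logarithm, the other
    half keeps the series convergent.\<close>
  define e where "e = (s - 1) / 2"
  have e: "e > 0" "e + (- s) = - (1 + e)" using assms by (auto simp: e_def field_simps)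
  show "(\<lambda>n. 1 / e * real n powr - (1 + e)) summable_on {0<..}"
    using e by (intro summable_on_cmult_right summable_on_powr) simp
  fix n :: nat assume "n \<in> {0<..}"
  hence n: "real n \<ge> 1" by simp
  have "ln (real n) * real n powr - s \<le> real n powr e / e * real n powr - s"
    using ln_powr_bound[OF n e(1)] by (intro mult_right_mono) auto
  also have "\<dots> = 1 / e * real n powr - (1 + e)"
    unfolding e(2)[symmetric] powr_add by simp
  finally show "ln (real n) * real n powr - s \<le> 1 / e * real n powr - (1 + e)" .
  show "0 \<le> ln (real n) * real n powr - s" using n by simp
qed

text \<open>The bound \<open>1 + ln n\<close> is wide enough for characters, for the logarithm and
  for \<open>mangoldt\<close>, also when the latter two are twisted by a character.\<close>

lemma dirichlet_series_abs_summable: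
  assumes "s > 1" "\<And>n. n > 0 \<Longrightarrow> norm (a n) \<le> 1 + ln (real n)"
  shows "(\<lambda>n. norm (a n * complex_of_real (real n powr - s))) summable_on {0<..}"
proof (rule Infinite_Sum.abs_summable_on_comparison_test')
  show "(\<lambda>n. real n powr - s + ln (real n) * real n powr - s) summable_on {0<..}"
    by (intro summable_on_add summable_on_powr summable_on_ln_powr assms)
  fix n :: nat assume "n \<in> {0<..}"
  hence "norm (a n) * real n powr - s \<le> (1 + ln (real n)) * real n powr - s"
    using assms(2)[of n] by (intro mult_right_mono) auto
  thus "norm (a n * of_real (real n powr - s)) \<le> real n powr - s + ln (real n) * real n powr - s"
    by (simp add: norm_mult algebra_simps)
qed

text \<open>Absolute summability over all pairs, which are then regrouped by their product.\<close>

lemma infsum_dirichlet_product: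
  fixes f g :: "nat \<Rightarrow> complex"
  assumes f: "(\<lambda>n. norm (f n)) summable_on {0<..}" and g: "(\<lambda>n. norm (g n)) summable_on {0<..}"
  shows "((\<lambda>n. \<Sum>d | d dvd n. f d * g (n div d)) has_sum infsum f {0<..} * infsum g {0<..}) {0<..}"
proof -
  define h where "h = (\<lambda>(a, b). f a * g b)"
  have "(\<lambda>x. norm (h x)) summable_on {0<..} \<times> {0<..}"
    unfolding Infinite_Sum.abs_summable_on_Sigma_iff
  proof (intro conjI ballI)
    show "(\<lambda>b. norm (h (a, b))) summable_on {0<..}" for a
      unfolding h_def prod.case norm_mult by (rule summable_on_cmult_right[OF g])
    define G where "G = infsum (\<lambda>b. norm (g b)) {0<..}"
    have "infsum (\<lambda>b. norm (h (a, b))) {0<..} = norm (f a) * G" for a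
      unfolding h_def prod.case norm_mult G_def by (rule infsum_cmult_right) (rule g)
    moreover have "G \<ge> 0"
      unfolding G_def by (rule infsum_nonneg) (rule norm_ge_zero)
    ultimately have "norm (infsum (\<lambda>b. norm (h (a, b))) {0<..}) = norm (f a) * G" for a
      by (simp only: real_norm_def abs_mult abs_norm_cancel abs_of_nonneg)
    thus "(\<lambda>a. norm (infsum (\<lambda>b. norm (h (a, b))) {0<..})) summable_on {0<..}"
      using summable_on_cmult_left[OF f, of G] by (simp only:)
  qed
  hence sum: "(h has_sum infsum h ({0<..} \<times> {0<..})) ({0<..} \<times> {0<..})"
    by (rule has_sum_infsum[OF abs_summable_summable])
  have "((\<lambda>a. f a * infsum g {0<..}) has_sum infsum h ({0<..} \<times> {0<..})) {0<..}"
    by (rule has_sum_SigmaD[OF sum], unfold h_def prod.case)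
      (intro has_sum_cmult_right has_sum_infsum abs_summable_summable[OF g])
  moreover have "((\<lambda>a. f a * infsum g {0<..}) has_sum infsum f {0<..} * infsum g {0<..}) {0<..}"
    by (intro has_sum_cmult_left has_sum_infsum abs_summable_summable[OF f])
  ultimately have eq: "infsum h ({0<..} \<times> {0<..}) = infsum f {0<..} * infsum g {0<..}"
    by (rule has_sum_unique)
  have "((\<lambda>(n, d). f d * g (n div d)) has_sum infsum f {0<..} * infsum g {0<..})
          (Sigma {0<..} (\<lambda>n. {d. d dvd n})) \<longleftrightarrow>
        (h has_sum infsum f {0<..} * infsum g {0<..}) ({0<..} \<times> {0<..})"
    by (rule has_sum_reindex_bij_witness[of _ "\<lambda>(a, b). (a * b, a)" "\<lambda>(n, d). (d, n div d)"])
      (auto simp: h_def dvd_pos_nat)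
  hence "((\<lambda>(n, d). f d * g (n div d)) has_sum infsum f {0<..} * infsum g {0<..})
          (Sigma {0<..} (\<lambda>n. {d. d dvd n}))"
    using sum unfolding eq by (rule iffD2)
  thus ?thesis
    by (rule has_sum_SigmaD) (simp add: has_sum_finite)
qed

lemma dirichlet_series_mult:
  assumes "s > 1" "\<And>n. n > 0 \<Longrightarrow> norm (a n) \<le> 1 + ln (real n)" "\<And>n. n > 0 \<Longrightarrow> norm (b n) \<le> 1 + ln (real n)"
  shows "dirichlet_series a s * dirichlet_series b s =
           dirichlet_series (\<lambda>n. \<Sum>d | d dvd n. a d * b (n div d)) s"
proof -
  let ?p = "\<lambda>n. complex_of_real (real n powr - s)"
  have "((\<lambda>n. \<Sum>d | d dvd n. (a d * ?p d) * (b (n div d) * ?p (n div d))) has_sum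
          dirichlet_series a s * dirichlet_series b s) {0<..}"
    unfolding dirichlet_series_def
    by (rule infsum_dirichlet_product; rule dirichlet_series_abs_summable; fact assms)
  moreover have "(\<Sum>d | d dvd n. (a d * ?p d) * (b (n div d) * ?p (n div d))) =
      (\<Sum>d | d dvd n. a d * b (n div d)) * ?p n" if "n \<in> {0<..}" for n
    unfolding sum_distrib_right
  proof (rule sum.cong)
    fix d assume "d \<in> {d. d dvd n}"
    then obtain k where k: "n = d * k" by auto
    hence "d > 0" using that by (cases "d = 0") auto
    thus "(a d * ?p d) * (b (n div d) * ?p (n div d)) = a d * b (n div d) * ?p n"
      using k by (simp add: powr_mult)
  qed simp
  ultimately have "((\<lambda>n. (\<Sum>d | d dvd n. a d * b (n div d)) * ?p n) has_sum
          dirichlet_series a s * dirichlet_series b s) {0<..}"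
    by (rule has_sum_cong[THEN iffD1, rotated])
  thus ?thesis unfolding dirichlet_series_def by (rule infsumI[symmetric])
qed

lemma norm_dirichlet_character_le_ln:
  assumes "\<psi> \<in> dirichlet_characters N" "N > 0" "n > 0"
  shows "norm (\<psi> n) \<le> 1 + ln (real n)"
  using norm_dirichlet_character_le[OF assms(1,2), of n] ln_ge_zero[of "real n"] assms(3) by linarith

lemma norm_mult_mangoldt_le:
  fixes \<psi> :: "nat \<Rightarrow> complex"
  assumes "norm (\<psi> n) \<le> 1" "n > 0"
  shows "norm (\<psi> n * mangoldt n) \<le> 1 + ln (real n)"
proof -
  have "norm (\<psi> n * mangoldt n) \<le> 1 * ln (real n)"
    unfolding norm_mult norm_mangoldt using assms mangoldt_le[OF assms(2)]
    by (intro mult_mono mangoldt_nonneg) auto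
  thus ?thesis by simp
qed

text \<open>The twist by \<open>\<psi>\<close> of the fact that \<open>mangoldt\<close> sums to
  \<open>ln n\<close> over the divisors of \<open>n\<close>. Classically it reads L (-L'/L) = -L',
  here without a derivative or logarithm of L.\<close>

lemma dirichlet_series_mangoldt:
  assumes \<psi>: "\<psi> \<in> dirichlet_characters N" and "N > 0" "s > 1"
  shows "dirichlet_series \<psi> s * dirichlet_series (\<lambda>n. \<psi> n * mangoldt n) s =
           dirichlet_series (\<lambda>n. \<psi> n * of_real (ln (real n))) s"
proof -
  note le = norm_dirichlet_character_le[OF \<psi> \<open>N > 0\<close>]
  have "dirichlet_series (\<lambda>n. \<psi> n * mangoldt n) s * dirichlet_series \<psi> s =
      dirichlet_series (\<lambda>n. \<Sum>d | d dvd n. \<psi> d * mangoldt d * \<psi> (n div d)) s"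
    using le by (intro dirichlet_series_mult[OF \<open>s > 1\<close>] norm_mult_mangoldt_le)
      (auto intro: order.trans[OF le])
  also have "\<dots> = dirichlet_series (\<lambda>n. \<psi> n * of_real (ln (real n))) s"
    unfolding dirichlet_series_def
  proof (rule infsum_cong)
    fix n :: nat assume n: "n \<in> {0<..}"
    have "(\<Sum>d | d dvd n. \<psi> d * mangoldt d * \<psi> (n div d)) = (\<Sum>d | d dvd n. \<psi> n * mangoldt d)"
    proof (rule sum.cong)
      fix d assume "d \<in> {d. d dvd n}"
      hence "\<psi> n = \<psi> d * \<psi> (n div d)"
        using dirichlet_characterD(1)[OF \<psi>, of d "n div d"] by simp
      thus "\<psi> d * mangoldt d * \<psi> (n div d) = \<psi> n * mangoldt d" by simp
    qed simp
    also have "\<dots> = \<psi> n * of_real (ln (real n))"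
      using n by (simp add: mangoldt_sum flip: sum_distrib_left)
    finally show "(\<Sum>d | d dvd n. \<psi> d * mangoldt d * \<psi> (n div d)) * of_real (real n powr - s) =
        \<psi> n * of_real (ln (real n)) * of_real (real n powr - s)" by simp
  qed
  finally show ?thesis by (simp add: mult.commute)
qed

text \<open>Real part of the power series of the logarithm. The summand at 0 is 0 because of
  division by 0.\<close>

lemma ln_norm_one_minus_sums:
  fixes w :: complex
  assumes "norm w < 1"
  shows "(\<lambda>n. - Re (w ^ n) / real n) sums ln (norm (1 - w))"
proof -
  have "(\<lambda>n. - ((- (- w)) ^ n) / of_nat n) sums ln (1 + (- w))"
    by (rule Ln_series') (use assms in simp)
  hence "(\<lambda>n. Re (- (w ^ n) / of_nat n)) sums Re (ln (1 - w))"
    by (intro sums_Re) simp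
  moreover have "1 - w \<noteq> 0" using assms by auto
  ultimately show ?thesis by (simp add: Re_divide_of_nat)
qed

text \<open>The inequality \<open>3 + 4 cos \<theta> + cos (2 \<theta>) \<ge> 0\<close>, in multiplicative form.\<close>

lemma three_four_one:
  fixes z :: complex
  assumes r: "0 \<le> r" "r < 1" and z: "norm z = 1"
  shows "norm (1 - of_real r :: complex) ^ 3 * norm (1 - of_real r * z) ^ 4 * norm (1 - of_real r * z\<^sup>2) \<le> 1"
proof -
  let ?A = "norm (1 - of_real r :: complex)" and ?B = "norm (1 - of_real r * z)"
    and ?C = "norm (1 - of_real r * z\<^sup>2)"
  have small: "norm (of_real r :: complex) < 1" "norm (of_real r * z) < 1" "norm (of_real r * z\<^sup>2) < 1"
    using r z by (simp_all add: norm_mult norm_power)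
  have pos: "?A > 0" "?B > 0" "?C > 0"
    using small by (metis norm_one norm_zero order_less_irrefl right_minus_eq zero_less_norm_iff)+
  have "(\<lambda>n. 3 * (- Re (of_real r ^ n) / real n) + 4 * (- Re ((of_real r * z) ^ n) / real n)
          + - Re ((of_real r * z\<^sup>2) ^ n) / real n) sums (3 * ln ?A + 4 * ln ?B + ln ?C)"
    by (intro sums_add sums_mult ln_norm_one_minus_sums small)
  moreover have "3 * (- Re (of_real r ^ n) / real n) + 4 * (- Re ((of_real r * z) ^ n) / real n)
          + - Re ((of_real r * z\<^sup>2) ^ n) / real n \<le> 0" for n
  proof -
    define c where "c = Re (z ^ n)"
    have "(Re (z ^ n))\<^sup>2 + (Im (z ^ n))\<^sup>2 = 1"
      using cmod_power2[of "z ^ n"] z by (simp add: norm_power)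
    hence "Re ((z ^ n)\<^sup>2) = 2 * c\<^sup>2 - 1" by (simp add: c_def Re_power2)
    hence c2: "Re ((z\<^sup>2) ^ n) = 2 * c\<^sup>2 - 1" by (simp flip: power_mult add: mult.commute)
    \<comment> \<open>The weights 3, 4, 1 produce a square:
      \<open>3 + 4 * c + (2 * c\<^sup>2 - 1) = 2 * (1 + c)\<^sup>2\<close>.\<close>
    have "3 * (- Re (of_real r ^ n) / real n) + 4 * (- Re ((of_real r * z) ^ n) / real n)
          + - Re ((of_real r * z\<^sup>2) ^ n) / real n = - (2 * (r ^ n * (1 + c)\<^sup>2) / real n)"
    proof -
      have "Re ((of_real r * z) ^ n) = r ^ n * c" "Re ((of_real r * z\<^sup>2) ^ n) = r ^ n * (2 * c\<^sup>2 - 1)"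
        "Re (of_real r ^ n) = r ^ n"
        by (simp_all add: power_mult_distrib c2 flip: of_real_power) (simp add: c_def)
      thus ?thesis
        by (simp only:) (simp add: power2_eq_square algebra_simps add_divide_distrib diff_divide_distrib)
    qed
    thus ?thesis using r by simp
  qed
  ultimately have "3 * ln ?A + 4 * ln ?B + ln ?C \<le> 0"
    by (metis (no_types, lifting) sums_le sums_zero)
  hence "ln (?A ^ 3 * ?B ^ 4 * ?C) \<le> 0"
    using pos by (simp add: ln_mult ln_realpow)
  thus ?thesis using pos by (simp add: ln_le_zero_iff)
qed

section \<open>The Euler product by sieving\<close>

context
  fixes N :: nat and \<psi> :: "nat \<Rightarrow> complex" and s :: real
  assumes \<psi>: "\<psi> \<in> dirichlet_characters N" and N: "N > 0" and s: "s > 1"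
begin

private abbreviation t where "t n \<equiv> \<psi> n * of_real (real n powr - s)"

text \<open>The \<open>x\<close>-rough numbers: 1 and whatever survives the sieve of Eratosthenes
  with the primes up to \<open>x\<close>.\<close>

private definition rough where
  "rough x = {n::nat. n > 0 \<and> (\<forall>q. Factorial_Ring.prime q \<longrightarrow> q dvd n \<longrightarrow> x < q)}"

private lemma summable_norm_t: "(\<lambda>n. norm (t n)) summable_on A" if "A \<subseteq> {0<..}"
proof (rule summable_on_subset_banach[OF _ that])
  show "(\<lambda>n. norm (t n)) summable_on {0<..}"
    by (rule dirichlet_series_abs_summable[OF s norm_dirichlet_character_le_ln[OF \<psi> N]])
qed

private lemma summable_t: "A \<subseteq> {0<..} \<Longrightarrow> t summable_on A"
  by (rule abs_summable_summable[OF summable_norm_t])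

private lemma t_mult: "t (m * n) = t m * t n"
  by (simp add: dirichlet_characterD(1)[OF \<psi>] powr_mult)

private lemma rough_subset: "rough x \<subseteq> {0<..}"
  by (auto simp: rough_def)

text \<open>The sieve of Eratosthenes applied to the series: by complete multiplicativity the
  multiples of \<open>p\<close> contribute \<open>t p\<close> times the sum over
  \<open>rough x\<close>, so the factor \<open>1 - t p\<close> removes exactly them.\<close>

lemma euler_product_step:
  "(\<Prod>p | Factorial_Ring.prime p \<and> p \<le> x. 1 - t p) * dirichlet_series \<psi> s = infsum t (rough x)"
proof (induction x)
  case 0
  have none: "{p::nat. Factorial_Ring.prime p \<and> p \<le> 0} = {}"
    by (auto dest: prime_gt_0_nat)
  have "rough 0 = {0<..}"
    by (auto simp: rough_def dest: prime_gt_0_nat)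
  thus ?case unfolding none by (simp add: dirichlet_series_def)
next
  case (Suc x)
  show ?case
  proof (cases "Factorial_Ring.prime (Suc x)")
    case False
    hence "{p. Factorial_Ring.prime p \<and> p \<le> Suc x} = {p. Factorial_Ring.prime p \<and> p \<le> x}"
      by (auto simp: le_Suc_eq)
    moreover have "Suc x < q \<longleftrightarrow> x < q" if "Factorial_Ring.prime q" for q
      using False that by (cases "q = Suc x") auto
    hence "rough (Suc x) = rough x"
      unfolding rough_def by blast
    ultimately show ?thesis using Suc by simp
  next
    case True
    define p where "p = Suc x"
    have p: "Factorial_Ring.prime p" "p > 0" using True by (simp_all add: p_def)
    have eq: "{p. Factorial_Ring.prime p \<and> p \<le> Suc x} = insert p {p. Factorial_Ring.prime p \<and> p \<le> x}"
      using True by (auto simp: le_Suc_eq p_def)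
    have union: "rough x = rough p \<union> (*) p ` rough x"
    proof (intro equalityI subsetI)
      fix n assume n: "n \<in> rough x"
      show "n \<in> rough p \<union> (*) p ` rough x"
      proof (cases "p dvd n")
        case True
        then obtain m where "n = p * m" by blast
        moreover from this have "m \<in> rough x" using n by (auto simp: rough_def)
        ultimately show ?thesis by blast
      next
        case False
        have "p < q" if "Factorial_Ring.prime q" "q dvd n" for q
        proof -
          have "x < q" using n that by (auto simp: rough_def)
          moreover have "q \<noteq> p" using False that by blast
          ultimately show ?thesis by (simp add: p_def)
        qed
        thus ?thesis using n by (auto simp: rough_def)
      qed
    next
      fix n assume "n \<in> rough p \<union> (*) p ` rough x"
      thus "n \<in> rough x"
      proof
        assume "n \<in> rough p"
        thus ?thesis by (auto simp: rough_def p_def dest: Suc_lessD)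
      next
        assume "n \<in> (*) p ` rough x"
        then obtain m where m: "n = p * m" "m \<in> rough x" by blast
        have "x < q" if q: "Factorial_Ring.prime q" "q dvd n" for q
        proof -
          have "q dvd p \<or> q dvd m" using q m by (simp add: prime_dvd_mult_iff)
          thus ?thesis
          proof
            assume "q dvd p"
            hence "q = p" using primes_dvd_imp_eq[OF q(1) p(1)] by simp
            thus ?thesis by (simp add: p_def)
          next
            assume "q dvd m"
            thus ?thesis using m(2) q(1) by (simp add: rough_def)
          qed
        qed
        thus ?thesis using m p by (simp add: rough_def)
      qed
    qed
    have disj: "rough p \<inter> (*) p ` rough x = {}"
      using p(1) by (auto simp: rough_def)
    have sub: "(*) p ` rough x \<subseteq> {0<..}" using union rough_subset[of x] by blast
    have "infsum t (rough x) = infsum t (rough p) + infsum t ((*) p ` rough x)"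
      by (subst union) (intro infsum_Un_disjoint summable_t rough_subset sub disj)
    also have "infsum t ((*) p ` rough x) = infsum (\<lambda>n. t (p * n)) (rough x)"
      using p(2) by (subst infsum_reindex) (auto simp: inj_on_def o_def)
    also have "\<dots> = t p * infsum t (rough x)"
      unfolding t_mult by (rule infsum_cmult_right) (intro summable_t rough_subset)
    finally have "infsum t (rough p) = (1 - t p) * infsum t (rough x)"
      by (simp add: algebra_simps)
    also have "infsum t (rough x) = (\<Prod>p | Factorial_Ring.prime p \<and> p \<le> x. 1 - t p) * dirichlet_series \<psi> s"
      by (rule Suc.IH[symmetric])
    finally show ?thesis
      unfolding eq by (subst prod.insert) (auto simp: p_def mult.assoc)
  qed
qed

private lemma tail_tendsto_0: "(\<lambda>x. infsum (\<lambda>n. real n powr - s) {x<..}) \<longlonglongrightarrow> 0"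
proof -
  let ?f = "\<lambda>n. real n powr - s"
  define Z where "Z = infsum ?f {0<..}"
  have "(?f has_sum Z) {0<..}" unfolding Z_def by (rule has_sum_infsum[OF summable_on_powr[OF s]])
  hence "(?f has_sum Z) UNIV"
    by (rule has_sum_cong_neutral[THEN iffD1, rotated -1]) auto
  hence "?f sums Z" by (rule has_sum_imp_sums)
  hence "(\<lambda>x. \<Sum>n\<le>x. ?f n) \<longlonglongrightarrow> Z" unfolding sums_def_le .
  hence "(\<lambda>x. Z - (\<Sum>n\<le>x. ?f n)) \<longlonglongrightarrow> Z - Z"
    by (intro tendsto_diff tendsto_const)
  moreover have "infsum ?f {x<..} = Z - (\<Sum>n\<le>x. ?f n)" for x
  proof -
    have "Z = infsum ?f ({x<..} \<union> {0<..x})"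
      unfolding Z_def by (rule arg_cong[of _ _ "infsum ?f"]) auto
    also have "\<dots> = infsum ?f {x<..} + infsum ?f {0<..x}"
      by (intro infsum_Un_disjoint summable_on_subset_banach[OF summable_on_powr[OF s]]) auto
    also have "infsum ?f {0<..x} = (\<Sum>n\<in>{0<..x}. ?f n)" by simp
    also have "\<dots> = (\<Sum>n\<le>x. ?f n)"
      by (rule sum.mono_neutral_left) auto
    finally show ?thesis by simp
  qed
  ultimately show ?thesis by simp
qed

text \<open>Rough numbers other than 1 exceed \<open>x\<close>, so the error is at most a tail of
  the zeta series. The product stays on the side of the series, which avoids infinite products of
  inverses.\<close>

lemma euler_product:
  "(\<lambda>x. (\<Prod>p | Factorial_Ring.prime p \<and> p \<le> x. 1 - t p) * dirichlet_series \<psi> s) \<longlonglongrightarrow> 1"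
  unfolding euler_product_step
proof (rule Lim_null[THEN iffD2], rule Lim_null_comparison[OF _ tail_tendsto_0])
  have "norm (infsum t (rough x) - 1) \<le> infsum (\<lambda>n. real n powr - s) {x<..}" for x
  proof -
    have "1 \<in> rough x" by (auto simp: rough_def)
    hence "rough x = {1} \<union> (rough x - {1})" by blast
    hence "infsum t (rough x) = infsum t ({1} \<union> (rough x - {1}))" by simp
    also have "\<dots> = infsum t {1} + infsum t (rough x - {1})"
      using rough_subset by (intro infsum_Un_disjoint summable_t) auto
    finally have "infsum t (rough x) - 1 = infsum t (rough x - {1})"
      by (simp add: dirichlet_character_one[OF \<psi>])
    hence "norm (infsum t (rough x) - 1) = norm (infsum t (rough x - {1}))" by (rule arg_cong)
    also have "\<dots> \<le> infsum (\<lambda>n. norm (t n)) (rough x - {1})"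
      using rough_subset by (intro norm_infsum_bound summable_norm_t) auto
    also have "\<dots> \<le> infsum (\<lambda>n. real n powr - s) {x<..}"
    proof (rule infsum_mono_neutral)
      show "(\<lambda>n. norm (t n)) summable_on rough x - {1}"
        using rough_subset by (intro summable_norm_t) auto
      show "(\<lambda>n. real n powr - s) summable_on {x<..}"
        by (rule summable_on_subset_banach[OF summable_on_powr[OF s]]) auto
      show "norm (t n) \<le> real n powr - s" for n
        using norm_dirichlet_character_le[OF \<psi> N, of n] by (simp add: norm_mult mult_left_le_one_le)
      have "x < n" if "n \<in> rough x - {1}" for n
      proof -
        have "n \<noteq> 1" "n > 0" using that by (auto simp: rough_def)
        then obtain q where q: "Factorial_Ring.prime q" "q dvd n" using prime_factor_nat by blast
        have "x < q" using that q by (auto simp: rough_def)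
        also have "q \<le> n" using q(2) \<open>n > 0\<close> by (rule dvd_imp_le)
        finally show ?thesis .
      qed
      thus "norm (t n) \<le> 0" if "n \<in> rough x - {1} - {x<..}" for n
        using that by force
    qed auto
    finally show ?thesis .
  qed
  thus "\<forall>\<^sub>F x in sequentially. norm (infsum t (rough x) - 1) \<le> infsum (\<lambda>n. real n powr - s) {x<..}"
    by simp
qed

end

text \<open>By \<open>three_four_one\<close> at each prime, the combination of the finite products
  \<open>Q\<close> is at most 1. Each \<open>Q\<close> times its series tends to 1, so the
  combination of the series is at least 1.\<close>

lemma three_four_one_dirichlet_series:
  assumes \<psi>: "\<psi> \<in> dirichlet_characters N" and N: "N > 0" and s: "s > 1"
  shows "1 \<le> norm (dirichlet_series (principal_character N) s) ^ 3 * norm (dirichlet_series \<psi> s) ^ 4 *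
              norm (dirichlet_series (\<lambda>n. \<psi> n * \<psi> n) s)"
proof -
  let ?L0 = "dirichlet_series (principal_character N) s" and ?L1 = "dirichlet_series \<psi> s"
    and ?L2 = "dirichlet_series (\<lambda>n. \<psi> n * \<psi> n) s"
  define f where "f \<rho> p = 1 - \<rho> p * of_real (real p powr - s)" for \<rho> :: "nat \<Rightarrow> complex" and p
  define Q where "Q \<rho> x = (\<Prod>p | Factorial_Ring.prime p \<and> p \<le> x. f \<rho> p)" for \<rho> and x :: nat
  let ?p0 = "principal_character N" and ?p2 = "\<lambda>n. \<psi> n * \<psi> n"
  have lim: "(\<lambda>x. Q \<rho> x * dirichlet_series \<rho> s) \<longlonglongrightarrow> 1" if "\<rho> \<in> dirichlet_characters N" for \<rho>
    using euler_product[OF that N s] by (simp add: Q_def f_def)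
  have local_le: "norm (f ?p0 p) ^ 3 * norm (f \<psi> p) ^ 4 * norm (f ?p2 p) \<le> 1"
    if p: "Factorial_Ring.prime p" for p
  proof (cases "coprime p N")
    case True
    have "real p powr - s < 1"
      using s prime_gt_1_nat[OF p] by (simp add: powr_less_one)
    moreover have "norm (\<psi> p) = 1" using norm_dirichlet_character[OF \<psi> N, of p] True by simp
    ultimately have "norm (1 - of_real (real p powr - s) :: complex) ^ 3 * norm (1 - of_real (real p powr - s) * \<psi> p) ^ 4
        * norm (1 - of_real (real p powr - s) * (\<psi> p)\<^sup>2) \<le> 1"
      by (intro three_four_one) auto
    thus ?thesis using True
      by (simp add: f_def principal_character_def power2_eq_square mult_ac)
  next
    \<comment> \<open>For \<open>p\<close> dividing \<open>N\<close> all three Euler factors are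
      1.\<close>
    case False
    thus ?thesis using dirichlet_characterD(2)[OF \<psi>, of p] by (simp add: f_def principal_character_def)
  qed
  have Q_le: "norm (Q ?p0 x) ^ 3 * norm (Q \<psi> x) ^ 4 * norm (Q ?p2 x) \<le> 1" for x
    unfolding Q_def prod_norm[symmetric] prod_power_distrib prod.distrib[symmetric]
    by (rule prod_le_1) (auto intro: local_le)
  have "(\<lambda>x. norm (Q ?p0 x * ?L0) ^ 3 * norm (Q \<psi> x * ?L1) ^ 4 * norm (Q ?p2 x * ?L2))
      \<longlonglongrightarrow> norm (1::complex) ^ 3 * norm (1::complex) ^ 4 * norm (1::complex)"
    by (intro tendsto_mult tendsto_power tendsto_norm lim principal_character \<psi> dirichlet_characters_mult)
  moreover have "norm (Q ?p0 x * ?L0) ^ 3 * norm (Q \<psi> x * ?L1) ^ 4 * norm (Q ?p2 x * ?L2)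
      \<le> norm ?L0 ^ 3 * norm ?L1 ^ 4 * norm ?L2" for x
  proof -
    have "norm (Q ?p0 x * ?L0) ^ 3 * norm (Q \<psi> x * ?L1) ^ 4 * norm (Q ?p2 x * ?L2) =
        (norm (Q ?p0 x) ^ 3 * norm (Q \<psi> x) ^ 4 * norm (Q ?p2 x)) * (norm ?L0 ^ 3 * norm ?L1 ^ 4 * norm ?L2)"
      by (simp add: norm_mult power_mult_distrib mult_ac)
    also have "\<dots> \<le> 1 * (norm ?L0 ^ 3 * norm ?L1 ^ 4 * norm ?L2)"
      by (intro mult_right_mono Q_le) auto
    finally show ?thesis by simp
  qed
  ultimately have "norm (1::complex) ^ 3 * norm (1::complex) ^ 4 * norm (1::complex) \<le>
      norm ?L0 ^ 3 * norm ?L1 ^ 4 * norm ?L2"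
    by (intro LIMSEQ_le_const2) auto
  thus ?thesis by simp
qed

section \<open>Abel summation and the behaviour of nonprincipal series near 1\<close>

lemma abel_summation_bound:
  fixes f :: "nat \<Rightarrow> complex" and b :: "nat \<Rightarrow> real"
  assumes f: "\<And>M. norm (\<Sum>n<M. f n) \<le> K"
    and b: "\<And>n. n \<ge> m \<Longrightarrow> b (Suc n) \<le> b n" "\<And>n. n \<ge> m \<Longrightarrow> b n \<ge> 0"
  shows "norm (\<Sum>n\<in>{m..<M}. f n * of_real (b n)) \<le> 2 * K * b m"
proof (cases "m \<le> M")
  case False
  have "K \<ge> 0" using f[of 0] by simp
  thus ?thesis using False b(2)[of m] by simp
next
  case True
  \<comment> \<open>A sum started at \<open>m\<close> is a difference of two initial sums, each
    bounded by \<open>K\<close>; hence the factor 2.\<close>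
  define S where "S n = (\<Sum>i\<in>{m..<n}. f i)" for n
  have S: "norm (S n) \<le> 2 * K" if "m \<le> n" for n
  proof -
    have "S n = (\<Sum>i<n. f i) - (\<Sum>i<m. f i)"
      using that unfolding S_def by (simp add: sum_diff_nat_ivl lessThan_atLeast0)
    also have "norm \<dots> \<le> norm (\<Sum>i<n. f i) + norm (\<Sum>i<m. f i)" by (rule norm_triangle_ineq4)
    also have "\<dots> \<le> K + K" by (intro add_mono f)
    finally show ?thesis by simp
  qed
  define A where "A = (\<Sum>n\<in>{m..<M}. S (Suc n) * of_real (b n - b (Suc n)))"
  have S_Suc: "S (Suc n) = S n + f n" if "m \<le> n" for n
    using that by (simp add: S_def)
  have eq: "(\<Sum>n\<in>{m..<M}. f n * of_real (b n)) = S M * of_real (b M) + A"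
    unfolding A_def using True
  proof (induction M rule: dec_induct)
    case base
    show ?case by (simp add: S_def)
  next
    case (step n)
    thus ?case by (simp add: S_Suc algebra_simps)
  qed
  have "norm (S M * of_real (b M)) \<le> 2 * K * b M"
    using S[OF True] b(2)[OF True] by (simp add: norm_mult mult_right_mono)
  moreover have "norm A \<le> 2 * K * (b m - b M)"
    unfolding A_def using True
  proof (induction M rule: dec_induct)
    case base
    show ?case by simp
  next
    case (step n)
    have "norm (S (Suc n) * of_real (b n - b (Suc n))) \<le> 2 * K * (b n - b (Suc n))"
      using S[of "Suc n"] b(1)[of n] step(1) unfolding norm_mult norm_of_real
      by (simp add: mult_right_mono)
    moreover have "norm (\<Sum>n\<in>{m..<Suc n}. S (Suc n) * of_real (b n - b (Suc n))) \<le>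
        norm (\<Sum>n\<in>{m..<n}. S (Suc n) * of_real (b n - b (Suc n))) + norm (S (Suc n) * of_real (b n - b (Suc n)))"
      using step(1) by (simp only: sum.op_ivl_Suc) (simp add: norm_triangle_ineq del: of_real_diff)
    ultimately have "norm (\<Sum>n\<in>{m..<Suc n}. S (Suc n) * of_real (b n - b (Suc n))) \<le>
        2 * K * (b m - b n) + 2 * K * (b n - b (Suc n))"
      using step.IH by linarith
    thus ?case by (simp add: right_diff_distrib)
  qed
  ultimately have "norm (\<Sum>n\<in>{m..<M}. f n * of_real (b n)) \<le> 2 * K * b M + 2 * K * (b m - b M)"
    unfolding eq by (rule norm_triangle_mono)
  thus ?thesis by (simp add: right_diff_distrib)
qed

text \<open>Since 3 exceeds e, \<open>ln x / x\<close> decreases from there on; the other factor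
  \<open>x powr (1 - s)\<close> does not increase.\<close>

lemma ln_mult_powr_antimono:
  fixes x y s :: real
  assumes "3 \<le> x" "x \<le> y" "s \<ge> 1"
  shows "ln y * y powr - s \<le> ln x * x powr - s"
proof -
  have eq: "ln z * z powr - s = ln z / z * z powr (1 - s)" if "z > 0" for z
    using that by (simp add: powr_diff powr_minus_divide)
  have "exp 1 \<le> (3::real)" by (rule exp_le)
  hence "ln y / y \<le> ln x / x" using assms by (intro ln_x_over_x_mono) auto
  moreover have "y powr (1 - s) \<le> x powr (1 - s)"
    using assms by (intro powr_mono2') auto
  ultimately show ?thesis
    using assms by (simp only: eq) (intro mult_mono; simp add: eq)
qed

context
  fixes N :: nat and \<psi> :: "nat \<Rightarrow> complex"
  assumes \<psi>: "\<psi> \<in> dirichlet_characters N" "\<psi> \<noteq> principal_character N" and N: "N > 0"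
begin

text \<open>Uniformity in \<open>M\<close> and \<open>s\<close> is the point. Terms 0 and 1 vanish,
  term 2 is at most 1, and from 3 on, where the weights decrease, Abel summation gives
  \<open>2 * N\<close>.\<close>

lemma norm_partial_ln_sum_le:
  assumes "s \<ge> 1"
  shows "norm (\<Sum>n<M. \<psi> n * of_real (ln (real n) * real n powr - s)) \<le> 1 + 2 * real N"
proof -
  define b where "b n = ln (real n) * real n powr - s" for n
  let ?f = "\<lambda>n. \<psi> n * of_real (b n)"
  have tail: "norm (\<Sum>n\<in>{3..<M}. ?f n) \<le> 2 * real N * b 3"
  proof (rule abel_summation_bound)
    show "norm (\<Sum>n<M. \<psi> n) \<le> real N" for M
      by (rule norm_sum_dirichlet_character_le[OF \<psi> N])
    show "b (Suc n) \<le> b n" if "n \<ge> 3" for n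
      unfolding b_def using that assms by (intro ln_mult_powr_antimono) auto
    show "b n \<ge> 0" if "n \<ge> 3" for n
      unfolding b_def using that by simp
  qed
  have b_le: "b n \<le> 1" "b n \<ge> 0" if "n > 0" for n
  proof -
    have "b n \<le> real n * real n powr - 1"
      unfolding b_def using that assms ln_le_minus_one[of "real n"]
      by (intro mult_mono powr_mono) auto
    thus "b n \<le> 1" using that by (simp add: powr_minus_divide)
    show "b n \<ge> 0" using that by (simp add: b_def)
  qed
  have "2 * real N * b 3 \<le> 2 * real N * 1"
    using b_le[of 3] by (intro mult_left_mono) auto
  with tail have tail': "norm (\<Sum>n\<in>{3..<M}. ?f n) \<le> 2 * real N" by simp
  have b01: "b 0 = 0" "b (Suc 0) = 0" by (simp_all add: b_def)
  show ?thesis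
  proof (cases "M \<ge> 3")
    case True
    hence "(\<Sum>n<M. ?f n) = (\<Sum>n\<in>{0..<3}. ?f n) + (\<Sum>n\<in>{3..<M}. ?f n)"
      unfolding lessThan_atLeast0 by (intro sum.atLeastLessThan_concat[symmetric]) auto
    also have "(\<Sum>n\<in>{0..<3}. ?f n) = ?f 2"
      by (simp add: numeral_3_eq_3 numeral_2_eq_2 b01)
    finally have "norm (\<Sum>n<M. ?f n) \<le> norm (?f 2) + norm (\<Sum>n\<in>{3..<M}. ?f n)"
      by (simp only: norm_triangle_ineq)
    moreover have "norm (?f 2) \<le> 1 * 1"
      unfolding norm_mult using norm_dirichlet_character_le[OF \<psi>(1) N] b_le[of 2]
      by (intro mult_mono) auto
    ultimately show ?thesis using tail' unfolding b_def by linarith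
  next
    case False
    hence "M = 0 \<or> M = 1 \<or> M = 2" by auto
    hence "(\<Sum>n<M. ?f n) = 0"
      by (elim disjE) (simp_all add: numeral_2_eq_2 b01)
    thus ?thesis unfolding b_def by simp
  qed
qed

text \<open>Mean value inequality in \<open>s\<close>: the derivative is minus the sum in
  \<open>norm_partial_ln_sum_le\<close>, bounded uniformly in \<open>M\<close>. In the limit this is
  a Lipschitz bound for the series at 1.\<close>

lemma norm_partial_sum_diff_le:
  assumes "s \<ge> 1"
  shows "norm ((\<Sum>n<M. \<psi> n * of_real (real n powr - s)) - (\<Sum>n<M. \<psi> n * of_real (real n powr - 1)))
           \<le> (1 + 2 * real N) * (s - 1)"
proof -
  define f where "f s = (\<Sum>n<M. \<psi> n * of_real (real n powr - s))" for s
  define g where "g s = - (\<Sum>n<M. \<psi> n * of_real (ln (real n) * real n powr - s))" for s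
  have deriv: "(f has_vector_derivative g x) (at x within {1..})" for x
  proof -
    have "((\<lambda>s. \<psi> n * of_real (real n powr - s)) has_vector_derivative
        - (\<psi> n * of_real (ln (real n) * real n powr - x))) (at x within {1..})" for n
    proof (cases "n = 0")
      case False
      have "((\<lambda>s. real n powr - s) has_real_derivative - (ln (real n) * real n powr - x)) (at x within {1..})"
      proof -
        have "((\<lambda>s. exp (- s * ln (real n))) has_real_derivative exp (- x * ln (real n)) * (- ln (real n)))
            (at x within {1..})"
          by (auto intro!: derivative_eq_intros)
        thus ?thesis using False by (simp add: powr_def mult.commute)
      qed
      hence "((\<lambda>s. complex_of_real (real n powr - s)) has_vector_derivative of_real (- (ln (real n) * real n powr - x))) (at x within {1..})"
        by (intro has_vector_derivative_of_real) (simp add: has_real_derivative_iff_has_vector_derivative)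
      hence "((\<lambda>s. \<psi> n * complex_of_real (real n powr - s)) has_vector_derivative \<psi> n * of_real (- (ln (real n) * real n powr - x))) (at x within {1..})"
        by (rule has_vector_derivative_mult_right)
      thus ?thesis by simp
    qed simp
    hence "(f has_vector_derivative (\<Sum>n<M. - (\<psi> n * of_real (ln (real n) * real n powr - x)))) (at x within {1..})"
      unfolding f_def by (intro has_vector_derivative_sum)
    thus ?thesis by (simp add: g_def sum_negf)
  qed
  have "norm (f s - f 1) \<le> (1 + 2 * real N) * norm (s - 1)"
  proof (rule differentiable_bound[where S = "{1..}" and f' = "\<lambda>x h. h *\<^sub>R g x"])
    show "(f has_derivative (\<lambda>h. h *\<^sub>R g x)) (at x within {1..})" if "x \<in> {1..}" for x
      using deriv[of x] by (simp add: has_vector_derivative_def)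
    show "onorm (\<lambda>h. h *\<^sub>R g x) \<le> 1 + 2 * real N" if "x \<in> {1..}" for x
    proof (rule onorm_le)
      fix h :: real
      have "norm (g x) \<le> 1 + 2 * real N"
        unfolding g_def norm_minus_cancel using that by (intro norm_partial_ln_sum_le) simp
      thus "norm (h *\<^sub>R g x) \<le> (1 + 2 * real N) * norm h"
        unfolding norm_scaleR real_norm_def mult.commute[of _ "\<bar>h\<bar>"] by (intro mult_left_mono) auto
    qed
  qed (use assms in auto)
  thus ?thesis using assms by (simp add: f_def)
qed

lemma convergent_L_one: "convergent (\<lambda>M. \<Sum>n<M. \<psi> n * of_real (real n powr - 1))"
proof (rule Cauchy_convergent, rule CauchyI')
  fix e :: real assume "e > 0"
  obtain m0 where m0: "2 * real N / e < real m0" using reals_Archimedean2 by blast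
  define m1 where "m1 = Suc m0"
  have "norm ((\<Sum>n<m. \<psi> n * of_real (real n powr - 1)) - (\<Sum>n<M. \<psi> n * of_real (real n powr - 1))) < e"
    if m: "m1 \<le> m" "m < M" for m M
  proof -
    have "m > 0" "real m0 \<le> real m" using m by (auto simp: m1_def)
    have "norm (\<Sum>n\<in>{m..<M}. \<psi> n * of_real (real n powr - 1)) \<le> 2 * real N * real m powr - 1"
    proof (rule abel_summation_bound)
      show "norm (\<Sum>n<M. \<psi> n) \<le> real N" for M
        by (rule norm_sum_dirichlet_character_le[OF \<psi> N])
      show "real (Suc n) powr - 1 \<le> real n powr - 1" if "n \<ge> m" for n
        using that \<open>m > 0\<close> by (intro powr_mono2') auto
    qed simp
    also have "\<dots> = 2 * real N / real m" using \<open>m > 0\<close> by (simp add: powr_minus_divide)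
    also have "\<dots> < e"
    proof -
      have "2 * real N / e < real m" using m0 \<open>real m0 \<le> real m\<close> by linarith
      thus ?thesis using \<open>e > 0\<close> \<open>m > 0\<close> by (simp add: field_simps)
    qed
    finally have "norm (\<Sum>n\<in>{m..<M}. \<psi> n * of_real (real n powr - 1)) < e" .
    moreover have "(\<Sum>n<M. \<psi> n * of_real (real n powr - 1)) - (\<Sum>n<m. \<psi> n * of_real (real n powr - 1)) =
        (\<Sum>n\<in>{m..<M}. \<psi> n * of_real (real n powr - 1))"
      using m by (simp add: sum_diff_nat_ivl lessThan_atLeast0)
    ultimately show ?thesis by (metis norm_minus_commute)
  qed
  thus "\<exists>M. \<forall>m\<ge>M. \<forall>n>m. dist (\<Sum>n<m. \<psi> n * of_real (real n powr - 1)) (\<Sum>n<n. \<psi> n * of_real (real n powr - 1)) < e"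
    unfolding dist_norm by blast
qed

end

text \<open>At \<open>s = 1\<close> the series converges only conditionally, so its value is the limit of the ordered
  partial sums and not an instance of \<^const>\<open>dirichlet_series\<close>, which is an unordered sum.\<close>

definition L_one :: "(nat \<Rightarrow> complex) \<Rightarrow> complex" where
  "L_one \<psi> = lim (\<lambda>M. \<Sum>n<M. \<psi> n * of_real (real n powr - 1))"

lemma dirichlet_series_partial_sums:
  assumes "s > 1" "\<And>n. n > 0 \<Longrightarrow> norm (a n) \<le> 1 + ln (real n)"
  shows "(\<lambda>M. \<Sum>n<M. a n * of_real (real n powr - s)) \<longlonglongrightarrow> dirichlet_series a s"
proof -
  let ?f = "\<lambda>n. a n * of_real (real n powr - s)"
  have "(?f has_sum dirichlet_series a s) {0<..}"
    unfolding dirichlet_series_def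
    by (rule has_sum_infsum[OF abs_summable_summable[OF dirichlet_series_abs_summable[OF assms]]])
  hence "(?f has_sum dirichlet_series a s) UNIV"
    by (rule has_sum_cong_neutral[THEN iffD1, rotated -1]) auto
  hence "?f sums dirichlet_series a s" by (rule has_sum_imp_sums)
  thus ?thesis by (simp add: sums_def)
qed

context
  fixes N :: nat and \<psi> :: "nat \<Rightarrow> complex" and s :: real
  assumes \<psi>: "\<psi> \<in> dirichlet_characters N" "\<psi> \<noteq> principal_character N" and N: "N > 0" and s: "s > 1"
begin

lemma norm_L_diff_L_one_le: "norm (dirichlet_series \<psi> s - L_one \<psi>) \<le> (1 + 2 * real N) * (s - 1)"
proof -
  have "(\<lambda>M. \<Sum>n<M. \<psi> n * of_real (real n powr - s)) \<longlonglongrightarrow> dirichlet_series \<psi> s"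
    by (rule dirichlet_series_partial_sums[OF s norm_dirichlet_character_le_ln[OF \<psi>(1) N]])
  moreover have "(\<lambda>M. \<Sum>n<M. \<psi> n * of_real (real n powr - 1)) \<longlonglongrightarrow> L_one \<psi>"
    unfolding L_one_def using convergent_L_one[OF \<psi> N] by (simp only: convergent_LIMSEQ_iff)
  ultimately have "(\<lambda>M. norm ((\<Sum>n<M. \<psi> n * of_real (real n powr - s)) - (\<Sum>n<M. \<psi> n * of_real (real n powr - 1))))
      \<longlonglongrightarrow> norm (dirichlet_series \<psi> s - L_one \<psi>)"
    by (intro tendsto_norm tendsto_diff)
  thus ?thesis
    by (rule LIMSEQ_le_const2) (use norm_partial_sum_diff_le[OF \<psi> N] s in auto)
qed

lemma norm_dirichlet_series_ln_le: "norm (dirichlet_series (\<lambda>n. \<psi> n * of_real (ln (real n))) s) \<le> 1 + 2 * real N"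
proof -
  have "norm (\<psi> n * of_real (ln (real n))) \<le> 1 + ln (real n)" if "n > 0" for n
  proof -
    have "norm (\<psi> n) * ln (real n) \<le> 1 * ln (real n)"
      using norm_dirichlet_character_le[OF \<psi>(1) N, of n] that by (intro mult_right_mono) auto
    thus ?thesis using that by (simp add: norm_mult)
  qed
  hence "(\<lambda>M. \<Sum>n<M. \<psi> n * of_real (ln (real n)) * of_real (real n powr - s)) \<longlonglongrightarrow>
      dirichlet_series (\<lambda>n. \<psi> n * of_real (ln (real n))) s"
    by (rule dirichlet_series_partial_sums[OF s])
  hence "(\<lambda>M. norm (\<Sum>n<M. \<psi> n * of_real (ln (real n)) * of_real (real n powr - s))) \<longlonglongrightarrow>
      norm (dirichlet_series (\<lambda>n. \<psi> n * of_real (ln (real n))) s)"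
    by (rule tendsto_norm)
  thus ?thesis
    by (rule LIMSEQ_le_const2)
      (use norm_partial_ln_sum_le[OF \<psi> N] s in \<open>auto simp: mult.assoc\<close>)
qed

end

section \<open>Nonvanishing at one\<close>

text \<open>Comparison with the integral, whose value together with the first term is
  \<open>1 + 1 / (s - 1)\<close>; the mean value theorem handles each unit interval.\<close>

lemma zeta_partial_sum_le:
  assumes "s > 1"
  shows "(\<Sum>n<M. real n powr - s) \<le> s / (s - 1)"
proof -
  have "(\<Sum>n\<in>{1..M}. real n powr - s) \<le> s / (s - 1) - real M powr (1 - s) / (s - 1)" if "M \<ge> 1" for M
    using that
  proof (induction M rule: nat_induct_at_least)
    case base
    have "s / (s - 1) - 1 / (s - 1) = 1" using assms by (simp flip: diff_divide_distrib)
    thus ?case by simp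
  next
    case (Suc M)
    have "\<exists>z. real M < z \<and> z < real (Suc M) \<and> real (Suc M) powr (1 - s) - real M powr (1 - s) =
        (real (Suc M) - real M) * ((1 - s) * z powr (1 - s - 1))"
      using Suc.hyps by (intro MVT2) (auto intro!: derivative_eq_intros)
    then obtain z where z: "real M < z" "z < real (Suc M)"
        "real (Suc M) powr (1 - s) - real M powr (1 - s) = (1 - s) * z powr - s"
      by auto
    have "(s - 1) * real (Suc M) powr - s \<le> (s - 1) * z powr - s"
      using z Suc.hyps assms by (intro mult_left_mono powr_mono2') auto
    also have "\<dots> = real M powr (1 - s) - real (Suc M) powr (1 - s)"
      using z(3) by (simp add: algebra_simps)
    finally have "real (Suc M) powr - s \<le> (real M powr (1 - s) - real (Suc M) powr (1 - s)) / (s - 1)"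
      using assms by (simp add: pos_le_divide_eq mult.commute)
    thus ?case using Suc.IH by (simp add: diff_divide_distrib)
  qed
  note bound = this
  have "(\<Sum>n<M. real n powr - s) \<le> (\<Sum>n\<le>M + 1. real n powr - s)"
    by (rule sum_mono2) auto
  also have "\<dots> = (\<Sum>n\<in>{1..M + 1}. real n powr - s)"
    by (rule sum.mono_neutral_right) (auto simp: Suc_le_eq)
  also have "\<dots> \<le> s / (s - 1) - real (M + 1) powr (1 - s) / (s - 1)" by (rule bound) simp
  also have "\<dots> \<le> s / (s - 1)" using assms by simp
  finally show ?thesis .
qed

lemma norm_dirichlet_series_le:
  assumes \<psi>: "\<psi> \<in> dirichlet_characters N" and N: "N > 0" and s: "s > 1"
  shows "norm (dirichlet_series \<psi> s) \<le> s / (s - 1)"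
proof -
  have "(\<lambda>M. norm (\<Sum>n<M. \<psi> n * of_real (real n powr - s))) \<longlonglongrightarrow> norm (dirichlet_series \<psi> s)"
    by (intro tendsto_norm dirichlet_series_partial_sums[OF s norm_dirichlet_character_le_ln[OF \<psi> N]])
  moreover have "norm (\<Sum>n<M. \<psi> n * of_real (real n powr - s)) \<le> s / (s - 1)" for M
  proof -
    have "norm (\<Sum>n<M. \<psi> n * of_real (real n powr - s)) \<le> (\<Sum>n<M. real n powr - s)"
      using norm_dirichlet_character_le[OF \<psi> N]
      by (intro sum_norm_le) (simp add: norm_mult mult_left_le_one_le)
    also have "\<dots> \<le> s / (s - 1)" by (rule zeta_partial_sum_le[OF s])
    finally show ?thesis .
  qed
  ultimately show ?thesis by (intro LIMSEQ_le_const2) auto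
qed

text \<open>A zero at 1 makes L(s, \<psi>) of size \<open>s - 1\<close>. Its fourth power beats the
  cube of the bound \<open>s / (s - 1)\<close> for the principal series, while the series of the
  nonprincipal square stays bounded.\<close>

lemma L_one_nonzero_complex:
  assumes \<psi>: "\<psi> \<in> dirichlet_characters N" "\<psi> \<noteq> principal_character N" and N: "N > 0"
    and sq: "(\<lambda>n. \<psi> n * \<psi> n) \<noteq> principal_character N"
  shows "L_one \<psi> \<noteq> 0"
proof
  assume zero: "L_one \<psi> = 0"
  let ?p2 = "\<lambda>n. \<psi> n * \<psi> n"
  note p2 = dirichlet_characters_mult[OF \<psi>(1) \<psi>(1)]
  define C where "C = 1 + 2 * real N"
  define K where "K = norm (L_one ?p2) + C"
  have "C \<ge> 1" by (simp add: C_def)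
  hence "K \<ge> 1" unfolding K_def by (simp add: add_increasing)
  \<comment> \<open>Chosen so that the upper bound
    \<open>(2 / e) ^ 3 * (C * e) ^ 4 * K = 8 * C ^ 4 * K * e\<close> equals 1/2.\<close>
  define e where "e = 1 / (16 * C ^ 4 * K)"
  have "C ^ 4 \<ge> 1" using \<open>C \<ge> 1\<close> by (rule one_le_power)
  hence CK: "C ^ 4 * K \<ge> 1" using \<open>K \<ge> 1\<close> by (metis mult_mono' mult_1 zero_le_one)
  have e: "0 < e" "e \<le> 1" using CK by (auto simp: e_def field_simps)
  define s where "s = 1 + e"
  have s: "s > 1" "s - 1 = e" using e by (auto simp: s_def)
  have "norm (dirichlet_series (principal_character N) s) \<le> s / (s - 1)"
    by (rule norm_dirichlet_series_le[OF principal_character N s(1)])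
  also have "\<dots> \<le> 2 / e" unfolding s(2) using e by (intro divide_right_mono) (auto simp: s_def)
  finally have L0: "norm (dirichlet_series (principal_character N) s) \<le> 2 / e" .
  have L1: "norm (dirichlet_series \<psi> s) \<le> C * e"
    using norm_L_diff_L_one_le[OF \<psi> N s(1)] zero s(2) by (simp add: C_def)
  have "norm (dirichlet_series ?p2 s) \<le> norm (L_one ?p2) + norm (dirichlet_series ?p2 s - L_one ?p2)"
    by (rule norm_triangle_sub)
  also have "\<dots> \<le> norm (L_one ?p2) + C * e"
    using norm_L_diff_L_one_le[OF p2 sq N s(1)] s(2) by (simp add: C_def)
  also have "\<dots> \<le> K" using mult_left_mono[of e 1 C] e \<open>C \<ge> 1\<close> by (simp add: K_def)
  finally have L2: "norm (dirichlet_series ?p2 s) \<le> K" .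
  have "1 \<le> norm (dirichlet_series (principal_character N) s) ^ 3 * norm (dirichlet_series \<psi> s) ^ 4 *
      norm (dirichlet_series ?p2 s)"
    by (rule three_four_one_dirichlet_series[OF \<psi>(1) N s(1)])
  also have "\<dots> \<le> (2 / e) ^ 3 * (C * e) ^ 4 * K"
    using L0 L1 L2 e \<open>C \<ge> 1\<close> \<open>K \<ge> 1\<close> by (intro mult_mono power_mono) auto
  also have "\<dots> = 8 * (C ^ 4 * K) * e"
    using e by (simp add: field_simps eval_nat_numeral)
  also have "\<dots> = 1 / 2"
    using \<open>C \<ge> 1\<close> \<open>K \<ge> 1\<close> unfolding e_def by (simp add: field_simps)
  finally show False by simp
qed

section \<open>Real characters: divisor sums and Lambert series\<close>

lemma complete_induct_prime_power [consumes 1, case_names one step]: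
  fixes P :: "nat \<Rightarrow> bool"
  assumes "n > 0" and "P 1"
    and step: "\<And>p k m. Factorial_Ring.prime p \<Longrightarrow> k > 0 \<Longrightarrow> m > 0 \<Longrightarrow> \<not> p dvd m \<Longrightarrow> P m \<Longrightarrow> P (p ^ k * m)"
  shows "P n"
  using assms(1)
proof (induction n rule: less_induct)
  case (less n)
  show ?case
  proof (cases "n = 1")
    case False
    then obtain p where p: "Factorial_Ring.prime p" "p dvd n" using prime_factor_nat by blast
    obtain k m where km: "\<not> p dvd m" "n = m * p ^ k"
      using prime_power_canonical[OF p(1) \<open>n > 0\<close>] by blast
    have "k > 0" using km p(2) by (cases k) auto
    moreover have "m > 0" using km(2) \<open>n > 0\<close> by (cases m) auto
    moreover have "m < n"
    proof -
      have "1 < p ^ k" using prime_gt_1_nat[OF p(1)] \<open>k > 0\<close> by (rule one_less_power)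
      thus ?thesis using \<open>m > 0\<close> unfolding km(2) by simp
    qed
    ultimately show ?thesis
      using step[OF p(1) _ _ km(1) less.IH] km(2) by (simp add: mult.commute)
  qed (use assms(2) in simp)
qed

text \<open>Since \<open>p\<close> does not divide \<open>m\<close>, each divisor of
  \<open>p ^ k * m\<close> is uniquely \<open>p ^ i * d\<close> with \<open>i \<le> k\<close> and
  \<open>d dvd m\<close>.\<close>

lemma sum_divisors_prime_power_mult:
  fixes c :: "nat \<Rightarrow> real"
  assumes p: "Factorial_Ring.prime p" "\<not> p dvd m" "m > 0"
    and c: "\<And>i d. c (p ^ i * d) = c p ^ i * c d"
  shows "(\<Sum>d | d dvd p ^ k * m. c d) = (\<Sum>i\<le>k. c p ^ i) * (\<Sum>d | d dvd m. c d)"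
proof -
  let ?f = "\<lambda>(i, d). p ^ i * d"
  have "inj_on ?f ({..k} \<times> {d. d dvd m})"
  proof (rule inj_onI, clarify)
    fix i d j e assume *: "p ^ i * d = p ^ j * e" "d dvd m" "e dvd m"
    have no: "\<not> p dvd d" "\<not> p dvd e" using * p(2) by (meson dvd_trans)+
    have le: "i \<le> j" if "p ^ i * d = p ^ j * e" "\<not> p dvd e" for i j d e
    proof (rule ccontr)
      assume "\<not> i \<le> j"
      then obtain r where "i = j + Suc r" by (metis add_Suc_right less_imp_Suc_add not_le)
      hence "p ^ j * (p * (p ^ r * d)) = p ^ j * e" using that(1) by (simp add: power_add mult_ac)
      hence "p * (p ^ r * d) = e" using p(1) by (auto dest: prime_gt_0_nat)
      with that(2) show False by auto
    qed
    have "i = j" using le[OF *(1) no(2)] le[OF *(1)[symmetric] no(1)] by simp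
    thus "i = j \<and> d = e" using * p(1) by (auto dest: prime_gt_0_nat)
  qed
  moreover have "{d. d dvd p ^ k * m} = ?f ` ({..k} \<times> {d. d dvd m})"
  proof (intro equalityI subsetI)
    fix d assume "d \<in> {d. d dvd p ^ k * m}"
    then obtain b e where "d = b * e" "b dvd p ^ k" "e dvd m"
      using division_decomp[of d "p ^ k" m] by blast
    moreover from this obtain i where "i \<le> k" "b = p ^ i"
      using divides_primepow_nat[OF p(1)] by blast
    ultimately show "d \<in> ?f ` ({..k} \<times> {d. d dvd m})"
      by (intro image_eqI[of _ _ "(i, e)"]) auto
  next
    fix d assume "d \<in> ?f ` ({..k} \<times> {d. d dvd m})"
    thus "d \<in> {d. d dvd p ^ k * m}" by (auto intro!: mult_dvd_mono le_imp_power_dvd)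
  qed
  ultimately have "(\<Sum>d | d dvd p ^ k * m. c d) = (\<Sum>(i, d)\<in>{..k} \<times> {d. d dvd m}. c (p ^ i * d))"
    by (simp add: sum.reindex o_def case_prod_unfold)
  also have "\<dots> = (\<Sum>i\<le>k. c p ^ i) * (\<Sum>d | d dvd m. c d)"
    by (simp add: c sum_product sum.cartesian_product)
  finally show ?thesis .
qed

text \<open>With \<open>S n = 1 + t + ... + t ^ (n - 1)\<close> the coefficient is
  \<open>(1 / n - t ^ n / S n) / (1 - t)\<close>. Monotonicity amounts to
  \<open>n * (n + 1) * t ^ n \<le> S n * S (n + 1)\<close>, which follows from the inequality of
  arithmetic and geometric means.\<close>

lemma lambert_coefficients_antimono:
  fixes t :: real
  assumes t: "0 < t" "t < 1"
  defines "b \<equiv> \<lambda>n. 1 / (real n * (1 - t)) - t ^ n / (1 - t ^ n)"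
  assumes n: "n \<ge> 1"
  shows "b (Suc n) \<le> b n" and "b n \<ge> 0"
proof -
  define S where "S n = (\<Sum>i<n. t ^ i)" for n
  have geo: "1 - t ^ n = (1 - t) * S n" for n
    unfolding S_def using t by (simp add: sum_gp_strict)
  have S_pos: "S n > 0" if "n \<ge> 1" for n
    unfolding S_def using that t by (intro sum_pos) (auto simp: lessThan_empty_iff)
  have S_ge: "real n * t ^ n \<le> S n" for n
  proof -
    have "(\<Sum>i<n. t ^ n) \<le> S n" unfolding S_def using t by (intro sum_mono power_decreasing) auto
    thus ?thesis by simp
  qed
  have b_eq: "b n = (1 / real n - t ^ n / S n) / (1 - t)" for n
    unfolding b_def geo using t by (simp add: divide_simps)
  show "b n \<ge> 0"
    unfolding b_eq using S_ge[of n] S_pos[OF n] n t by (intro divide_nonneg_nonneg) (auto simp: field_simps)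
  \<comment> \<open>The geometric mean of \<open>t ^ i\<close> and \<open>t ^ (n - 1 - i)\<close> is
    \<open>r ^ (n - 1)\<close> for every \<open>i\<close>, so pairing the summands bounds
    \<open>S n\<close> from below.\<close>
  define r where "r = sqrt t"
  have r: "0 < r" "r < 1" "t = r\<^sup>2" using t by (auto simp: r_def)
  have amgm: "real n * r ^ (n - 1) \<le> S n" if "n \<ge> 1" for n
  proof -
    have "(\<Sum>i<n. t ^ (n - Suc i)) = S n"
      unfolding S_def by (rule sum.nat_diff_reindex)
    hence "2 * S n = (\<Sum>i<n. t ^ i + t ^ (n - Suc i))"
      by (simp add: sum.distrib S_def)
    also have "\<dots> \<ge> (\<Sum>i<n. 2 * r ^ (n - 1))"
    proof (rule sum_mono)
      fix i assume "i \<in> {..<n}"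
      hence "r ^ (n - 1) = r ^ i * r ^ (n - Suc i)" by (simp flip: power_add)
      moreover have "t ^ i = (r ^ i)\<^sup>2" "t ^ (n - Suc i) = (r ^ (n - Suc i))\<^sup>2"
        unfolding r(3) by (simp_all flip: power_mult add: mult.commute)
      ultimately show "2 * r ^ (n - 1) \<le> t ^ i + t ^ (n - Suc i)"
        using sum_squares_bound[of "r ^ i" "r ^ (n - Suc i)"] by simp
    qed
    finally show ?thesis by simp
  qed
  have "real n * real (Suc n) * t ^ n \<le> (real n * r ^ (n - 1)) * (real (Suc n) * r ^ n)"
  proof -
    have "t ^ n = r ^ (2 * n)" unfolding r(3) by (simp flip: power_mult)
    also have "\<dots> \<le> r ^ (n - 1 + n)" using r by (intro power_decreasing) auto
    finally have "real n * real (Suc n) * t ^ n \<le> real n * real (Suc n) * r ^ (n - 1 + n)"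
      by (intro mult_left_mono) auto
    thus ?thesis by (simp add: power_add mult_ac)
  qed
  also have "\<dots> \<le> S n * S (Suc n)"
    using amgm[of n] amgm[of "Suc n"] n r S_pos[of n] by (intro mult_mono) auto
  finally have le: "real n * real (Suc n) * t ^ n \<le> S n * S (Suc n)" .
  have key: "t ^ n / (S n * S (Suc n)) \<le> 1 / (real n * real (Suc n))"
  proof -
    define P where "P = S n * S (Suc n)"
    define Q where "Q = real n * real (Suc n)"
    have "P > 0" "Q > 0" using S_pos[of n] S_pos[of "Suc n"] n by (simp_all add: P_def Q_def)
    moreover have "Q * t ^ n \<le> P" using le by (simp add: P_def Q_def)
    ultimately show ?thesis unfolding P_def[symmetric] Q_def[symmetric] by (simp add: field_simps)
  qed
  \<comment> \<open>Because \<open>S (Suc n) - t * S n = 1\<close>, the difference is the quotient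
    bounded in \<open>key\<close>.\<close>
  have "t ^ n / S n - t ^ Suc n / S (Suc n) = t ^ n * (S (Suc n) - t * S n) / (S n * S (Suc n))"
    using S_pos[of n] S_pos[of "Suc n"] n by (simp add: field_simps)
  also have "S (Suc n) - t * S n = 1"
    using geo[of "Suc n"] geo[of n] t by (simp add: S_def) (simp add: algebra_simps)
  finally have "t ^ n / S n - t ^ Suc n / S (Suc n) \<le> 1 / real n - 1 / real (Suc n)"
    using key n by (simp add: field_simps)
  hence "(1 / real (Suc n) - t ^ Suc n / S (Suc n)) \<le> (1 / real n - t ^ n / S n)" by linarith
  thus "b (Suc n) \<le> b n"
    unfolding b_eq using t by (intro divide_right_mono) auto
qed

text \<open>Finite form of expanding a Lambert series into a power series: a pair of
  \<open>m\<close> and a divisor becomes the divisor and its cofactor. Truncation leaves geometric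
  sums of length \<open>M div n\<close>.\<close>

lemma sum_divisor_sums_lambert:
  fixes c :: "nat \<Rightarrow> real" and t :: real
  shows "(\<Sum>m\<in>{1..M}. (\<Sum>d | d dvd m. c d) * t ^ m) =
           (\<Sum>n\<in>{1..M}. c n * (\<Sum>k\<in>{1..M div n}. (t ^ n) ^ k))"
proof -
  have "(\<Sum>m\<in>{1..M}. (\<Sum>d | d dvd m. c d) * t ^ m) = (\<Sum>(m, d)\<in>Sigma {1..M} (\<lambda>m. {d. d dvd m}). c d * t ^ m)"
    by (subst sum.Sigma[symmetric]) (auto simp: sum_distrib_right)
  also have "\<dots> = (\<Sum>(n, k)\<in>Sigma {1..M} (\<lambda>n. {1..M div n}). c n * (t ^ n) ^ k)"
  proof (rule sum.reindex_bij_witness[of _ "\<lambda>(n, k). (n * k, n)" "\<lambda>(m, d). (d, m div d)"])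
    fix x assume "x \<in> Sigma {1..M} (\<lambda>m. {d. d dvd m})"
    then obtain d k where x: "x = (d * k, d)" "1 \<le> d * k" "d * k \<le> M" by (auto elim!: dvdE)
    have pos: "d > 0" "k > 0" using x(2) by (auto intro!: Nat.gr0I)
    show "(case case x of (m, d) \<Rightarrow> (d, m div d) of (n, k) \<Rightarrow> (n * k, n)) = x"
      using x pos by simp
    have "d \<le> M" using x(3) pos by (metis le_trans mult_le_mono2 nat_mult_1_right Suc_leI One_nat_def)
    moreover have "k \<le> M div d" using x(3) pos by (simp add: less_eq_div_iff_mult_less_eq mult.commute)
    ultimately show "(case x of (m, d) \<Rightarrow> (d, m div d)) \<in> Sigma {1..M} (\<lambda>n. {1..M div n})"
      using x(1) pos by (simp add: Suc_le_eq)
    show "(case case x of (m, d) \<Rightarrow> (d, m div d) of (n, k) \<Rightarrow> c n * (t ^ n) ^ k) = (case x of (m, d) \<Rightarrow> c d * t ^ m)"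
      using x(1) pos by (simp add: power_mult)
  next
    fix y assume "y \<in> Sigma {1..M} (\<lambda>n. {1..M div n})"
    then obtain n k where y: "y = (n, k)" "n > 0" "k > 0" "k \<le> M div n" by auto
    show "(case case y of (n, k) \<Rightarrow> (n * k, n) of (m, d) \<Rightarrow> (d, m div d)) = y"
      using y by simp
    have "n * k \<le> M" using y by (simp add: less_eq_div_iff_mult_less_eq mult.commute)
    thus "(case y of (n, k) \<Rightarrow> (n * k, n)) \<in> Sigma {1..M} (\<lambda>m. {d. d dvd m})"
      using y by (simp add: Suc_le_eq)
  qed
  also have "\<dots> = (\<Sum>n\<in>{1..M}. c n * (\<Sum>k\<in>{1..M div n}. (t ^ n) ^ k))"
    by (subst sum.Sigma[symmetric]) (auto simp: sum_distrib_left)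
  finally show ?thesis .
qed

text \<open>The divisor sums \<open>a\<close> are nonnegative and at least 1 at squares, so the
  Lambert series grows without bound as t tends to 1. If \<open>L_one \<psi>\<close> vanished,
  replacing its coefficients by the decreasing \<open>b\<close> would change only the sign, and Abel
  summation would bound it by \<open>2 * N\<close>.\<close>

lemma L_one_nonzero_real:
  assumes \<psi>: "\<psi> \<in> dirichlet_characters N" "\<psi> \<noteq> principal_character N" and N: "N > 0"
    and sq: "(\<lambda>n. \<psi> n * \<psi> n) = principal_character N"
  shows "L_one \<psi> \<noteq> 0"
proof
  assume zero: "L_one \<psi> = 0"
  define c where "c n = Re (\<psi> n)" for n
  have \<psi>_cases: "\<psi> n = 0 \<or> \<psi> n = 1 \<or> \<psi> n = -1" for n
  proof -
    have "\<psi> n * \<psi> n = 0 \<or> \<psi> n * \<psi> n = 1"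
      using fun_cong[OF sq, of n] by (simp add: principal_character_def split: if_splits)
    thus ?thesis using square_eq_1_iff[of "\<psi> n"] by auto
  qed
  have \<psi>_c: "\<psi> n = of_real (c n)" for n
    using \<psi>_cases[of n] by (auto simp: c_def)
  have c_cases: "c n = 0 \<or> c n = 1 \<or> c n = -1" for n
    using \<psi>_cases[of n] by (auto simp: c_def)
  have c_mult: "c (m * n) = c m * c n" for m n
    using dirichlet_characterD(1)[OF \<psi>(1), of m n] unfolding \<psi>_c by (simp flip: of_real_mult)
  have c_1: "c (Suc 0) = 1" using dirichlet_character_one[OF \<psi>(1)] by (simp add: c_def)
  have "c (p ^ i) = c p ^ i" for p i
    by (induction i) (simp_all add: c_mult c_1)
  hence c_pow: "c (p ^ i * d) = c p ^ i * c d" for p i d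
    by (simp add: c_mult)
  define a where "a m = (\<Sum>d | d dvd m. c d)" for m
  have a_prime_power: "a (p ^ k * m) = (\<Sum>i\<le>k. c p ^ i) * a m"
    if "Factorial_Ring.prime p" "\<not> p dvd m" "m > 0" for p k m
    unfolding a_def using that by (intro sum_divisors_prime_power_mult c_pow)
  \<comment> \<open>According to whether \<open>c p\<close> is 0, 1 or -1, the sum is 1,
    \<open>k + 1\<close>, or alternately 1 and 0.\<close>
  have geometric: "(\<Sum>i\<le>k. c p ^ i) \<ge> (if even k then 1 else 0)" for p k
  proof -
    have "(\<Sum>i\<le>k. (0::real) ^ i) = 1" by (induction k) auto
    moreover have "(\<Sum>i\<le>k. (-1::real) ^ i) = (if even k then 1 else 0)" by (induction k) auto
    ultimately show ?thesis using c_cases[of p] by auto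
  qed
  have a_1: "a 1 = 1" by (simp add: a_def c_1)
  have a_nonneg: "a m \<ge> 0" if "m > 0" for m
    using that
  proof (induction m rule: complete_induct_prime_power)
    case (step p k m)
    have "(\<Sum>i\<le>k. c p ^ i) \<ge> 0" using geometric[where p = p and k = k] by (auto split: if_splits)
    thus ?case using step by (simp add: a_prime_power)
  qed (use a_1 in simp)
  have a_square: "a (j ^ 2) \<ge> 1" if "j > 0" for j
    using that
  proof (induction j rule: complete_induct_prime_power)
    case (step p k m)
    have "\<not> p dvd m ^ 2" using step prime_dvd_power by blast
    hence "a (p ^ (2 * k) * m ^ 2) = (\<Sum>i\<le>2 * k. c p ^ i) * a (m ^ 2)"
      using step by (intro a_prime_power) auto
    moreover have "(\<Sum>i\<le>2 * k. c p ^ i) \<ge> 1" using geometric[where p = p and k = "2 * k"] by simp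
    moreover have "(p ^ k * m) ^ 2 = p ^ (2 * k) * m ^ 2"
      by (simp add: power_mult_distrib mult.commute flip: power_mult)
    ultimately show ?case using step.IH mult_mono[of 1 "\<Sum>i\<le>2 * k. c p ^ i" 1 "a (m ^ 2)"] by simp
  qed (use a_1 in simp)
  have bound: "(\<Sum>j\<in>{1..J}. t ^ (j ^ 2)) \<le> 2 * real N" if t: "0 < t" "t < 1" for t :: real and J
  proof -
    define b where "b n = 1 / (real n * (1 - t)) - t ^ n / (1 - t ^ n)" for n
    have b: "b (Suc n) \<le> b n" "b n \<ge> 0" if "n \<ge> 1" for n
      unfolding b_def using lambert_coefficients_antimono[OF t that] by auto
    have b_1: "b 1 = 1"
      using t by (simp add: b_def flip: diff_divide_distrib)
    define T where "T M = (\<Sum>n<Suc M. \<psi> n * of_real (real n powr - 1))" for M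
    have T_lim: "T \<longlonglongrightarrow> 0"
      using convergent_L_one[OF \<psi> N] zero unfolding T_def L_one_def
      by (intro LIMSEQ_Suc) (simp only: convergent_LIMSEQ_iff)
    \<comment> \<open>The first summand comes from a partial sum at 1, the last from cutting the
      geometric series at \<open>M\<close>; both vanish as \<open>M\<close> grows.\<close>
    have main: "(\<Sum>j\<in>{1..J}. t ^ (j ^ 2)) \<le> norm (T M) / (1 - t) + 2 * real N + real M * t ^ M / (1 - t)"
      if M: "M \<ge> J ^ 2" for M
    proof -
      have "(\<Sum>j\<in>{1..J}. t ^ (j ^ 2)) \<le> (\<Sum>j\<in>{1..J}. a (j ^ 2) * t ^ (j ^ 2))"
        using a_square t by (intro sum_mono) (simp add: mult_le_cancel_right1)
      also have "\<dots> = (\<Sum>m\<in>(\<lambda>j. j ^ 2) ` {1..J}. a m * t ^ m)"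
        by (subst sum.reindex) (auto simp: inj_on_def)
      also have "\<dots> \<le> (\<Sum>m\<in>{1..M}. a m * t ^ m)"
      proof (rule sum_mono2)
        show "(\<lambda>j. j ^ 2) ` {1..J} \<subseteq> {1..M}"
        proof
          fix x assume "x \<in> (\<lambda>j. j ^ 2) ` {1..J}"
          then obtain j where j: "x = j ^ 2" "1 \<le> j" "j \<le> J" by auto
          have "j ^ 2 \<le> M" by (rule le_trans[OF power_mono[OF j(3)] M]) simp
          thus "x \<in> {1..M}" using j M by simp
        qed
      qed (use a_nonneg t in auto)
      also have "\<dots> = (\<Sum>n\<in>{1..M}. c n * (\<Sum>k\<in>{1..M div n}. (t ^ n) ^ k))"
        unfolding a_def by (rule sum_divisor_sums_lambert)
      also have "\<dots> \<le> (\<Sum>n\<in>{1..M}. c n * (t ^ n / (1 - t ^ n)) + t ^ M / (1 - t))"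
      proof (rule sum_mono)
        fix n assume n: "n \<in> {1..M}"
        define x where "x = t ^ n"
        have x: "0 < x" "x < 1" "x \<le> t"
          using t n power_decreasing[of 1 n t] unfolding x_def by (auto simp: power_less_one_iff)
        have "(\<Sum>k\<in>{1..K}. x ^ k) = x / (1 - x) - x ^ Suc K / (1 - x)" for K
        proof -
          have "(\<Sum>k\<in>{1..K}. x ^ k) * (1 - x) = x - x ^ Suc K"
          proof (induction K)
            case (Suc K)
            have "(\<Sum>k\<in>{1..Suc K}. x ^ k) * (1 - x) = (\<Sum>k\<in>{1..K}. x ^ k) * (1 - x) + x ^ Suc K * (1 - x)"
              by (simp add: distrib_right)
            also have "\<dots> = x - x ^ Suc (Suc K)" unfolding Suc.IH by (simp add: algebra_simps)
            finally show ?case .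
          qed simp
          thus ?thesis using x(2) by (simp add: eq_divide_eq flip: diff_divide_distrib)
        qed
        moreover have "x ^ Suc (M div n) / (1 - x) \<le> t ^ M / (1 - t)"
        proof (rule frac_le)
          \<comment> \<open>The first omitted exponent already reaches \<open>M\<close>.\<close>
          have "M \<le> n * Suc (M div n)"
            using n dividend_less_times_div[of n M] by simp
          thus "x ^ Suc (M div n) \<le> t ^ M"
            unfolding x_def power_mult[symmetric] using t by (intro power_decreasing) auto
        qed (use x t in auto)
        ultimately have *: "\<bar>(\<Sum>k\<in>{1..M div n}. x ^ k) - x / (1 - x)\<bar> \<le> t ^ M / (1 - t)"
          using x by simp
        have "c n * ((\<Sum>k\<in>{1..M div n}. x ^ k) - x / (1 - x)) \<le> \<bar>(\<Sum>k\<in>{1..M div n}. x ^ k) - x / (1 - x)\<bar>"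
          using c_cases[of n] by auto
        with * show "c n * (\<Sum>k\<in>{1..M div n}. (t ^ n) ^ k) \<le> c n * (t ^ n / (1 - t ^ n)) + t ^ M / (1 - t)"
          unfolding x_def by (simp add: right_diff_distrib)
      qed
      also have "\<dots> = (\<Sum>n\<in>{1..M}. c n * (t ^ n / (1 - t ^ n))) + real M * t ^ M / (1 - t)"
        by (simp add: sum.distrib)
      \<comment> \<open>Splitting off \<open>1 / (n * (1 - t))\<close> isolates the partial sum at 1
        and leaves \<open>- b n\<close>.\<close>
      also have "(\<Sum>n\<in>{1..M}. c n * (t ^ n / (1 - t ^ n))) = (\<Sum>n\<in>{1..M}. c n * (1 / real n) / (1 - t)) - (\<Sum>n\<in>{1..M}. c n * b n)"
        unfolding b_def sum_subtractf[symmetric] by (intro sum.cong) (simp_all add: right_diff_distrib)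
      also have "(\<Sum>n\<in>{1..M}. c n * (1 / real n) / (1 - t)) = (\<Sum>n\<in>{1..M}. c n * (1 / real n)) / (1 - t)"
        by (simp add: sum_divide_distrib)
      finally have le: "(\<Sum>j\<in>{1..J}. t ^ (j ^ 2)) \<le> (\<Sum>n\<in>{1..M}. c n * (1 / real n)) / (1 - t) -
          (\<Sum>n\<in>{1..M}. c n * b n) + real M * t ^ M / (1 - t)" .
      have "(\<Sum>n\<in>{1..M}. c n * (1 / real n)) \<le> norm (T M)"
      proof -
        have "T M = (\<Sum>n\<in>{1..M}. \<psi> n * of_real (real n powr - 1))"
          unfolding T_def lessThan_Suc_atMost by (rule sum.mono_neutral_right) (auto simp: Suc_le_eq)
        also have "\<dots> = of_real (\<Sum>n\<in>{1..M}. c n * (1 / real n))"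
          unfolding of_real_sum by (intro sum.cong) (auto simp: \<psi>_c powr_minus_divide)
        finally have "norm (T M) = \<bar>\<Sum>n\<in>{1..M}. c n * (1 / real n)\<bar>" by (simp only: norm_of_real)
        thus ?thesis by linarith
      qed
      hence "(\<Sum>n\<in>{1..M}. c n * (1 / real n)) / (1 - t) \<le> norm (T M) / (1 - t)"
        using t by (intro divide_right_mono) auto
      moreover have "- (\<Sum>n\<in>{1..M}. c n * b n) \<le> 2 * real N"
      proof -
        have "norm (\<Sum>n\<in>{1..<Suc M}. \<psi> n * of_real (b n)) \<le> 2 * real N * b 1"
          by (rule abel_summation_bound[where b = b and m = 1, OF norm_sum_dirichlet_character_le[OF \<psi> N] b])
        also have "(\<Sum>n\<in>{1..<Suc M}. \<psi> n * of_real (b n)) = of_real (\<Sum>n\<in>{1..M}. c n * b n)"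
          by (simp add: \<psi>_c atLeastLessThanSuc_atLeastAtMost)
        finally have "\<bar>\<Sum>n\<in>{1..M}. c n * b n\<bar> \<le> 2 * real N" by (simp add: b_1[simplified] del: of_real_sum)
        thus ?thesis by linarith
      qed
      ultimately show ?thesis using le by linarith
    qed
    have "(\<lambda>M. norm (T M) / (1 - t) + 2 * real N + real M * t ^ M / (1 - t)) \<longlonglongrightarrow>
        norm (0 :: complex) / (1 - t) + 2 * real N + 0 / (1 - t)"
      using t by (intro tendsto_add tendsto_divide tendsto_norm T_lim tendsto_const powser_times_n_limit_0) auto
    hence "(\<lambda>M. norm (T M) / (1 - t) + 2 * real N + real M * t ^ M / (1 - t)) \<longlonglongrightarrow> 2 * real N" by simp
    thus ?thesis by (rule LIMSEQ_le_const) (use main in blast)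
  qed
  \<comment> \<open>As t tends to 1 the sum of \<open>J\<close> powers tends to \<open>J\<close>,
    one more than the bound.\<close>
  define J where "J = 2 * N + 1"
  have "((\<lambda>t::real. \<Sum>j\<in>{1..J}. t ^ (j ^ 2)) \<longlongrightarrow> (\<Sum>j\<in>{1..J}. 1 ^ (j ^ 2))) (at_left 1)"
    by (intro tendsto_intros)
  moreover have "eventually (\<lambda>t::real. (\<Sum>j\<in>{1..J}. t ^ (j ^ 2)) \<le> 2 * real N) (at_left 1)"
    unfolding eventually_at_left_field using bound by (intro exI[of _ 0]) auto
  ultimately have "(\<Sum>j\<in>{1..J}. 1 ^ (j ^ 2)) \<le> 2 * real N"
    by (intro tendsto_upperbound) auto
  thus False by (simp add: J_def)
qed

section \<open>Dirichlet's theorem on primes in arithmetic progressions\<close>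

lemma L_one_nonzero:
  assumes "\<psi> \<in> dirichlet_characters N" "\<psi> \<noteq> principal_character N" "N > 0"
  shows "L_one \<psi> \<noteq> 0"
  using L_one_nonzero_real[OF assms] L_one_nonzero_complex[OF assms] by blast

text \<open>In \<open>dirichlet_series_mangoldt\<close> the right-hand side is bounded, and near 1
  the first factor stays above half of \<open>norm (L_one \<psi>)\<close>, on an interval given by
  the Lipschitz bound.\<close>

lemma norm_dirichlet_series_mangoldt_bounded:
  assumes \<psi>: "\<psi> \<in> dirichlet_characters N" "\<psi> \<noteq> principal_character N" and N: "N > 0"
  shows "\<exists>B. eventually (\<lambda>s. norm (dirichlet_series (\<lambda>n. \<psi> n * mangoldt n) s) \<le> B) (at_right 1)"
proof -
  define C where "C = 1 + 2 * real N"
  define l where "l = norm (L_one \<psi>)"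
  have "C > 0" "l > 0" using L_one_nonzero[OF \<psi> N] by (auto simp: C_def l_def)
  have "norm (dirichlet_series (\<lambda>n. \<psi> n * mangoldt n) s) \<le> 2 * C / l"
    if s: "1 < s" "s < 1 + l / (2 * C)" for s
  proof -
    have "C * (s - 1) \<le> l / 2" using s \<open>C > 0\<close> by (simp add: field_simps)
    moreover have "norm (dirichlet_series \<psi> s - L_one \<psi>) \<le> C * (s - 1)"
      unfolding C_def by (rule norm_L_diff_L_one_le[OF \<psi> N s(1)])
    moreover have "l \<le> norm (dirichlet_series \<psi> s) + norm (dirichlet_series \<psi> s - L_one \<psi>)"
      unfolding l_def using norm_triangle_sub[of "L_one \<psi>" "dirichlet_series \<psi> s"]
      by (simp add: norm_minus_commute)
    ultimately have L: "norm (dirichlet_series \<psi> s) \<ge> l / 2" by linarith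
    have "l / 2 * norm (dirichlet_series (\<lambda>n. \<psi> n * mangoldt n) s) \<le>
        norm (dirichlet_series \<psi> s) * norm (dirichlet_series (\<lambda>n. \<psi> n * mangoldt n) s)"
      using L by (rule mult_right_mono) simp
    also have "\<dots> = norm (dirichlet_series (\<lambda>n. \<psi> n * of_real (ln (real n))) s)"
      unfolding norm_mult[symmetric] dirichlet_series_mangoldt[OF \<psi>(1) N s(1)] ..
    also have "\<dots> \<le> C" unfolding C_def by (rule norm_dirichlet_series_ln_le[OF \<psi> N s(1)])
    finally show ?thesis using \<open>l > 0\<close> by (simp add: field_simps)
  qed
  hence "eventually (\<lambda>s. norm (dirichlet_series (\<lambda>n. \<psi> n * mangoldt n) s) \<le> 2 * C / l) (at_right 1)"
    unfolding eventually_at_right_field using \<open>C > 0\<close> \<open>l > 0\<close> by (intro exI[of _ "1 + l / (2 * C)"]) auto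
  thus ?thesis ..
qed

text \<open>The numbers \<open>j * N + 1\<close> are prime to \<open>N\<close> and at most
  \<open>N * (j + 1)\<close>, which gives the harmonic series as a minorant up to the factor
  \<open>N\<close>.\<close>

lemma sum_inverse_coprime_unbounded:
  assumes N: "N > 0"
  shows "\<exists>M. B \<le> (\<Sum>n<M. of_bool (coprime n N) * real n powr - 1)"
proof -
  have "\<not> summable (\<lambda>n. inverse (real (Suc n)))"
    using not_summable_harmonic[where 'a = real] by (subst summable_Suc_iff)
  hence "\<exists>J. \<not> (\<Sum>j<J. inverse (real (Suc j))) \<le> real N * B"
    using summableI_nonneg_bounded[of "\<lambda>n. inverse (real (Suc n))" "real N * B"] by auto
  then obtain J where J: "real N * B < (\<Sum>j<J. inverse (real (Suc j)))" by (auto simp: not_le)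
  define f where "f j = j * N + 1" for j
  have "inj_on f {..<J}" using N by (auto simp: f_def inj_on_def)
  have "(\<Sum>j<J. inverse (real (Suc j))) \<le> (\<Sum>j<J. real N * real (f j) powr - 1)"
  proof (rule sum_mono)
    fix j
    have "real (f j) \<le> real N * real (Suc j)" using N unfolding f_def by (simp add: algebra_simps Suc_leI)
    hence "inverse (real N * real (Suc j)) \<le> inverse (real (f j))"
    proof (rule le_imp_inverse_le)
      show "0 < real (f j)" unfolding of_nat_0_less_iff by (simp add: f_def)
    qed
    hence "real N * inverse (real N * real (Suc j)) \<le> real N * inverse (real (f j))"
      by (intro mult_left_mono) auto
    moreover have "real N * inverse (real N * real (Suc j)) = inverse (real (Suc j))"
      using N by (simp del: of_nat_Suc)
    ultimately show "inverse (real (Suc j)) \<le> real N * real (f j) powr - 1"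
      by (simp only: powr_minus powr_one of_nat_0_le_iff)
  qed
  also have "\<dots> = real N * (\<Sum>n\<in>f ` {..<J}. of_bool (coprime n N) * real n powr - 1)"
  proof -
    have "coprime (f j) N" for j
      unfolding f_def by (metis coprime_mult_self_right_iff gcd_add_mult coprime_iff_gcd_eq_1 gcd.commute gcd_1_nat add.commute)
    thus ?thesis using \<open>inj_on f {..<J}\<close> by (simp add: sum.reindex sum_distrib_left)
  qed
  also have "\<dots> \<le> real N * (\<Sum>n<J * N + 1. of_bool (coprime n N) * real n powr - 1)"
    using N by (intro mult_left_mono sum_mono2) (auto simp: f_def)
  finally have "real N * B < real N * (\<Sum>n<J * N + 1. of_bool (coprime n N) * real n powr - 1)"
    using J by linarith
  hence "B < (\<Sum>n<J * N + 1. of_bool (coprime n N) * real n powr - 1)"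
    by (rule mult_less_cancel_left_pos[THEN iffD1, rotated]) (use N in simp)
  thus ?thesis using less_imp_le by blast
qed

text \<open>With nonnegative coefficients the norm is the value itself, so real estimates of partial
  sums transfer to the complex series.\<close>

lemma norm_dirichlet_series_nonneg:
  fixes q :: "nat \<Rightarrow> real"
  assumes "s > 1" "\<And>n. 0 \<le> q n" "\<And>n. n > 0 \<Longrightarrow> q n \<le> 1 + ln (real n)"
  shows "(\<lambda>M. \<Sum>n<M. q n * real n powr - s) \<longlonglongrightarrow> norm (dirichlet_series (\<lambda>n. of_real (q n)) s)"
proof -
  have "(\<lambda>M. norm (\<Sum>n<M. of_real (q n) * complex_of_real (real n powr - s))) \<longlonglongrightarrow>
      norm (dirichlet_series (\<lambda>n. of_real (q n)) s)"
    using assms by (intro tendsto_norm dirichlet_series_partial_sums) auto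
  moreover have "norm (\<Sum>n<M. of_real (q n) * complex_of_real (real n powr - s)) = (\<Sum>n<M. q n * real n powr - s)" for M
  proof -
    have "(\<Sum>n<M. of_real (q n) * complex_of_real (real n powr - s)) = of_real (\<Sum>n<M. q n * real n powr - s)"
      by simp
    moreover have "(\<Sum>n<M. q n * real n powr - s) \<ge> 0" using assms(2) by (intro sum_nonneg) simp
    ultimately show ?thesis by (simp only: norm_of_real abs_of_nonneg)
  qed
  ultimately show ?thesis by simp
qed

text \<open>Takes the place of a pole: weighting by \<open>ln n\<close> multiplies the part with
  \<open>n \<ge> T\<close> by at least \<open>ln T\<close>, and the part below is at most
  \<open>T\<close>. Once the series exceeds \<open>2 * T\<close>, the quotient by it is at least
  \<open>ln T / 2\<close>.\<close>

lemma dirichlet_series_mangoldt_principal_unbounded: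
  assumes N: "N > 0"
  shows "eventually (\<lambda>s. B \<le> norm (dirichlet_series (\<lambda>n. principal_character N n * mangoldt n) s)) (at_right 1)"
proof -
  define q where "q n = (of_bool (coprime n N) :: real)" for n
  have q: "0 \<le> q n" "q n \<le> 1" for n by (simp_all add: q_def)
  have chi0: "principal_character N = (\<lambda>n. of_real (q n))"
    by (auto simp: principal_character_def q_def)
  \<comment> \<open>Makes \<open>ln T / 2\<close> at least the absolute value of
    \<open>B\<close>.\<close>
  define T where "T = nat \<lceil>exp (2 * \<bar>B\<bar>)\<rceil>"
  have lnT: "ln (real T) \<ge> 2 * \<bar>B\<bar>" and T: "T \<ge> 1"
  proof -
    have le: "exp (2 * \<bar>B\<bar>) \<le> real T" unfolding T_def by (rule real_nat_ceiling_ge)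
    moreover have "1 \<le> exp (2 * \<bar>B\<bar>)" by simp
    ultimately show "T \<ge> 1" by linarith
    show "ln (real T) \<ge> 2 * \<bar>B\<bar>" using le by (metis exp_gt_zero ln_exp ln_le_cancel_iff less_le_trans)
  qed
  obtain M0 where M0: "2 * real T + 1 \<le> (\<Sum>n<M0. q n * real n powr - 1)"
    using sum_inverse_coprime_unbounded[OF N, of "2 * real T + 1"] unfolding q_def by blast
  have "((\<lambda>s. \<Sum>n<M0. q n * real n powr - s) \<longlongrightarrow> (\<Sum>n<M0. q n * real n powr - 1)) (at_right 1)"
  proof (rule tendsto_sum)
    fix n show "((\<lambda>s. q n * real n powr - s) \<longlongrightarrow> q n * real n powr - 1) (at_right 1)"
    proof (cases "n = 0")
      case False
      thus ?thesis by (intro tendsto_intros) auto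
    qed simp
  qed
  hence "eventually (\<lambda>s. 2 * real T < (\<Sum>n<M0. q n * real n powr - s)) (at_right 1)"
    by (rule order_tendstoD) (use M0 in simp)
  moreover have "eventually (\<lambda>s. s > (1::real)) (at_right 1)" by (rule eventually_at_right_less)
  ultimately show ?thesis
  proof eventually_elim
    case (elim s)
    note s = elim(2)
    let ?L = "norm (dirichlet_series (principal_character N) s)"
    have Llim: "(\<lambda>M. \<Sum>n<M. q n * real n powr - s) \<longlonglongrightarrow> ?L"
      unfolding chi0 using q by (intro norm_dirichlet_series_nonneg s) (auto intro: order.trans[OF q(2)])
    have "(\<lambda>M. \<Sum>n<M. (q n * ln (real n)) * real n powr - s) \<longlonglongrightarrow>
        norm (dirichlet_series (\<lambda>n. of_real (q n * ln (real n))) s)"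
    proof (intro norm_dirichlet_series_nonneg s)
      show "0 \<le> q n * ln (real n)" for n using q by (cases "n = 0") auto
      show "q n * ln (real n) \<le> 1 + ln (real n)" if "n > 0" for n
        using that q[of n] mult_right_mono[of "q n" 1 "ln (real n)"] by simp
    qed
    hence lnlim: "(\<lambda>M. \<Sum>n<M. (q n * ln (real n)) * real n powr - s) \<longlonglongrightarrow>
        norm (dirichlet_series (\<lambda>n. principal_character N n * of_real (ln (real n))) s)"
      by (simp add: chi0)
    \<comment> \<open>Only terms below \<open>T\<close> can make \<open>ln n - ln T\<close>
      negative; each costs at most \<open>ln T\<close>, and there are at most \<open>T\<close> of
      them.\<close>
    have partial: "ln (real T) * ((\<Sum>n<M. q n * real n powr - s) - real T) \<le> (\<Sum>n<M. (q n * ln (real n)) * real n powr - s)" for M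
    proof -
      have "- (ln (real T) * real T) \<le> (\<Sum>n<M. if n < T then - ln (real T) else 0)"
      proof -
        have "(\<Sum>n<M. if n < T then - ln (real T) else 0) = - (ln (real T) * real (card {n. n < M \<and> n < T}))"
          by (simp add: sum.If_cases Int_def)
        moreover have "card {n. n < M \<and> n < T} \<le> card {..<T}" by (intro card_mono) auto
        ultimately show ?thesis using lnT by (simp add: mult_left_mono)
      qed
      also have "\<dots> \<le> (\<Sum>n<M. q n * real n powr - s * (ln (real n) - ln (real T)))"
      proof (rule sum_mono)
        fix n
        show "(if n < T then - ln (real T) else 0) \<le> q n * real n powr - s * (ln (real n) - ln (real T))"
        proof (cases "n = 0")
          case False
          have qp: "0 \<le> q n * real n powr - s" "q n * real n powr - s \<le> 1"
          proof -
            have "real n powr - s \<le> 1"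
              using False s powr_mono[of "- s" 0 "real n"] by simp
            thus "q n * real n powr - s \<le> 1" using q[of n] by (intro mult_le_one) auto
          qed (use q in simp)
          show ?thesis
          proof (cases "n < T")
            case True
            have "q n * real n powr - s * (ln (real T) - ln (real n)) \<le> 1 * ln (real T)"
              using qp True False by (intro mult_mono) auto
            thus ?thesis using True by (simp add: algebra_simps)
          next
            case nl: False
            hence "ln (real T) \<le> ln (real n)" using T by simp
            thus ?thesis using nl qp by simp
          qed
        qed (use lnT in auto)
      qed
      also have "\<dots> = (\<Sum>n<M. (q n * ln (real n)) * real n powr - s) - ln (real T) * (\<Sum>n<M. q n * real n powr - s)"
        by (simp add: sum_subtractf[symmetric] sum_distrib_left algebra_simps)
      finally show ?thesis by (simp add: algebra_simps)
    qed
    have ge: "ln (real T) * (?L - real T) \<le> norm (dirichlet_series (\<lambda>n. principal_character N n * of_real (ln (real n))) s)"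
      by (rule LIMSEQ_le[OF tendsto_mult[OF tendsto_const tendsto_diff[OF Llim tendsto_const]] lnlim])
        (use partial in blast)
    have "2 * real T \<le> ?L"
    proof (rule LIMSEQ_le_const[OF Llim], intro exI allI impI)
      fix M assume "M0 \<le> M"
      hence "(\<Sum>n<M0. q n * real n powr - s) \<le> (\<Sum>n<M. q n * real n powr - s)"
        using q by (intro sum_mono2) auto
      thus "2 * real T \<le> (\<Sum>n<M. q n * real n powr - s)" using elim(1) by linarith
    qed
    hence L: "?L - real T \<ge> ?L / 2" "?L > 0" using T by auto
    have "\<bar>B\<bar> * ?L = 2 * \<bar>B\<bar> * (?L / 2)" by simp
    also have "\<dots> \<le> ln (real T) * (?L - real T)"
      using L lnT by (intro mult_mono) auto
    also note ge
    also have "norm (dirichlet_series (\<lambda>n. principal_character N n * of_real (ln (real n))) s) =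
        norm (dirichlet_series (\<lambda>n. principal_character N n * mangoldt n) s) * ?L"
      unfolding dirichlet_series_mangoldt[OF principal_character N s, symmetric] norm_mult by (rule mult.commute)
    finally have "\<bar>B\<bar> \<le> norm (dirichlet_series (\<lambda>n. principal_character N n * mangoldt n) s)"
      using L(2) by (simp add: mult_le_cancel_right)
    thus ?case by linarith
  qed
qed

lemma sum_powers_from_two_le:
  fixes x :: real
  assumes "0 \<le> x" "x \<le> 1 / 2"
  shows "(\<Sum>k\<in>{2..<M}. x ^ k) \<le> 2 * x\<^sup>2"
proof (cases "M \<ge> 2")
  case True
  hence "(\<Sum>k\<in>{2..<M}. x ^ k) \<le> 2 * x\<^sup>2 - 2 * x ^ M"
  proof (induction M rule: dec_induct)
    case (step M)
    have "x * x ^ M \<le> 1 / 2 * x ^ M" using assms by (intro mult_right_mono) auto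
    thus ?case using step by simp
  qed simp
  thus ?thesis using assms by (smt (verit) zero_le_power)
qed (use assms in auto)

text \<open>Only prime powers count, and for each \<open>p\<close> the exponents from 2 on
  contribute at most \<open>2 * ln p / p\<^sup>2\<close>, which is summable.\<close>

lemma sum_mangoldt_nonprime_bounded:
  "\<exists>C. \<forall>M. (\<Sum>n | n < M \<and> \<not> Factorial_Ring.prime n. mangoldt n * real n powr - 1) \<le> C"
proof (intro exI allI)
  fix M :: nat
  let ?f = "\<lambda>(p, k). p ^ k :: nat"
  define I where "I = {p. p < M \<and> Factorial_Ring.prime p} \<times> {2..<M}"
  have "finite I" by (simp add: I_def)
  let ?g = "\<lambda>n. mangoldt n * real n powr - 1 :: real"
  have "(\<Sum>n | n < M \<and> \<not> Factorial_Ring.prime n. ?g n) = (\<Sum>n | n < M \<and> \<not> Factorial_Ring.prime n \<and> primepow n. ?g n)"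
    by (rule sum.mono_neutral_right) (auto simp: mangoldt_def)
  also have "\<dots> \<le> (\<Sum>n\<in>?f ` I. ?g n)"
  proof (rule sum_mono2)
    show "{n. n < M \<and> \<not> Factorial_Ring.prime n \<and> primepow n} \<subseteq> ?f ` I"
    proof
      fix n assume "n \<in> {n. n < M \<and> \<not> Factorial_Ring.prime n \<and> primepow n}"
      then obtain p k where pk: "n < M" "\<not> Factorial_Ring.prime n" "Factorial_Ring.prime p" "k > 0" "n = p ^ k"
        by (auto simp: primepow_def)
      have "k \<noteq> 1" using pk by auto
      moreover have "p \<le> p ^ k" using prime_ge_1_nat[OF pk(3)] pk(4) by (intro self_le_power) auto
      moreover have "k < p ^ k" using prime_gt_1_nat[OF pk(3)] by (simp add: power_gt_expt)
      ultimately show "n \<in> ?f ` I" using pk by (intro image_eqI[of _ _ "(p, k)"]) (auto simp: I_def)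
    qed
  qed (use \<open>finite I\<close> in \<open>auto simp: mangoldt_nonneg\<close>)
  also have "\<dots> \<le> sum (?g \<circ> ?f) I"
    by (rule sum_image_le[OF \<open>finite I\<close>]) (simp add: mangoldt_nonneg)
  also have "\<dots> = (\<Sum>p | p < M \<and> Factorial_Ring.prime p. \<Sum>k\<in>{2..<M}. ?g (p ^ k))"
    by (subst sum.cartesian_product) (simp only: I_def comp_def case_prod_unfold)
  also have "\<dots> \<le> (\<Sum>p | p < M \<and> Factorial_Ring.prime p. 2 * (ln (real p) * real p powr - 2))"
  proof (rule sum_mono)
    fix p assume "p \<in> {p. p < M \<and> Factorial_Ring.prime p}"
    hence p: "Factorial_Ring.prime p" by simp
    have p2: "real p \<ge> 2" using prime_ge_2_nat[OF p] by simp
    have "(\<Sum>k\<in>{2..<M}. ?g (p ^ k)) = ln (real p) * (\<Sum>k\<in>{2..<M}. (1 / real p) ^ k)"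
      unfolding sum_distrib_left
      using p p2 by (intro sum.cong) (auto simp: powr_minus_divide power_one_over)
    also have "\<dots> \<le> ln (real p) * (2 * (1 / real p)\<^sup>2)"
      using p2 by (intro mult_left_mono sum_powers_from_two_le) auto
    also have "\<dots> = 2 * (ln (real p) * real p powr - 2)"
      using p2 by (simp add: powr_minus_divide power_one_over)
    finally show "(\<Sum>k\<in>{2..<M}. ?g (p ^ k)) \<le> 2 * (ln (real p) * real p powr - 2)" .
  qed
  also have "\<dots> = 2 * (\<Sum>p | p < M \<and> Factorial_Ring.prime p. ln (real p) * real p powr - 2)"
    by (simp add: sum_distrib_left)
  also have "(\<Sum>p | p < M \<and> Factorial_Ring.prime p. ln (real p) * real p powr - 2) \<le>
      infsum (\<lambda>n. ln (real n) * real n powr - 2) {0<..}"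
    by (rule finite_sum_le_infsum) (auto intro: summable_on_ln_powr dest: prime_gt_0_nat)
  finally show "(\<Sum>n | n < M \<and> \<not> Factorial_Ring.prime n. ?g n) \<le>
      2 * infsum (\<lambda>n. ln (real n) * real n powr - 2) {0<..}" by simp
qed

text \<open>The primes contribute a finite sum and the higher prime powers a bounded amount, both
  uniformly in \<open>s\<close>.\<close>

lemma dirichlet_series_mangoldt_finite_class_bounded:
  assumes "finite {p. Factorial_Ring.prime p \<and> p \<in> A}"
  shows "\<exists>K. \<forall>s>1. norm (dirichlet_series (\<lambda>n. of_bool (n \<in> A) * mangoldt n) s) \<le> K"
proof -
  let ?S = "{p. Factorial_Ring.prime p \<and> p \<in> A}"
  obtain C where C: "\<And>M. (\<Sum>n | n < M \<and> \<not> Factorial_Ring.prime n. mangoldt n * real n powr - 1) \<le> C"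
    using sum_mangoldt_nonprime_bounded by blast
  define q where "q n = of_bool (n \<in> A) * (mangoldt n :: real)" for n
  have q: "0 \<le> q n" "q n \<le> mangoldt n" for n by (auto simp: q_def mangoldt_nonneg)
  have "norm (dirichlet_series (\<lambda>n. of_bool (n \<in> A) * mangoldt n) s) \<le> (\<Sum>p\<in>?S. mangoldt p) + C" if s: "s > 1" for s
  proof -
    have eq: "(\<lambda>n. of_bool (n \<in> A) * mangoldt n) = (\<lambda>n. complex_of_real (q n))"
      by (auto simp: q_def)
    have lim: "(\<lambda>M. \<Sum>n<M. q n * real n powr - s) \<longlonglongrightarrow> norm (dirichlet_series (\<lambda>n. of_real (q n)) s)"
    proof (rule norm_dirichlet_series_nonneg[OF s q(1)])
      show "q n \<le> 1 + ln (real n)" if "n > 0" for n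
        using q(2)[of n] mangoldt_le[OF that] by linarith
    qed
    have "(\<Sum>n<M. q n * real n powr - s) \<le> (\<Sum>p\<in>?S. mangoldt p) + C" for M
    proof -
      have powr: "real n powr - s \<le> real n powr - 1" "real n powr - s \<le> 1" if "n > 0" for n
        using that s powr_mono[of "- s" "- 1" "real n"] powr_mono[of "- s" 0 "real n"] by auto
      have split: "{..<M} = {n. n < M \<and> Factorial_Ring.prime n} \<union> {n. n < M \<and> \<not> Factorial_Ring.prime n}" by auto
      have "(\<Sum>n<M. q n * real n powr - s) = (\<Sum>n | n < M \<and> Factorial_Ring.prime n. q n * real n powr - s)
          + (\<Sum>n | n < M \<and> \<not> Factorial_Ring.prime n. q n * real n powr - s)"
        by (subst split, rule sum.union_disjoint) auto
      also have "(\<Sum>n | n < M \<and> Factorial_Ring.prime n. q n * real n powr - s) \<le> (\<Sum>p\<in>?S. mangoldt p)"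
      proof -
        have "(\<Sum>n | n < M \<and> Factorial_Ring.prime n. q n * real n powr - s) =
            (\<Sum>n | n < M \<and> n \<in> ?S. q n * real n powr - s)"
          by (rule sum.mono_neutral_right) (auto simp: q_def)
        also have "\<dots> \<le> (\<Sum>n | n < M \<and> n \<in> ?S. mangoldt n)"
        proof (rule sum_mono)
          fix n assume "n \<in> {n. n < M \<and> n \<in> ?S}"
          hence "n > 0" by (auto dest: prime_gt_0_nat)
          thus "q n * real n powr - s \<le> mangoldt n"
            using mult_mono[OF q(2)[of n] powr(2)[of n]] by (simp add: mangoldt_nonneg)
        qed
        also have "\<dots> \<le> (\<Sum>p\<in>?S. mangoldt p)"
          using assms by (intro sum_mono2) (auto simp: mangoldt_nonneg simp del: mangoldt_prime)
        finally show ?thesis .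
      qed
      also have "(\<Sum>n | n < M \<and> \<not> Factorial_Ring.prime n. q n * real n powr - s) \<le>
          (\<Sum>n | n < M \<and> \<not> Factorial_Ring.prime n. mangoldt n * real n powr - 1)"
      proof (rule sum_mono)
        fix n
        show "q n * real n powr - s \<le> mangoldt n * real n powr - 1"
        proof (cases "n = 0")
          case False
          thus ?thesis by (intro mult_mono q(2) powr(1)) (simp_all add: mangoldt_nonneg)
        qed simp
      qed
      also have "\<dots> \<le> C" by (rule C)
      finally show ?thesis by simp
    qed
    thus ?thesis unfolding eq by (intro LIMSEQ_le_const2[OF lim]) auto
  qed
  thus ?thesis by blast
qed

text \<open>With finitely many primes in the class its series \<open>G\<close> stays bounded. By
  orthogonality \<open>card D\<close> times \<open>G\<close> is a combination of the
  \<open>F \<psi>\<close>, of which only the principal one is unbounded near 1.\<close>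

theorem dirichlet_primes_in_arithmetic_progressions:
  assumes N: "N > 0" and a: "coprime a N"
  shows "infinite {p::nat. Factorial_Ring.prime p \<and> [p = a] (mod N)}"
proof
  assume fin: "finite {p::nat. Factorial_Ring.prime p \<and> [p = a] (mod N)}"
  define D where "D = dirichlet_characters N"
  have "finite D" unfolding D_def by (rule finite_dirichlet_characters[OF N])
  define F where "F \<psi> = dirichlet_series (\<lambda>n. \<psi> n * mangoldt n)" for \<psi>
  define G where "G = dirichlet_series (\<lambda>n. of_bool (n \<in> {n. [n = a] (mod N)}) * mangoldt n)"
  obtain K where K: "\<And>s. s > 1 \<Longrightarrow> norm (G s) \<le> K"
    using dirichlet_series_mangoldt_finite_class_bounded[of "{n. [n = a] (mod N)}"] fin
    unfolding G_def by auto
  \<comment> \<open>The value \<open>\<psi> a'\<close> at an inverse of \<open>a\<close> takes the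
    place of the conjugate of \<open>\<psi> a\<close>.\<close>
  obtain a' where a': "[a * a' = 1] (mod N)"
    using cong_solve_coprime_nat[OF a] by auto
  have "coprime a' N"
    using cong_imp_coprime[OF cong_sym[OF a']] by simp
  have orth: "(\<Sum>\<psi>\<in>D. \<psi> a' * \<psi> n) = of_nat (card D) * of_bool ([n = a] (mod N))" for n
  proof (cases "coprime n N")
    case True
    have "[a' * n = 1] (mod N) \<longleftrightarrow> [n = a] (mod N)"
    proof
      assume "[a' * n = 1] (mod N)"
      hence "[a * (a' * n) = a * 1] (mod N)" by (rule cong_mult[OF cong_refl])
      moreover have "[a * a' * n = 1 * n] (mod N)" by (rule cong_mult[OF a' cong_refl])
      ultimately show "[n = a] (mod N)" by (metis cong_sym cong_trans mult.assoc mult.right_neutral mult_1)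
    next
      assume "[n = a] (mod N)"
      hence "[a' * n = a' * a] (mod N)" by (rule cong_mult[OF cong_refl])
      thus "[a' * n = 1] (mod N)" using a' by (metis cong_trans mult.commute)
    qed
    moreover have "(\<Sum>\<psi>\<in>D. \<psi> a' * \<psi> n) = (\<Sum>\<psi>\<in>D. \<psi> (a' * n))"
      by (intro sum.cong) (auto simp: D_def dirichlet_characterD(1))
    ultimately show ?thesis
      using sum_dirichlet_characters[OF N, of "a' * n"] True \<open>coprime a' N\<close> by (simp add: D_def)
  next
    case False
    hence "\<psi> n = 0" if "\<psi> \<in> D" for \<psi> using dirichlet_characterD(2)[of \<psi> N n] that by (auto simp: D_def)
    hence "(\<Sum>\<psi>\<in>D. \<psi> a' * \<psi> n) = 0" by (intro sum.neutral ballI) simp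
    moreover have "\<not> [n = a] (mod N)" using False a cong_imp_coprime[OF cong_sym] by blast
    ultimately show ?thesis by simp
  qed
  have identity: "(\<Sum>\<psi>\<in>D. \<psi> a' * F \<psi> s) = of_nat (card D) * G s" if s: "s > 1" for s
  proof (rule LIMSEQ_unique)
    have F_lim: "(\<lambda>M. \<Sum>n<M. \<psi> n * mangoldt n * of_real (real n powr - s)) \<longlonglongrightarrow> F \<psi> s" if "\<psi> \<in> D" for \<psi>
      unfolding F_def using that norm_dirichlet_character_le[of \<psi> N, OF _ N]
      by (intro dirichlet_series_partial_sums[OF s] norm_mult_mangoldt_le) (auto simp: D_def)
    thus "(\<lambda>M. \<Sum>\<psi>\<in>D. \<psi> a' * (\<Sum>n<M. \<psi> n * mangoldt n * of_real (real n powr - s))) \<longlonglongrightarrow> (\<Sum>\<psi>\<in>D. \<psi> a' * F \<psi> s)"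
      by (intro tendsto_sum tendsto_mult tendsto_const)
    have "(\<lambda>M. \<Sum>n<M. of_bool (n \<in> {n. [n = a] (mod N)}) * mangoldt n * complex_of_real (real n powr - s)) \<longlonglongrightarrow> G s"
      unfolding G_def by (intro dirichlet_series_partial_sums[OF s] norm_mult_mangoldt_le) auto
    hence "(\<lambda>M. of_nat (card D) * (\<Sum>n<M. of_bool (n \<in> {n. [n = a] (mod N)}) * mangoldt n * complex_of_real (real n powr - s)))
        \<longlonglongrightarrow> of_nat (card D) * G s"
      by (intro tendsto_mult tendsto_const)
    moreover have "(\<Sum>\<psi>\<in>D. \<psi> a' * (\<Sum>n<M. \<psi> n * mangoldt n * of_real (real n powr - s))) =
        of_nat (card D) * (\<Sum>n<M. of_bool (n \<in> {n. [n = a] (mod N)}) * mangoldt n * of_real (real n powr - s))" for M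
    proof -
      have "(\<Sum>\<psi>\<in>D. \<psi> a' * (\<Sum>n<M. \<psi> n * mangoldt n * of_real (real n powr - s))) =
          (\<Sum>n<M. (\<Sum>\<psi>\<in>D. \<psi> a' * \<psi> n) * (mangoldt n * of_real (real n powr - s)))"
        unfolding sum_distrib_left sum_distrib_right by (subst sum.swap) (simp add: mult.assoc)
      also have "\<dots> = (\<Sum>n<M. of_nat (card D) * (of_bool (n \<in> {n. [n = a] (mod N)}) * mangoldt n * of_real (real n powr - s)))"
        unfolding orth by (simp add: mult.assoc)
      finally show ?thesis by (simp only: sum_distrib_left)
    qed
    ultimately show "(\<lambda>M. \<Sum>\<psi>\<in>D. \<psi> a' * (\<Sum>n<M. \<psi> n * mangoldt n * of_real (real n powr - s))) \<longlonglongrightarrow> of_nat (card D) * G s"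
      by (simp only:)
  qed
  define Y where "Y = D - {principal_character N}"
  have "\<forall>\<psi>\<in>Y. \<exists>B. eventually (\<lambda>s. norm (F \<psi> s) \<le> B) (at_right 1)"
    using norm_dirichlet_series_mangoldt_bounded[OF _ _ N] by (auto simp: Y_def D_def F_def)
  then obtain B where "\<forall>\<psi>\<in>Y. eventually (\<lambda>s. norm (F \<psi> s) \<le> B \<psi>) (at_right 1)"
    by (rule bchoice[THEN exE])
  hence "eventually (\<lambda>s. \<forall>\<psi>\<in>Y. norm (F \<psi> s) \<le> B \<psi>) (at_right 1)"
    using \<open>finite D\<close> by (intro eventually_ball_finite) (simp_all add: Y_def)
  \<comment> \<open>One more than the bound on everything else in \<open>identity\<close>.\<close>
  moreover have "eventually (\<lambda>s. real (card D) * K + (\<Sum>\<psi>\<in>Y. B \<psi>) + 1 \<le> norm (F (principal_character N) s)) (at_right 1)"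
    unfolding F_def by (rule dirichlet_series_mangoldt_principal_unbounded[OF N])
  moreover have "eventually (\<lambda>s. s > (1::real)) (at_right 1)" by (rule eventually_at_right_less)
  ultimately have "eventually (\<lambda>s::real. False) (at_right 1)"
  proof eventually_elim
    case (elim s)
    have "principal_character N \<in> D"
      unfolding D_def by (rule principal_character)
    hence "(\<Sum>\<psi>\<in>D. \<psi> a' * F \<psi> s) = principal_character N a' * F (principal_character N) s + (\<Sum>\<psi>\<in>Y. \<psi> a' * F \<psi> s)"
      unfolding Y_def by (rule sum.remove[OF \<open>finite D\<close>])
    hence "F (principal_character N) s = of_nat (card D) * G s - (\<Sum>\<psi>\<in>Y. \<psi> a' * F \<psi> s)"
      using identity[OF elim(3)] \<open>coprime a' N\<close> by (simp add: principal_character_def)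
    hence "norm (F (principal_character N) s) \<le> norm (of_nat (card D) * G s) + norm (\<Sum>\<psi>\<in>Y. \<psi> a' * F \<psi> s)"
      by (metis norm_triangle_ineq4)
    also have "norm (of_nat (card D) * G s) \<le> real (card D) * K"
      using K[OF elim(3)] by (simp add: norm_mult mult_left_mono)
    also have "norm (\<Sum>\<psi>\<in>Y. \<psi> a' * F \<psi> s) \<le> (\<Sum>\<psi>\<in>Y. B \<psi>)"
    proof (rule sum_norm_le)
      fix \<psi> assume "\<psi> \<in> Y"
      hence "norm (\<psi> a') \<le> 1" "norm (F \<psi> s) \<le> B \<psi>"
        using elim(1) norm_dirichlet_character_le[of \<psi> N, OF _ N] by (auto simp: Y_def D_def)
      thus "norm (\<psi> a' * F \<psi> s) \<le> B \<psi>"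
        using mult_mono[of "norm (\<psi> a')" 1 "norm (F \<psi> s)" "B \<psi>"] by (simp add: norm_mult)
    qed
    finally show ?case using elim(2) by simp
  qed
  thus False by simp
qed

section \<open>The main result\<close>

lemma zeta_power_int_eq_cis:
  assumes "m > 0"
  shows "zeta m powi i = cis (2 * pi * of_int i / of_int m)"
proof -
  have "zeta m = cis (2 * pi / of_int m)"
    by (simp add: zeta_def cis_conv_exp mult_ac)
  thus ?thesis by (simp add: cis_power_int mult_ac)
qed

lemma cis_two_pi_rational_eq_1_imp_dvd:
  assumes "cis (2 * pi * of_int j / of_int m) = 1" "m > 0"
  shows "m dvd j"
proof -
  have "cos (2 * pi * of_int j / of_int m) = 1"
    using arg_cong[OF assms(1), of Re] by simp
  then obtain z :: int where "2 * pi * of_int j / of_int m = of_int z * 2 * pi"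
    by (auto simp: cos_one_2pi_int)
  hence "real_of_int j = of_int (z * m)" using assms(2) by (simp add: field_simps)
  hence "j = z * m" by linarith
  thus ?thesis by simp
qed

theorem proposition3p2:
  fixes \<epsilon> k k\<epsilon> :: int
  assumes "\<epsilon> \<in> {1, -1}"
    and "real_of_int k\<epsilon> = real_of_int k - 1 / 2 + real_of_int \<epsilon> / 2"
    and "k\<epsilon> \<ge> 1"
    and "\<not> [k\<epsilon> = 1] (mod 3)"
  shows "infinite {p :: nat. Factorial_Ring.prime p \<and> \<not> QuadRes (int p) 2 \<and>
           (\<forall>i::int. 1 \<le> i \<and> i \<le> k\<epsilon> \<longrightarrow>
              inertia_degree
                (rat_adjoin (zeta (2 * k\<epsilon> + 1) powi i + zeta (2 * k\<epsilon> + 1) powi (- i))) p \<ge> 2)}"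
proof -
  define n where "n = 2 * k\<epsilon> + 1"
  define m where "m = nat n"
  have n: "n > 0" "int m = n" "m > 0" using assms(3) by (auto simp: n_def m_def)
  have "odd n" by (simp add: n_def)
  hence "odd m" using n(2) by (metis even_of_nat)
  \<comment> \<open>3 divides \<open>2 * k\<epsilon> + 1\<close> exactly if
    \<open>k\<epsilon>\<close> is 1 modulo 3.\<close>
  have "\<not> 3 dvd n"
    using assms(4) unfolding n_def cong_iff_mod_eq by presburger
  hence coprime_3: "coprime n 3"
    using prime_imp_coprime[of "3 :: int" n] by (simp add: coprime_commute)
  have coprime_2: "coprime 2 m" using \<open>odd m\<close> by simp
  have coprime_8: "coprime (8 :: nat) j" if "coprime 2 j" for j
    using coprime_power_left_iff[of 2 3 j] that by simp
  \<comment> \<open>Combines the class that makes 2 a nonresidue with the one that makes the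
    Frobenius square \<omega>.\<close>
  obtain a where a: "[a = 3] (mod 8)" "[a = 2] (mod m)"
    using binary_chinese_remainder_nat[OF coprime_8[OF coprime_2]] by blast
  have "coprime (2 :: nat) 3" by simp
  hence "coprime (3 :: nat) 8" using coprime_8 by (simp only: coprime_commute)
  hence "coprime a 8" by (rule cong_imp_coprime[OF cong_sym[OF a(1)]])
  moreover have "coprime a m" by (rule cong_imp_coprime[OF cong_sym[OF a(2)] coprime_2])
  ultimately have "coprime a (8 * m)" by (simp only: coprime_mult_right_iff simp_thms)
  hence "infinite {p::nat. Factorial_Ring.prime p \<and> [p = a] (mod 8 * m)}"
    using n(3) by (intro dirichlet_primes_in_arithmetic_progressions) auto
  moreover have "{p::nat. Factorial_Ring.prime p \<and> [p = a] (mod 8 * m)} \<subseteq>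
      {p :: nat. Factorial_Ring.prime p \<and> \<not> QuadRes (int p) 2 \<and>
           (\<forall>i::int. 1 \<le> i \<and> i \<le> k\<epsilon> \<longrightarrow> inertia_degree (rat_adjoin (zeta n powi i + zeta n powi (- i))) p \<ge> 2)}"
  proof (intro subsetI CollectI conjI allI impI)
    fix p assume "p \<in> {p. Factorial_Ring.prime p \<and> [p = a] (mod 8 * m)}"
    hence p: "Factorial_Ring.prime p" "[p = a] (mod 8 * m)" by auto
    have "[p = a] (mod m * 8)" using p(2) by (simp only: mult.commute)
    hence p_cong: "[p = 3] (mod 8)" "[p = 2] (mod m)"
      using cong_trans[OF cong_modulus_mult_nat[OF p(2)] a(1)]
        cong_trans[OF cong_modulus_mult_nat[of p a m 8] a(2)] by blast+
    show "Factorial_Ring.prime p" by (rule p(1))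
    show "\<not> QuadRes (int p) 2" by (rule two_not_QuadRes_3_mod_8[OF p(1) p_cong(1)])
    fix i :: int assume i: "1 \<le> i \<and> i \<le> k\<epsilon>"
    define \<omega> where "\<omega> = zeta n powi i"
    have \<omega>: "\<omega> = cis (2 * pi * of_int i / of_int n)"
      unfolding \<omega>_def by (rule zeta_power_int_eq_cis[OF n(1)])
    have inv: "zeta n powi (- i) = inverse \<omega>"
      by (simp add: \<omega>_def power_int_minus)
    have "real m = real_of_int n" using n(2) by (metis of_int_of_nat_eq)
    hence "\<omega> ^ m = cis (2 * pi * of_int i)"
      unfolding \<omega> Complex.DeMoivre using n(1) by simp
    also have "\<dots> = 1" by (rule cis_multiple_2pi) simp
    finally have pow_m: "\<omega> ^ m = 1" .
    \<comment> \<open>As 3 is prime to \<open>n\<close>, equality would give \<open>n dvd i\<close>,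
      although \<open>0 < i\<close> and \<open>i < n\<close>.\<close>
    have pow_3: "\<omega> ^ 3 \<noteq> 1"
    proof
      assume "\<omega> ^ 3 = 1"
      hence "cis (2 * pi * of_int (3 * i) / of_int n) = 1"
        unfolding \<omega> Complex.DeMoivre by (simp add: mult_ac)
      hence "n dvd 3 * i" by (rule cis_two_pi_rational_eq_1_imp_dvd[OF _ n(1)])
      hence "n dvd i" using coprime_3 by (simp add: coprime_dvd_mult_right_iff)
      hence "n \<le> i" using i by (intro zdvd_imp_le) auto
      thus False using i by (simp add: n_def)
    qed
    have "coprime p m" by (rule cong_imp_coprime[OF cong_sym[OF p_cong(2)] coprime_2])
    have "algebraic_int \<omega>" "algebraic_int (inverse \<omega>)"
      by (rule algebraic_int_root_of_unity[of _ m]; simp add: pow_m n(3) power_inverse)+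
    hence "algebraic_int (\<omega> + inverse \<omega>)" by (rule algebraic_int_add_mult(1))
    hence "inertia_degree (rat_adjoin (\<omega> + inverse \<omega>)) p \<ge> 2"
      by (rule inertia_degree_ge_2[OF _ p(1) not_congruent_to_integer[OF pow_m pow_3 n(3) p(1) \<open>coprime p m\<close> p_cong(2)]])
    thus "2 \<le> inertia_degree (rat_adjoin (zeta n powi i + zeta n powi (- i))) p"
      unfolding inv \<omega>_def[symmetric] .
  qed
  ultimately show ?thesis
    unfolding n_def by (rule infinite_super[rotated])
qed

end
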